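(* Let $E$ be a vector space and $\mathcal A$ an FZ-complete algebra. Let $V$ be a (unital) vertex subalgebra of $\mathrm{End}_v(E)$ or of $\mathcal A[[z^\pm]]_H$. Then $V$ is associative if and only if $V$ is local.
   Context: Conventions: $\mathbb K$ is a field of characteristic $0$. All vector spaces are super ($\mathbb Z/2$-graded), multiplications are even, commutators $[\,,]$ of operators and algebra elements are supercommutators, $\zeta^{ab}=(-1)^{p(a)p(b)}$. $x^{(n)}=x^n/n!$. All associative algebras and all unbounded vertex algebras are unital. Let $\rho\in\mathbb Q^\times$ with $\rho^{-1}\in\mathbb N$. Vertex algebras: an unbounded $\lambda$-bracket on a vector space $V$ with even operator $T$ is an even linear map $V\otimes V\to V[[\lambda]]$, $[a_\lambda b]=\sum_{t\ge 0}a_tb\lambda^{(t)}$, with $T[a_\lambda b]=[Ta_\lambda b]+[a_\lambda Tb]$, $[Ta_\lambda b]=-\lambda[a_\lambda b]$. An unbounded vertex algebra is a (not necessarily associative) algebra $V$ with an even derivation $T$ and an unbounded $\lambda$-bracket; it is a vertex algebra if $[a_\lambda b]\in V[\lambda]$ always. An identity is a unit $1$ of the algebra with $[1_\lambda a]=[a_\lambda 1]=0$. A vertex subalgebra of an unbounded vertex algebra is a subspace containing $1$ and closed under $T$, the product and all coefficients $a_tb$ of the $\lambda$-bracket, which is itself a vertex algebra (i.e. $[a_\lambda b]$ is polynomial in $\lambda$ for its elements). A vertex algebra is associative if: (1) $[a,b]c=a(bc)-\zeta^{ab}b(ac)$ where $[a,b]=ab-\zeta^{ab}ba$; (2) $[[a_\lambda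 b]_\mu c]=[a_\lambda[b_{\mu-\lambda}c]]-\zeta^{ab}[b_{\mu-\lambda}[a_\lambda c]]$; (3) $[a_\lambda b]=-\zeta^{ab}[b_{-\lambda-T}a]$ where $[b_{-\lambda-T}a]=\sum_t(-\lambda-T)^{(t)}(b_ta)$; (4) $[a,b]=\sum_{i\ge0}(-1)^iT^{(i+1)}(a_ib)$; (5) $[a_\lambda bc]=[a_\lambda b]c+\zeta^{ab}b[a_\lambda c]+\int_0^\lambda d\mu\,[[a_\lambda b]_\mu c]$. A distribution with values in $W$ is a formal sum $a(z)=\sum_{t\in\mathbb Z}a_tz^{-t-1}$, $a_t\in W$; $\mathrm{res}_za(z)=a_0$. $\mathrm{End}_v(E)$ is the space of fields: distributions $a(z)$ with values in $\mathrm{End}(E)$ such that for every $b\in E$, $a_tb=0$ for $t\gg0$. It is an unbounded vertex algebra with $T=\partial_z$, $[a(w)_\lambda b(w)]=\mathrm{res}_z e^{(z-w)\lambda}[a(z),b(w)]$, product the normal ordered product $\sum_{t<0}a_tz^{-t-1}b(z)+\zeta^{ab}\,b(z)\sum_{t\ge0}a_tz^{-t-1}$, and identity $\mathrm{id}_E$. FZ-complete algebra: a $\rho\mathbb Z$-graded associative algebra $\mathcal A=\bigoplus\mathcal A_h$ with a topology on each $\mathcal A_h$ making it a topological vector space ($\mathbb K$ discrete) with $0$ having a neighbourhood basis of subspaces, such that the multiplications $\mathcal A_h\times\mathcal A_{k}\to\mathcal A_{h+k}$ are continuous, each $\mathcal A_h$ is complete and Hausdorff, and the topology of $\mathcal A_h$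 is coarser than (or equal to) the one for which the closures of $\sum_{l<k}\mathcal A_{h-l}\mathcal A_l$, $k\in\mathbb Z$, form a neighbourhood basis of $0$. $\mathcal A[[z^\pm]]_H=\bigoplus_{h\in\rho\mathbb Z}\mathcal A[[z^\pm]]_h$ where $\mathcal A[[z^\pm]]_h$ consists of $a(z)$ with $a_t\in\mathcal A_{h-t-1}$. It is an unbounded vertex algebra with the same formulas for $T$, the $\lambda$-bracket and the normal ordered product (whose coefficients are convergent sums) and identity $1$. A set of distributions is local if for any two of its elements there is $n\ge0$ with $(z-w)^n[a(z),b(w)]=0$. *)

theory Defs
  imports "HOL-Analysis.Analysis" "HOL-Library.Function_Algebras" "HOL-Library.Z2"
begin

section \<open>Graded and super vector spaces\<close>

text \<open>
  A vector space over a field \<open>'k\<close> is a type \<open>'v\<close> with a scalar multiplication \<open>s\<close>, or a subspace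
  of such. Gradings are families of subspaces; parities are elements of \<^typ>\<open>bit\<close>.
\<close>

definition decomposition ::
  "'i set \<Rightarrow> ('i \<Rightarrow> 'v::ab_group_add set) \<Rightarrow> 'v \<Rightarrow> ('i \<Rightarrow> 'v) \<Rightarrow> bool" where
  "decomposition I G x f \<longleftrightarrow>
     (\<forall>i\<in>I. f i \<in> G i) \<and> (\<forall>i. i \<notin> I \<longrightarrow> f i = 0) \<and> finite {i. f i \<noteq> 0} \<and>
     x = (\<Sum>i | f i \<noteq> 0. f i)"

definition component :: "'i set \<Rightarrow> ('i \<Rightarrow> 'v::ab_group_add set) \<Rightarrow> 'v \<Rightarrow> 'i \<Rightarrow> 'v" where
  "component I G x = (THE f. decomposition I G x f)"

definition graded_space ::
  "('k::field \<Rightarrow> 'v::ab_group_add \<Rightarrow> 'v) \<Rightarrow> 'i set \<Rightarrow> ('i \<Rightarrow> 'v set) \<Rightarrow> 'v set \<Rightarrow> bool" where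
  "graded_space s I G C \<longleftrightarrow>
     vector_space s \<and> module.subspace s C \<and>
     (\<forall>i\<in>I. module.subspace s (G i) \<and> G i \<subseteq> C) \<and>
     (\<forall>x\<in>C. \<exists>!f. decomposition I G x f)"

abbreviation super_space ::
  "('k::field \<Rightarrow> 'v::ab_group_add \<Rightarrow> 'v) \<Rightarrow> (bit \<Rightarrow> 'v set) \<Rightarrow> 'v set \<Rightarrow> bool" where
  "super_space s P C \<equiv> graded_space s UNIV P C"

abbreviation parity_part :: "(bit \<Rightarrow> 'v::ab_group_add set) \<Rightarrow> 'v \<Rightarrow> bit \<Rightarrow> 'v" where
  "parity_part P \<equiv> component UNIV P"

definition super_subspace ::
  "('k::field \<Rightarrow> 'v::ab_group_add \<Rightarrow> 'v) \<Rightarrow> (bit \<Rightarrow> 'v set) \<Rightarrow> 'v set \<Rightarrow> bool" where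
  "super_subspace s P S \<longleftrightarrow>
     module.subspace s S \<and> (\<forall>x\<in>S. \<forall>p. parity_part P x p \<in> S)"

text \<open>Multiplication by the Koszul sign \<open>\<zeta>\<^sup>a\<^sup>b\<close> for \<open>a\<close>, \<open>b\<close> of parity \<open>p\<close>, \<open>q\<close>.\<close>

definition koszul :: "bit \<Rightarrow> bit \<Rightarrow> 'v::ab_group_add \<Rightarrow> 'v" where
  "koszul p q x = (if p = 1 \<and> q = 1 then - x else x)"

definition supercomm ::
  "('w \<Rightarrow> 'w \<Rightarrow> 'w) \<Rightarrow> (bit \<Rightarrow> 'w::ab_group_add set) \<Rightarrow> 'w \<Rightarrow> 'w \<Rightarrow> 'w" where
  "supercomm m P x y =
     (\<Sum>p\<in>{0,1}. \<Sum>q\<in>{0,1}. m (parity_part P x p) (parity_part P y q)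
        - koszul p q (m (parity_part P y q) (parity_part P x p)))"

definition lin_on ::
  "('k \<Rightarrow> 'v::ab_group_add \<Rightarrow> 'v) \<Rightarrow> 'v set \<Rightarrow> ('v \<Rightarrow> 'v) \<Rightarrow> bool" where
  "lin_on s C f \<longleftrightarrow>
     (\<forall>x\<in>C. \<forall>y\<in>C. f (x + y) = f x + f y) \<and> (\<forall>c. \<forall>x\<in>C. f (s c x) = s c (f x))"

definition even_bilinear_on ::
  "('k \<Rightarrow> 'v::ab_group_add \<Rightarrow> 'v) \<Rightarrow> 'v set \<Rightarrow> (bit \<Rightarrow> 'v set) \<Rightarrow> ('v \<Rightarrow> 'v \<Rightarrow> 'v) \<Rightarrow> bool" where
  "even_bilinear_on s C P f \<longleftrightarrow>
     (\<forall>a\<in>C. \<forall>b\<in>C. f a b \<in> C) \<and>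
     (\<forall>a\<in>C. lin_on s C (f a)) \<and> (\<forall>b\<in>C. lin_on s C (\<lambda>a. f a b)) \<and>
     (\<forall>p q. \<forall>a\<in>P p. \<forall>b\<in>P q. f a b \<in> P (p + q))"


section \<open>Unbounded vertex algebras\<close>

text \<open>
  \<open>vbr A a b t\<close> is the coefficient \<open>a\<^sub>t b\<close> of \<open>\<lambda>\<^sup>t / t!\<close> in the \<open>\<lambda>\<close>-bracket of \<open>a\<close> and \<open>b\<close>.
\<close>

record ('k, 'v) valg =
  vcar :: "'v set"
  vscale :: "'k \<Rightarrow> 'v \<Rightarrow> 'v"
  vpar :: "bit \<Rightarrow> 'v set"
  vT :: "'v \<Rightarrow> 'v"
  vmul :: "'v \<Rightarrow> 'v \<Rightarrow> 'v"
  vbr :: "'v \<Rightarrow> 'v \<Rightarrow> nat \<Rightarrow> 'v"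
  vone :: 'v

definition unbounded_vertex_algebra :: "('k::field_char_0, 'v::ab_group_add) valg \<Rightarrow> bool" where
  "unbounded_vertex_algebra A \<longleftrightarrow>
     super_space (vscale A) (vpar A) (vcar A) \<and>
     even_bilinear_on (vscale A) (vcar A) (vpar A) (vmul A) \<and>
     (\<forall>a\<in>vcar A. vT A a \<in> vcar A) \<and> lin_on (vscale A) (vcar A) (vT A) \<and>
     (\<forall>p. \<forall>a\<in>vpar A p. vT A a \<in> vpar A p) \<and>
     (\<forall>a\<in>vcar A. \<forall>b\<in>vcar A. vT A (vmul A a b) = vmul A (vT A a) b + vmul A a (vT A b)) \<and>
     (\<forall>t. even_bilinear_on (vscale A) (vcar A) (vpar A) (\<lambda>a b. vbr A a b t)) \<and>
     (\<forall>a\<in>vcar A. \<forall>b\<in>vcar A. \<forall>t. vT A (vbr A a b t) = vbr A (vT A a) b t + vbr A a (vT A b) t) \<and>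
     (\<forall>a\<in>vcar A. \<forall>b\<in>vcar A. \<forall>t.
        vbr A (vT A a) b t = (if t = 0 then 0 else - vscale A (of_nat t) (vbr A a b (t - 1)))) \<and>
     vone A \<in> vcar A \<and>
     (\<forall>a\<in>vcar A. vmul A (vone A) a = a \<and> vmul A a (vone A) = a \<and>
        (\<forall>t. vbr A (vone A) a t = 0 \<and> vbr A a (vone A) t = 0))"

definition polynomial_bracket_on ::
  "('k, 'v::ab_group_add) valg \<Rightarrow> 'v set \<Rightarrow> bool" where
  "polynomial_bracket_on A V \<longleftrightarrow> (\<forall>a\<in>V. \<forall>b\<in>V. \<exists>N. \<forall>t\<ge>N. vbr A a b t = 0)"

definition vertex_algebra :: "('k::field_char_0, 'v::ab_group_add) valg \<Rightarrow> bool" where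
  "vertex_algebra A \<longleftrightarrow> unbounded_vertex_algebra A \<and> polynomial_bracket_on A (vcar A)"

definition restrict_valg :: "('k, 'v) valg \<Rightarrow> 'v set \<Rightarrow> ('k, 'v) valg" where
  "restrict_valg A V = A\<lparr>vcar := V, vpar := (\<lambda>p. vpar A p \<inter> V)\<rparr>"

definition vertex_subalgebra ::
  "('k::field_char_0, 'v::ab_group_add) valg \<Rightarrow> 'v set \<Rightarrow> bool" where
  "vertex_subalgebra A V \<longleftrightarrow>
     V \<subseteq> vcar A \<and> super_subspace (vscale A) (vpar A) V \<and> vone A \<in> V \<and>
     (\<forall>a\<in>V. vT A a \<in> V) \<and>
     (\<forall>a\<in>V. \<forall>b\<in>V. vmul A a b \<in> V \<and> (\<forall>t. vbr A a b t \<in> V)) \<and>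
     polynomial_bracket_on A V"

text \<open>
  The identities between \<open>\<lambda>\<close>-brackets are stated coefficientwise in the basis
  \<open>\<lambda>\<^sup>m / m!\<close>, \<open>\<mu>\<^sup>n / n!\<close>, on parity-homogeneous elements. For
  \<open>G(\<lambda>,\<mu>) = \<Sum> G i j (\<lambda>\<^sup>i / i!) (\<mu>\<^sup>j / j!)\<close>, the binomial theorem gives the coefficient
  \<open>subst_mu_minus_lambda s G m n\<close> of \<open>G(\<lambda>, \<mu> - \<lambda>)\<close>. In the Wick formula,
  \<open>(\<lambda>\<^sup>i / i!) \<integral>\<^sub>0\<^sup>\<lambda> (\<mu>\<^sup>j / j!) d\<mu>\<close> is \<open>(i + j + 1) choose i\<close> times \<open>\<lambda>\<^sup>n / n!\<close> with \<open>n = i + j + 1\<close>.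
\<close>

definition subst_mu_minus_lambda ::
  "('k::field_char_0 \<Rightarrow> 'v::ab_group_add \<Rightarrow> 'v) \<Rightarrow> (nat \<Rightarrow> nat \<Rightarrow> 'v) \<Rightarrow> nat \<Rightarrow> nat \<Rightarrow> 'v" where
  "subst_mu_minus_lambda s G m n =
     (\<Sum>l\<le>m. s ((-1) ^ l * of_nat (m choose l)) (G (m - l) (n + l)))"

definition divT :: "('k::field_char_0, 'v) valg \<Rightarrow> nat \<Rightarrow> 'v \<Rightarrow> 'v" where
  "divT A j x = vscale A (inverse (fact j)) ((vT A ^^ j) x)"

definition finsum :: "(nat \<Rightarrow> 'v::ab_group_add) \<Rightarrow> 'v" where
  "finsum f = (\<Sum>n | f n \<noteq> 0. f n)"

definition vcomm :: "('k, 'v::ab_group_add) valg \<Rightarrow> bit \<Rightarrow> bit \<Rightarrow> 'v \<Rightarrow> 'v \<Rightarrow> 'v" where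
  "vcomm A p q a b = vmul A a b - koszul p q (vmul A b a)"

definition quasi_associative :: "('k::field_char_0, 'v::ab_group_add) valg \<Rightarrow> bool" where
  "quasi_associative A \<longleftrightarrow> (\<forall>p q. \<forall>a\<in>vpar A p. \<forall>b\<in>vpar A q. \<forall>c\<in>vcar A.
     vmul A (vcomm A p q a b) c
       = vmul A a (vmul A b c) - koszul p q (vmul A b (vmul A a c)))"

definition lambda_Jacobi :: "('k::field_char_0, 'v::ab_group_add) valg \<Rightarrow> bool" where
  "lambda_Jacobi A \<longleftrightarrow> (\<forall>p q. \<forall>a\<in>vpar A p. \<forall>b\<in>vpar A q. \<forall>c\<in>vcar A. \<forall>m n.
     vbr A (vbr A a b m) c n
       = subst_mu_minus_lambda (vscale A) (\<lambda>i j. vbr A a (vbr A b c j) i) m n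
         - koszul p q
             (subst_mu_minus_lambda (vscale A) (\<lambda>i j. vbr A b (vbr A a c i) j) m n))"

text \<open>\<open>(-\<lambda>-T)\<^sup>t / t! = (-1)\<^sup>t \<Sum>\<^sub>i\<^sub>+\<^sub>j\<^sub>=\<^sub>t (\<lambda>\<^sup>i / i!) (T\<^sup>j / j!)\<close>\<close>

definition skew_symmetric :: "('k::field_char_0, 'v::ab_group_add) valg \<Rightarrow> bool" where
  "skew_symmetric A \<longleftrightarrow> (\<forall>p q. \<forall>a\<in>vpar A p. \<forall>b\<in>vpar A q. \<forall>i.
     vbr A a b i
       = - koszul p q (finsum (\<lambda>j. vscale A ((-1) ^ (i + j)) (divT A j (vbr A b a (i + j))))))"

definition commutator_formula :: "('k::field_char_0, 'v::ab_group_add) valg \<Rightarrow> bool" where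
  "commutator_formula A \<longleftrightarrow> (\<forall>p q. \<forall>a\<in>vpar A p. \<forall>b\<in>vpar A q.
     vcomm A p q a b = finsum (\<lambda>i. vscale A ((-1) ^ i) (divT A (i + 1) (vbr A a b i))))"

definition Wick_formula :: "('k::field_char_0, 'v::ab_group_add) valg \<Rightarrow> bool" where
  "Wick_formula A \<longleftrightarrow> (\<forall>p q. \<forall>a\<in>vpar A p. \<forall>b\<in>vpar A q. \<forall>c\<in>vcar A. \<forall>n.
     vbr A a (vmul A b c) n
       = vmul A (vbr A a b n) c + koszul p q (vmul A b (vbr A a c n))
         + (\<Sum>i<n. vscale A (of_nat (n choose i)) (vbr A (vbr A a b i) c (n - 1 - i))))"

definition associative_vertex_algebra ::
  "('k::field_char_0, 'v::ab_group_add) valg \<Rightarrow> bool" where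
  "associative_vertex_algebra A \<longleftrightarrow>
     vertex_algebra A \<and> quasi_associative A \<and> lambda_Jacobi A \<and> skew_symmetric A \<and>
     commutator_formula A \<and> Wick_formula A"


section \<open>Distributions\<close>

text \<open>
  \<open>a :: int \<Rightarrow> 'w\<close> stands for \<open>\<Sum> a t z\<^sup>-\<^sup>t\<^sup>-\<^sup>1\<close>, and \<open>D :: int \<Rightarrow> int \<Rightarrow> 'w\<close> for
  \<open>\<Sum> D t s z\<^sup>-\<^sup>t\<^sup>-\<^sup>1 w\<^sup>-\<^sup>s\<^sup>-\<^sup>1\<close>.
\<close>

type_synonym 'w distribution = "int \<Rightarrow> 'w"
type_synonym 'w distribution2 = "int \<Rightarrow> int \<Rightarrow> 'w"

definition deriv_dist ::
  "('k::field_char_0 \<Rightarrow> 'w::ab_group_add \<Rightarrow> 'w) \<Rightarrow> 'w distribution \<Rightarrow> 'w distribution" where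
  "deriv_dist s a = (\<lambda>t. s (- of_int t) (a (t - 1)))"

definition mult_z_minus_w :: "'w::ab_group_add distribution2 \<Rightarrow> 'w distribution2" where
  "mult_z_minus_w D = (\<lambda>t s. D (t + 1) s - D t (s + 1))"

definition res_z :: "'w distribution2 \<Rightarrow> 'w distribution" where
  "res_z D = D 0"

definition comm_dist ::
  "('w \<Rightarrow> 'w \<Rightarrow> 'w) \<Rightarrow> (bit \<Rightarrow> 'w::ab_group_add set) \<Rightarrow>
   'w distribution \<Rightarrow> 'w distribution \<Rightarrow> 'w distribution2" where
  "comm_dist m P a b = (\<lambda>t s. supercomm m P (a t) (b s))"

definition local_set ::
  "('w \<Rightarrow> 'w \<Rightarrow> 'w) \<Rightarrow> (bit \<Rightarrow> 'w::ab_group_add set) \<Rightarrow> 'w distribution set \<Rightarrow> bool" where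
  "local_set m P V \<longleftrightarrow>
     (\<forall>a\<in>V. \<forall>b\<in>V. \<exists>n::nat. (mult_z_minus_w ^^ n) (comm_dist m P a b) = 0)"

text \<open>The coefficient of \<open>\<lambda>\<^sup>n / n!\<close> in \<open>res\<^sub>z e\<^sup>(\<^sup>z\<^sup>-\<^sup>w\<^sup>)\<^sup>\<lambda> [a(z),b(w)]\<close>.\<close>

definition bracket_dist ::
  "('w \<Rightarrow> 'w \<Rightarrow> 'w) \<Rightarrow> (bit \<Rightarrow> 'w::ab_group_add set) \<Rightarrow>
   'w distribution \<Rightarrow> 'w distribution \<Rightarrow> nat \<Rightarrow> 'w distribution" where
  "bracket_dist m P a b n = res_z ((mult_z_minus_w ^^ n) (comm_dist m P a b))"

text \<open>
  Normal ordered product relative to an infinite summation operator \<open>\<sigma>\<close>; the first summation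
  runs over the modes \<open>a\<^sub>t\<close> with \<open>t = -1 - n < 0\<close>, the second over those with \<open>t = n \<ge> 0\<close>.
\<close>

definition normal_ordered_product ::
  "('w \<Rightarrow> 'w \<Rightarrow> 'w) \<Rightarrow> (bit \<Rightarrow> 'w::ab_group_add set) \<Rightarrow> ((nat \<Rightarrow> 'w) \<Rightarrow> 'w) \<Rightarrow>
   'w distribution \<Rightarrow> 'w distribution \<Rightarrow> 'w distribution" where
  "normal_ordered_product m P \<sigma> a b = (\<lambda>s.
     \<sigma> (\<lambda>n. m (a (- 1 - int n)) (b (s + int n)))
     + (\<Sum>p\<in>{0,1}. \<Sum>q\<in>{0,1}. koszul p q
         (\<sigma> (\<lambda>n. m (parity_part P (b (s - int n - 1)) q) (parity_part P (a (int n)) p)))))"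

definition dist_valg ::
  "('k::field_char_0 \<Rightarrow> 'w::ab_group_add \<Rightarrow> 'w) \<Rightarrow> ('w \<Rightarrow> 'w \<Rightarrow> 'w) \<Rightarrow> 'w \<Rightarrow> (bit \<Rightarrow> 'w set) \<Rightarrow>
   ((nat \<Rightarrow> 'w) \<Rightarrow> 'w) \<Rightarrow> 'w distribution set \<Rightarrow> ('k, 'w distribution) valg" where
  "dist_valg s m e P \<sigma> D =
     \<lparr>vcar = D,
      vscale = (\<lambda>c a t. s c (a t)),
      vpar = (\<lambda>p. {a \<in> D. \<forall>t. a t \<in> P p}),
      vT = deriv_dist s,
      vmul = normal_ordered_product m P \<sigma>,
      vbr = bracket_dist m P,
      vone = (\<lambda>t. if t = -1 then e else 0)\<rparr>"


section \<open>Fields on a vector space\<close>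

definition end_par ::
  "('k::field \<Rightarrow> 'e::ab_group_add \<Rightarrow> 'e) \<Rightarrow> (bit \<Rightarrow> 'e set) \<Rightarrow> bit \<Rightarrow> ('e \<Rightarrow> 'e) set" where
  "end_par s PE p = {f. Vector_Spaces.linear s s f \<and> (\<forall>q. f ` PE q \<subseteq> PE (p + q))}"

definition fields_on ::
  "('k::field \<Rightarrow> 'e::ab_group_add \<Rightarrow> 'e) \<Rightarrow> ('e \<Rightarrow> 'e) distribution set" where
  "fields_on s =
     {a. (\<forall>t. Vector_Spaces.linear s s (a t)) \<and> (\<forall>v. \<exists>N. \<forall>t\<ge>N. a t v = 0)}"

definition End_v ::
  "('k::field_char_0 \<Rightarrow> 'e::ab_group_add \<Rightarrow> 'e) \<Rightarrow> (bit \<Rightarrow> 'e set) \<Rightarrow>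
   ('k, ('e \<Rightarrow> 'e) distribution) valg" where
  "End_v s PE =
     dist_valg (\<lambda>c f v. s c (f v)) (\<circ>) id (end_par s PE)
       (\<lambda>f v. finsum (\<lambda>n. f n v)) (fields_on s)"


section \<open>FZ-complete algebras\<close>

definition weights :: "rat \<Rightarrow> rat set" where
  "weights \<rho> = {\<rho> * of_int n | n. True}"

definition complete_group_topology :: "'a::ab_group_add topology \<Rightarrow> bool" where
  "complete_group_topology X \<longleftrightarrow>
     (\<forall>F. F \<noteq> bot \<and> F \<le> principal (topspace X) \<and>
        (\<forall>U. openin X U \<and> 0 \<in> U \<longrightarrow> eventually (\<lambda>(x, y). x - y \<in> U) (F \<times>\<^sub>F F))
        \<longrightarrow> (\<exists>l. limitin X (\<lambda>x. x) l F))"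

definition low_products ::
  "('k::field \<Rightarrow> 'a::{ring,monoid_mult} \<Rightarrow> 'a) \<Rightarrow> rat \<Rightarrow> (rat \<Rightarrow> 'a set) \<Rightarrow> rat \<Rightarrow> int \<Rightarrow> 'a set" where
  "low_products s \<rho> G h k =
     module.span s
       {x * y | x y l. l \<in> weights \<rho> \<and> l < of_int k \<and> x \<in> G (h - l) \<and> y \<in> G l}"

text \<open>
  \<open>P\<close> is the parity, \<open>G\<close> the grading and \<open>\<tau> h\<close> the topology of the weight space \<open>G h\<close>.
  All subspaces are super subspaces, including those in the neighbourhood basis. The sort
  \<open>{ring,monoid_mult}\<close> is used in place of \<open>ring_1\<close> in order to admit the zero algebra.
\<close>

definition FZ_complete ::
  "rat \<Rightarrow> ('k::field_char_0 \<Rightarrow> 'a::{ring,monoid_mult} \<Rightarrow> 'a) \<Rightarrow> (bit \<Rightarrow> 'a set) \<Rightarrow>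
   (rat \<Rightarrow> 'a set) \<Rightarrow> (rat \<Rightarrow> 'a topology) \<Rightarrow> bool" where
  "FZ_complete \<rho> s P G \<tau> \<longleftrightarrow>
     super_space s P UNIV \<and>
     (\<forall>c x y. s c (x * y) = s c x * y \<and> s c (x * y) = x * s c y) \<and>
     (\<forall>p q. \<forall>x\<in>P p. \<forall>y\<in>P q. x * y \<in> P (p + q)) \<and> 1 \<in> P 0 \<and>
     graded_space s (weights \<rho>) G UNIV \<and>
     (\<forall>h\<in>weights \<rho>. super_subspace s P (G h)) \<and>
     (\<forall>h\<in>weights \<rho>. \<forall>k\<in>weights \<rho>. \<forall>x\<in>G h. \<forall>y\<in>G k. x * y \<in> G (h + k)) \<and> 1 \<in> G 0 \<and>
     (\<forall>h\<in>weights \<rho>.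
        topspace (\<tau> h) = G h \<and>
        continuous_map (prod_topology (\<tau> h) (\<tau> h)) (\<tau> h) (\<lambda>(x, y). x + y) \<and>
        continuous_map (prod_topology (discrete_topology UNIV) (\<tau> h)) (\<tau> h) (\<lambda>(c, x). s c x) \<and>
        (\<forall>U. openin (\<tau> h) U \<and> 0 \<in> U \<longrightarrow>
           (\<exists>S W. super_subspace s P S \<and> openin (\<tau> h) W \<and> 0 \<in> W \<and> W \<subseteq> S \<and> S \<subseteq> U)) \<and>
        Hausdorff_space (\<tau> h) \<and> complete_group_topology (\<tau> h)) \<and>
     (\<forall>h\<in>weights \<rho>. \<forall>k\<in>weights \<rho>.
        continuous_map (prod_topology (\<tau> h) (\<tau> k)) (\<tau> (h + k)) (\<lambda>(x, y). x * y)) \<and>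
     \<comment> \<open>\<open>\<tau> h\<close> is coarser than the topology given by the closures of the \<open>low_products\<close>\<close>
     (\<forall>h\<in>weights \<rho>. \<forall>U. openin (\<tau> h) U \<longrightarrow>
        (\<forall>x\<in>U. \<exists>k. (+) x ` (\<tau> h closure_of low_products s \<rho> G h k) \<subseteq> U))"

text \<open>The sum of a series in the direct sum of the weight spaces, taken weight by weight.\<close>

definition conv_sum ::
  "rat \<Rightarrow> (rat \<Rightarrow> 'a::ab_group_add set) \<Rightarrow> (rat \<Rightarrow> 'a topology) \<Rightarrow> (nat \<Rightarrow> 'a) \<Rightarrow> 'a" where
  "conv_sum \<rho> G \<tau> f =
     (THE x. \<forall>h\<in>weights \<rho>.
        limitin (\<tau> h) (\<lambda>N. component (weights \<rho>) G (\<Sum>n<N. f n) h)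
          (component (weights \<rho>) G x h) sequentially)"

definition dist_weight ::
  "(rat \<Rightarrow> 'a set) \<Rightarrow> rat \<Rightarrow> 'a distribution set" where
  "dist_weight G h = {a. \<forall>t. a t \<in> G (h - of_int t - 1)}"

definition dist_H ::
  "rat \<Rightarrow> (rat \<Rightarrow> 'a::ab_group_add set) \<Rightarrow> 'a distribution set" where
  "dist_H \<rho> G =
     {(\<Sum>h\<in>F. f h) | F f. finite F \<and> F \<subseteq> weights \<rho> \<and> (\<forall>h\<in>F. f h \<in> dist_weight G h)}"

definition FZ_valg ::
  "rat \<Rightarrow> ('k::field_char_0 \<Rightarrow> 'a::{ring,monoid_mult} \<Rightarrow> 'a) \<Rightarrow> (bit \<Rightarrow> 'a set) \<Rightarrow>
   (rat \<Rightarrow> 'a set) \<Rightarrow> (rat \<Rightarrow> 'a topology) \<Rightarrow> ('k, 'a distribution) valg" where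
  "FZ_valg \<rho> s P G \<tau> = dist_valg s (*) 1 P (conv_sum \<rho> G \<tau>) (dist_H \<rho> G)"

end

theory Submission
  imports Defs
begin

text \<open>
  The \<open>\<lambda>\<close>-Jacobi identity, the Wick formula and quasi-associativity hold for arbitrary
  distributions: they follow from the Jacobi identity and the Leibniz rule for commutators of
  modes, from the binomial theorem applied to \<open>z - x = (z - w) - (x - w)\<close>, and from a rearrangement
  of double series. Locality only matters for skew-symmetry and for the commutator formula. For a
  polynomial bracket it is equivalent to
  \<open>[a(z),b(w)] = \<Sum>\<^sub>j (a\<^sub>jb)(w) \<partial>\<^sub>w\<^sup>(\<^sup>j\<^sup>) \<delta>(z,w)\<close>, from which both formulas can be read off.
  Conversely, the difference of the two sides never has modes with nonnegative \<open>z\<close>-index; skew-symmetry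
  excludes nonnegative \<open>w\<close>-indices, and the commutator formula for the derivatives of \<open>a\<close> excludes
  the remaining modes. The argument only uses a linear topology on the algebra of modes, and
  therefore applies to both settings.
\<close>


section \<open>Formal distributions in two variables\<close>

text \<open>Both halves of mode \<open>v\<close> of the normal ordered product are values of one
  pairing, the series of a_(-1-n) b_n, with one factor multiplied by a power of the variable. Normal
  ordering then enters only through the way this pairing reacts to multiplication by a mode, by the
  variable and to derivatives. Moving the variable from one factor to the other costs the single
  boundary term a_0 b_0; these boundary terms produce the integral in the Wick formula and the
  finite sums in [a,b]. The obstacle is convergence. Quasi-associativity reads a double series first
  by rows and then by antidiagonals, so sums are defined without an order, by finite sets and
  neighbourhoods that are subspaces. Convergence of the rows and of the series of row sums is then
  not enough: only finitely many terms may lie outside each neighbourhood. This is why the smallness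
  of a_t has to be uniform under left multiplication. Signs depend on parities, so identities are
  proved for homogeneous distributions and extended by additivity.\<close>

lemma sum_fun_apply: "(\<Sum>i\<in>I. f i) x = (\<Sum>i\<in>I. f i x)"
  for f :: "'i \<Rightarrow> 'x \<Rightarrow> 'b::comm_monoid_add"
  by (induction I rule: infinite_finite_induct) auto

abbreviation M :: "'w::ab_group_add distribution2 \<Rightarrow> 'w distribution2" where
  "M \<equiv> mult_z_minus_w"

lemma M_apply: "M D t u = D (t + 1) u - D t (u + 1)"
  by (simp add: mult_z_minus_w_def)

lemma M_Suc: "(M ^^ Suc n) D = (M ^^ n) (M D)"
  by (simp add: funpow_Suc_right del: funpow.simps)

lemma M_Suc_apply: "(M ^^ Suc n) D t u = (M ^^ n) D (t + 1) u - (M ^^ n) D t (u + 1)"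
  unfolding funpow.simps o_apply by (rule M_apply)

lemma M_pow_add: "(M ^^ n) (A + B) = (M ^^ n) A + (M ^^ n) B"
proof (intro ext)
  show "(M ^^ n) (A + B) t u = ((M ^^ n) A + (M ^^ n) B) t u" for t u
    by (induction n arbitrary: t u) (simp_all add: M_Suc_apply del: funpow.simps(2))
qed

lemma M_pow_zero: "(M ^^ n) 0 = 0"
proof (intro ext)
  show "(M ^^ n) 0 t u = 0 t u" for t u
    by (induction n arbitrary: t u) (simp_all add: M_Suc_apply del: funpow.simps(2))
qed

lemma M_pow_minus: "(M ^^ n) (- A) = - (M ^^ n) A"
  by (metis M_pow_add M_pow_zero add.right_inverse eq_neg_iff_add_eq_0 add.commute)

lemma M_pow_diff: "(M ^^ n) (A - B) = (M ^^ n) A - (M ^^ n) B"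
  by (simp only: diff_conv_add_uminus M_pow_add M_pow_minus)

lemma M_pow_zero_mono: "(M ^^ n) D = 0 \<Longrightarrow> n \<le> k \<Longrightarrow> (M ^^ k) D = 0"
proof -
  assume a: "(M ^^ n) D = 0" and "n \<le> k"
  then have "k = (k - n) + n" by simp
  then have "(M ^^ k) D = (M ^^ (k - n)) ((M ^^ n) D)" by (metis funpow_add o_apply)
  then show ?thesis by (simp only: a M_pow_zero)
qed

text \<open>Exchanging the variables turns z - w into its negative.\<close>

lemma M_pow_swap:
  "(M ^^ n) (\<lambda>t u. D u t) t u = (if even n then (M ^^ n) D u t else - (M ^^ n) D u t)"
  by (induction n arbitrary: t u) (simp_all add: M_Suc_apply del: funpow.simps(2))

lemma M_pow_in:
  assumes "\<And>t u. D t u \<in> C" "\<And>x y. x \<in> C \<Longrightarrow> y \<in> C \<Longrightarrow> x - y \<in> C"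
  shows "(M ^^ n) D t u \<in> C"
  by (induction n arbitrary: t u) (simp_all add: assms M_Suc_apply del: funpow.simps(2))

text \<open>In the applications \<open>f\<close> is a supercommutator, which is additive only on
  \<open>C\<close>, where parity components make sense.\<close>

lemma M_pow_hom:
  assumes "\<And>t u. D t u \<in> C" "\<And>x y. x \<in> C \<Longrightarrow> y \<in> C \<Longrightarrow> x - y \<in> C"
    and "\<And>x y. x \<in> C \<Longrightarrow> y \<in> C \<Longrightarrow> f (x - y) = f x - f y"
  shows "(M ^^ n) (\<lambda>t u. f (D t u)) t u = f ((M ^^ n) D t u)"
proof (induction n arbitrary: t u)
  case (Suc n)
  have "(M ^^ n) D t u \<in> C" for t u by (rule M_pow_in) (use assms in auto)
  then show ?case using Suc by (simp add: M_Suc_apply assms(3) del: funpow.simps)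
qed simp

text \<open>A distribution killed by z - w depends only on t + u, so vanishing for nonnegative
  \<open>t\<close> spreads to all indices. For higher powers the induction hypothesis, applied to
  \<open>M E\<close>, reduces to this case.\<close>

lemma M_zero_unique:
  assumes "(M ^^ n) E = 0" "\<And>t u. t \<ge> 0 \<Longrightarrow> E t u = 0"
  shows "E = 0"
  using assms
proof (induction n arbitrary: E)
  case (Suc n)
  have "(M ^^ n) (M E) = 0" using Suc.prems(1) unfolding M_Suc .
  then have "M E = 0" by (rule Suc.IH) (simp add: M_apply Suc.prems(2))
  have step: "E t (u + 1) = E (t + 1) u" for t u
  proof -
    have "M E t u = 0" by (simp only: \<open>M E = 0\<close> zero_fun_apply)
    then show ?thesis unfolding M_apply by simp
  qed
  have neg: "E (- int k) u = 0" for k u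
  proof (induction k arbitrary: u)
    case 0
    show ?case by (rule Suc.prems(2)) simp
  next
    case (Suc k)
    have "E (- int (Suc k)) (u - 1 + 1) = E (- int (Suc k) + 1) (u - 1)" by (rule step)
    moreover have "- int (Suc k) + 1 = - int k" "u - 1 + 1 = u" by simp_all
    ultimately show ?case by (simp only: Suc)
  qed
  have "E t u = 0" for t u
  proof (cases "t \<ge> 0")
    case False
    then have "t = - int (nat (- t))" by simp
    then show ?thesis using neg by metis
  qed (rule Suc.prems(2))
  then show ?case by (simp add: fun_eq_iff)
qed simp

lemma finsum_eq: "(\<And>j. j \<ge> N \<Longrightarrow> f j = 0) \<Longrightarrow> finsum f = (\<Sum>j<N. f j)"
  unfolding finsum_def by (rule sum.mono_neutral_left) (auto simp: not_less[symmetric])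


subsection \<open>Formal distributions in three variables\<close>

lemma funpow_commute:
  assumes "\<And>x. f (g x) = g (f x)"
  shows "(f ^^ i) ((g ^^ j) x) = (g ^^ j) ((f ^^ i) x)"
proof -
  have 1: "(f ^^ i) (g x) = g ((f ^^ i) x)" for x
    by (induction i) (simp_all add: assms)
  show ?thesis by (induction j) (simp_all add: 1)
qed

text \<open>The indices \<open>r\<close>, \<open>t\<close>, \<open>u\<close> belong to variables z,
  x, w; \<open>M12\<close>, \<open>M13\<close> and \<open>M23\<close> are multiplication by z - x, z
  - w and x - w.\<close>

definition M12 :: "(int \<Rightarrow> int \<Rightarrow> int \<Rightarrow> 'w::ab_group_add) \<Rightarrow> int \<Rightarrow> int \<Rightarrow> int \<Rightarrow> 'w" where
  "M12 F = (\<lambda>r t u. F (r + 1) t u - F r (t + 1) u)"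

definition M13 :: "(int \<Rightarrow> int \<Rightarrow> int \<Rightarrow> 'w::ab_group_add) \<Rightarrow> int \<Rightarrow> int \<Rightarrow> int \<Rightarrow> 'w" where
  "M13 F = (\<lambda>r t u. F (r + 1) t u - F r t (u + 1))"

definition M23 :: "(int \<Rightarrow> int \<Rightarrow> int \<Rightarrow> 'w::ab_group_add) \<Rightarrow> int \<Rightarrow> int \<Rightarrow> int \<Rightarrow> 'w" where
  "M23 F = (\<lambda>r t u. F r (t + 1) u - F r t (u + 1))"

lemma M13_eq: "M13 F = M12 F + M23 F" and M12_eq: "M12 F = M13 F - M23 F"
  unfolding M12_def M13_def M23_def by (intro ext; simp)+

lemma M123_commute: "M12 (M23 F) = M23 (M12 F)" "M12 (M13 F) = M13 (M12 F)" "M13 (M23 F) = M23 (M13 F)"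
  unfolding M12_def M13_def M23_def by (intro ext; simp)+

lemma M123_diff: "M12 (F - G) = M12 F - M12 G" "M13 (F - G) = M13 F - M13 G" "M23 (F - G) = M23 F - M23 G"
  unfolding M12_def M13_def M23_def by (intro ext; simp)+

lemma M123_add: "M12 (F + G) = M12 F + M12 G" "M13 (F + G) = M13 F + M13 G" "M23 (F + G) = M23 F + M23 G"
  unfolding M12_def M13_def M23_def by (intro ext; simp)+

lemma M123_pow_diff: "(M12 ^^ n) (F - G) = (M12 ^^ n) F - (M12 ^^ n) G"
  "(M13 ^^ n) (F - G) = (M13 ^^ n) F - (M13 ^^ n) G"
  "(M23 ^^ n) (F - G) = (M23 ^^ n) F - (M23 ^^ n) G"
  by (induction n) (simp_all add: M123_diff)

lemma M123_pow_add: "(M12 ^^ n) (F + G) = (M12 ^^ n) F + (M12 ^^ n) G"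
  "(M13 ^^ n) (F + G) = (M13 ^^ n) F + (M13 ^^ n) G"
  "(M23 ^^ n) (F + G) = (M23 ^^ n) F + (M23 ^^ n) G"
  by (induction n) (simp_all add: M123_add)

lemma M123_pow:
  "(M12 ^^ n) F r t u = (M ^^ n) (\<lambda>r t. F r t u) r t"
  "(M13 ^^ n) F r t u = (M ^^ n) (\<lambda>r u. F r t u) r u"
  "(M23 ^^ n) F r t u = (M ^^ n) (F r) t u"
proof -
  show "(M12 ^^ n) F r t u = (M ^^ n) (\<lambda>r t. F r t u) r t" for r t u
  proof (induction n arbitrary: r t u)
    case (Suc n)
    show ?case unfolding M_Suc_apply Suc[symmetric] funpow.simps o_apply by (simp add: M12_def M_apply)
  qed simp
  show "(M13 ^^ n) F r t u = (M ^^ n) (\<lambda>r u. F r t u) r u" for r t u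
  proof (induction n arbitrary: r t u)
    case (Suc n)
    show ?case unfolding M_Suc_apply Suc[symmetric] funpow.simps o_apply by (simp add: M13_def M_apply)
  qed simp
  show "(M23 ^^ n) F r t u = (M ^^ n) (F r) t u" for r t u
  proof (induction n arbitrary: r t u)
    case (Suc n)
    show ?case unfolding M_Suc_apply Suc[symmetric] funpow.simps o_apply by (simp add: M23_def M_apply)
  qed simp
qed


subsection \<open>Expansions of the delta distribution\<close>

locale char0_space = vector_space s for s :: "'k::field_char_0 \<Rightarrow> 'w::ab_group_add \<Rightarrow> 'w"
begin

text \<open>
  \<open>delta_expansion N c\<close> is \<open>\<Sum>\<^sub>j c\<^sub>j(w) \<partial>\<^sub>w\<^sup>(\<^sup>j\<^sup>) \<delta>(z,w)\<close>, where \<open>j < N\<close>.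
\<close>

definition delta_expansion :: "nat \<Rightarrow> (nat \<Rightarrow> 'w distribution) \<Rightarrow> 'w distribution2" where
  "delta_expansion N c = (\<lambda>t u. \<Sum>j<N. s (of_int t gchoose j) (c j (t + u - int j)))"

lemma gchoose_Pascal: "(of_int (t + 1) gchoose Suc j :: 'k) = (of_int t gchoose j) + (of_int t gchoose Suc j)"
  by (simp add: gbinomial_Suc_Suc)

text \<open>Since \<open>D (int n)\<close> is the residue in z of z^n D, this is the binomial
  expansion of z^n = (w + (z - w))^n under the residue.\<close>

lemma Taylor:
  "D (int n) u = (\<Sum>j<Suc n. s (of_nat n gchoose j) ((M ^^ j) D 0 (int n + u - int j)))"
proof (induction n arbitrary: D u)
  case (Suc n)
  have "D (int (Suc n)) u = M D (int n) u + D (int n) (u + 1)"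
    by (simp add: M_apply add.commute)
  also have "\<dots> = (\<Sum>j<Suc n. s (of_nat n gchoose j) ((M ^^ Suc j) D 0 (int n + u - int j)))
      + (\<Sum>j<Suc n. s (of_nat n gchoose j) ((M ^^ j) D 0 (int n + (u + 1) - int j)))"
    unfolding Suc[of "M D"] Suc[of D] M_Suc by simp
  also have "(\<Sum>j<Suc n. s (of_nat n gchoose j) ((M ^^ j) D 0 (int n + (u + 1) - int j)))
     = (\<Sum>j<Suc (Suc n). s (of_nat n gchoose j) ((M ^^ j) D 0 (int n + (u + 1) - int j)))"
    by (simp flip: binomial_gbinomial)
  also have "\<dots> = D 0 (int n + (u + 1)) +
      (\<Sum>j<Suc n. s (of_nat n gchoose Suc j) ((M ^^ Suc j) D 0 (int n + u - int j)))"
    by (subst sum.lessThan_Suc_shift) (simp add: algebra_simps del: funpow.simps)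
  also have "(\<Sum>j<Suc n. s (of_nat n gchoose j) ((M ^^ Suc j) D 0 (int n + u - int j)))
      + (D 0 (int n + (u + 1)) +
      (\<Sum>j<Suc n. s (of_nat n gchoose Suc j) ((M ^^ Suc j) D 0 (int n + u - int j))))
    = D 0 (int n + (u + 1)) + (\<Sum>j<Suc n. s (of_nat (Suc n) gchoose Suc j) ((M ^^ Suc j) D 0 (int n + u - int j)))"
    using gchoose_Pascal[of "int n"]
    by (simp add: sum.distrib[symmetric] scale_left_distrib add.commute add.left_commute del: funpow.simps sum.lessThan_Suc)
  also have "\<dots> = (\<Sum>j<Suc (Suc n). s (of_nat (Suc n) gchoose j) ((M ^^ j) D 0 (int (Suc n) + u - int j)))"
    by (subst (2) sum.lessThan_Suc_shift) (simp add: algebra_simps del: funpow.simps sum.lessThan_Suc)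
  finally show ?case .
qed simp

lemma of_nat_gchoose_zero: "n < j \<Longrightarrow> (of_nat n gchoose j :: 'k) = 0"
  by (simp flip: binomial_gbinomial)

lemma sum_vanish_beyond:
  fixes N N' :: nat
  assumes "\<And>j. j \<ge> N \<Longrightarrow> f j = 0" "\<And>j. j \<ge> N' \<Longrightarrow> f j = 0"
  shows "(\<Sum>j<N. f j) = (\<Sum>j<N'. f j :: 'w)"
proof -
  have "(\<Sum>j<N. f j) = (\<Sum>j<max N N'. f j)"
    using assms by (intro sum.mono_neutral_left) (auto simp: not_less[symmetric])
  also have "\<dots> = (\<Sum>j<N'. f j)"
    using assms by (intro sum.mono_neutral_right) (auto simp: not_less[symmetric])
  finally show ?thesis .
qed

text \<open>Nonnegative first indices are recovered from the residues of (z - w)^j D whether or not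
  D is local. The Taylor sum stops at \<open>n\<close> and the expansion at \<open>N\<close>; beyond
  either bound the terms vanish.\<close>

lemma delta_expansion_nonneg:
  assumes "\<And>j. j \<ge> N \<Longrightarrow> (M ^^ j) D 0 = 0" "t \<ge> 0"
  shows "D t u = delta_expansion N (\<lambda>j. (M ^^ j) D 0) t u"
proof -
  obtain n where n: "t = int n" using assms(2) nonneg_int_cases by blast
  show ?thesis unfolding n delta_expansion_def
    by (subst Taylor, unfold of_int_of_nat_eq, rule sum_vanish_beyond)
      (use assms of_nat_gchoose_zero in \<open>auto simp del: funpow.simps simp: Suc_le_eq\<close>)
qed

text \<open>Multiplication by z - w lowers the order of a divided derivative of the delta
  distribution by one; on modes this is Pascal's rule.\<close>

lemma M_delta_expansion:
  assumes "\<And>j. j \<ge> N \<Longrightarrow> c j = 0"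
  shows "M (delta_expansion N c) = delta_expansion N (\<lambda>j. c (Suc j))"
proof (intro ext)
  fix t u
  have "M (delta_expansion N c) t u
     = (\<Sum>j<N. s ((of_int (t + 1) gchoose j) - (of_int t gchoose j)) (c j (t + u + 1 - int j)))"
    by (simp add: M_apply delta_expansion_def sum_subtractf[symmetric] scale_left_diff_distrib algebra_simps)
  also have "\<dots> = (\<Sum>j<Suc N. s ((of_int (t + 1) gchoose j) - (of_int t gchoose j)) (c j (t + u + 1 - int j)))"
    by (simp add: assms)
  also have "\<dots> = (\<Sum>j<N. s (of_int t gchoose j) (c (Suc j) (t + u - int j)))"
    unfolding sum.lessThan_Suc_shift gchoose_Pascal by (simp add: add_diff_eq)
  finally show "M (delta_expansion N c) t u = delta_expansion N (\<lambda>j. c (Suc j)) t u"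
    by (simp add: delta_expansion_def)
qed

lemma M_pow_delta_expansion:
  assumes "\<And>j. j \<ge> N \<Longrightarrow> c j = 0"
  shows "(M ^^ n) (delta_expansion N c) = delta_expansion N (\<lambda>j. c (j + n))"
proof (induction n)
  case (Suc n)
  then show ?case using M_delta_expansion[of N "\<lambda>j. c (j + n)"] assms by simp
qed simp

text \<open>The expansion is killed by (z - w)^N and agrees with \<open>D\<close> at nonnegative
  first indices, so for local \<open>D\<close> the difference is 0 by
  \<open>M_zero_unique\<close>.\<close>

lemma local_iff_delta_expansion:
  assumes "\<And>j. j \<ge> N \<Longrightarrow> (M ^^ j) D 0 = 0"
  shows "(\<exists>n. (M ^^ n) D = 0) \<longleftrightarrow> D = delta_expansion N (\<lambda>j. (M ^^ j) D 0)"
proof -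
  let ?d = "delta_expansion N (\<lambda>j. (M ^^ j) D 0)"
  have d: "(M ^^ n) ?d = 0" if "n \<ge> N" for n
    by (subst M_pow_delta_expansion)
      (use assms that in \<open>auto simp: delta_expansion_def fun_eq_iff\<close>)
  show ?thesis
  proof
    assume "\<exists>n. (M ^^ n) D = 0"
    then obtain n where "(M ^^ n) D = 0" by blast
    then have "(M ^^ (n + N)) (D - ?d) = 0"
      using M_pow_zero_mono[of n D "n + N"] d[of "n + N"] by (simp add: M_pow_diff)
    then have "D - ?d = 0"
      by (rule M_zero_unique) (use delta_expansion_nonneg[OF assms] in simp)
    then show "D = ?d" by simp
  next
    assume "D = ?d"
    then show "\<exists>n. (M ^^ n) D = 0" using d by (metis order_refl)
  qed
qed

text \<open>Prepares the right-hand side of skew-symmetry: the residue is taken in the second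
  variable of the expansion, and the exchange of variables turns (z - w)^i into (-1)^i times
  itself.\<close>

lemma delta_expansion_swap:
  assumes "\<And>j. j \<ge> N \<Longrightarrow> c j = 0"
  shows "(M ^^ i) (\<lambda>t u. delta_expansion N c u t) 0 v
     = (\<Sum>j<N. s ((-1) ^ i * (of_int v gchoose j)) (c (j + i) (v - int j)))"
  by (subst M_pow_swap, subst (1 2) M_pow_delta_expansion[OF assms])
    (auto simp: delta_expansion_def sum_negf)

text \<open>Mode \<open>v\<close> of [a,b], the commutator for the normal ordered product, when
  \<open>D\<close> is the commutator of a(z) and b(w). Only index pairs on the antidiagonal t + u =
  v - 1 that are both negative or both nonnegative contribute.\<close>

definition comm_coeff :: "'w distribution2 \<Rightarrow> int \<Rightarrow> 'w" where
  "comm_coeff D v = (if v \<ge> 0 then - (\<Sum>i<nat v. D (v - 1 - int i) (int i))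
     else \<Sum>i<nat (- v). D (- 1 - int i) (v + int i))"

lemma comm_coeff_diff: "comm_coeff (A - B) v = comm_coeff A v - comm_coeff B v"
  by (simp add: comm_coeff_def sum_subtractf)

lemma hockey_stick:
  "(\<Sum>i<n. of_int (int n - 1 - int i) gchoose j) = (of_int (int n) gchoose Suc j :: 'k)"
proof (induction n)
  case (Suc n)
  then show ?case using gchoose_Pascal[of "int n" j]
    by (subst sum.lessThan_Suc_shift) (simp add: algebra_simps)
qed simp

lemma hockey_stick_neg:
  "(\<Sum>i<n. of_int (- 1 - int i) gchoose j) = - (of_int (- int n) gchoose Suc j :: 'k)"
proof (induction n)
  case (Suc n)
  have "(of_int (- int n) gchoose Suc j :: 'k)
      = (of_int (- 1 - int n) gchoose j) + (of_int (- 1 - int n) gchoose Suc j)"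
    using gchoose_Pascal[of "- 1 - int n" j] by (simp only: diff_add_cancel diff_add_eq add.left_inverse diff_0)
  moreover have "- int (Suc n) = - 1 - int n" by simp
  moreover have "- (a + b) + a = - b" for a b :: 'k by simp
  ultimately show ?case by (simp only: sum.lessThan_Suc Suc.IH)
qed simp

text \<open>Along an antidiagonal the argument of \<open>c j\<close> is constant, so only binomial
  coefficients are summed. The result is mode \<open>v\<close> of the sum of (-1)^j T^(j+1) c_j in
  divided powers of T, the shape of the commutator formula.\<close>

lemma comm_coeff_delta_expansion:
  "comm_coeff (delta_expansion N c) v
     = - (\<Sum>j<N. s (of_int v gchoose Suc j) (c j (v - 1 - int j)))"
proof (cases "v \<ge> 0")
  case True
  then obtain n where n: "v = int n" using nonneg_int_cases by blast
  have "comm_coeff (delta_expansion N c) v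
      = - (\<Sum>i<n. \<Sum>j<N. s (of_int (int n - 1 - int i) gchoose j) (c j (int n - 1 - int j)))"
    by (simp add: comm_coeff_def delta_expansion_def n)
  also have "\<dots> = - (\<Sum>j<N. s (of_int v gchoose Suc j) (c j (v - 1 - int j)))"
    by (subst sum.swap) (simp only: n hockey_stick scale_sum_left[symmetric])
  finally show ?thesis .
next
  case False
  define n where "n = nat (- v)"
  have n: "v = - int n" "n > 0" using False by (auto simp: n_def)
  have "comm_coeff (delta_expansion N c) v = (\<Sum>i<n. delta_expansion N c (- 1 - int i) (v + int i))"
    using n by (simp add: comm_coeff_def)
  also have "\<dots> = (\<Sum>i<n. \<Sum>j<N. s (of_int (- 1 - int i) gchoose j) (c j (v - 1 - int j)))"
    unfolding delta_expansion_def by (intro sum.cong refl arg_cong2[where f=s] arg_cong2[where f=c]) simp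
  also have "\<dots> = - (\<Sum>j<N. s (of_int v gchoose Suc j) (c j (v - 1 - int j)))"
    by (subst sum.swap)
      (simp only: n hockey_stick_neg scale_sum_left[symmetric] scale_minus_left sum_negf)
  finally show ?thesis .
qed

lemma fun_vector_space: "vector_space (\<lambda>k a t. s k (a t))"
  by unfold_locales (auto simp: fun_eq_iff scale_right_distrib scale_left_distrib)

text \<open>The coefficients are those that sesquilinearity prescribes for Ta. They yield the
  derivative in z of the expansion by the absorption identity for binomials; the bound grows to
  \<open>Suc N\<close> because indices shift by one.\<close>

lemma delta_expansion_deriv:
  "delta_expansion (Suc N) (\<lambda>j v. if j = 0 then 0 else - s (of_nat j) (c (j - 1) v)) t u
     = s (- of_int t) (delta_expansion N c (t - 1) u)"
proof -
  have "delta_expansion (Suc N) (\<lambda>j v. if j = 0 then 0 else - s (of_nat j) (c (j - 1) v)) t u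
      = (\<Sum>j<N. s (of_int t gchoose Suc j) (- s (of_nat (Suc j)) (c j (t + u - int (Suc j)))))"
    unfolding delta_expansion_def sum.lessThan_Suc_shift by simp
  also have "\<dots> = (\<Sum>j<N. s (- of_int t) (s (of_int (t - 1) gchoose j) (c j (t - 1 + u - int j))))"
  proof (rule sum.cong[OF refl])
    fix j
    have 1: "t + u - int (Suc j) = t - 1 + u - int j" by simp
    have "(of_int t gchoose Suc j) * (- of_nat (Suc j)) = - (of_nat (Suc j) * (of_int t gchoose Suc j) :: 'k)"
      by (simp only: mult_minus_left mult_minus_right mult.commute)
    also have "\<dots> = (- of_int t) * (of_int (t - 1) gchoose j)"
      unfolding gbinomial_absorption by simp
    finally show "s (of_int t gchoose Suc j) (- s (of_nat (Suc j)) (c j (t + u - int (Suc j))))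
        = s (- of_int t) (s (of_int (t - 1) gchoose j) (c j (t - 1 + u - int j)))"
      unfolding 1 scale_minus_left[symmetric] scale_scale by (simp only:)
  qed
  also have "\<dots> = s (- of_int t) (delta_expansion N c (t - 1) u)"
    unfolding delta_expansion_def scale_sum_right ..
  finally show ?thesis .
qed

text \<open>In divided powers, raising \<open>m\<close> is differentiation in \<lambda>, so this is
  the chain rule for G(\<lambda>, \<mu> - \<lambda>). It has the same shape as
  \<open>M12_eq\<close>.\<close>

lemma subst_Suc:
  "subst_mu_minus_lambda s G (Suc m) n
     = subst_mu_minus_lambda s (\<lambda>i. G (Suc i)) m n - subst_mu_minus_lambda s G m (Suc n)"
proof -
  let ?c = "\<lambda>l. (-1) ^ l * of_nat (m choose l) :: 'k"
  have "subst_mu_minus_lambda s G (Suc m) n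
      = G (Suc m) n + (\<Sum>l\<le>m. s (?c (Suc l) - ?c l) (G (m - l) (Suc n + l)))"
  proof -
    have "(-1) ^ Suc l * of_nat (Suc m choose Suc l) = ?c (Suc l) - ?c l" for l
      by (simp add: algebra_simps)
    then show ?thesis
      unfolding subst_mu_minus_lambda_def by (subst sum.atMost_Suc_shift) simp
  qed
  also have "\<dots> = (G (Suc m) n + (\<Sum>l\<le>m. s (?c (Suc l)) (G (m - l) (Suc n + l))))
      - subst_mu_minus_lambda s G m (Suc n)"
    unfolding subst_mu_minus_lambda_def scale_left_diff_distrib sum_subtractf by (simp only: add_diff_eq)
  also have "G (Suc m) n + (\<Sum>l\<le>m. s (?c (Suc l)) (G (m - l) (Suc n + l)))
      = subst_mu_minus_lambda s (\<lambda>i. G (Suc i)) m n"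
  proof (cases m)
    case (Suc m')
    have "(\<Sum>l\<le>m. s (?c (Suc l)) (G (m - l) (Suc n + l)))
        = (\<Sum>l\<le>m'. s (?c (Suc l)) (G (m - l) (Suc n + l)))"
      unfolding Suc by (simp add: binomial_eq_0)
    also have "\<dots> = (\<Sum>l\<le>m'. s (?c (Suc l)) (G (Suc (m - Suc l)) (n + Suc l)))"
      by (intro sum.cong refl) (auto simp: Suc Suc_diff_le)
    finally show ?thesis
      unfolding subst_mu_minus_lambda_def unfolding Suc sum.atMost_Suc_shift by simp
  qed (simp add: subst_mu_minus_lambda_def)
  finally show ?thesis .
qed

text \<open>The binomial theorem for z - x = (z - w) - (x - w), the three multiplications commuting.
  It matches the substitution of \<mu> - \<lambda> in the Jacobi identity.\<close>

lemma subst_M123: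
  "(M12 ^^ m) ((M23 ^^ n) F) r t u
     = subst_mu_minus_lambda s (\<lambda>i j. (M13 ^^ i) ((M23 ^^ j) F) r t u) m n"
proof (induction m arbitrary: n F)
  case 0
  show ?case by (simp add: subst_mu_minus_lambda_def)
next
  case (Suc m)
  let ?X = "(M23 ^^ n) F"
  have c: "M13 ((M23 ^^ j) F) = (M23 ^^ j) (M13 F)" for j
    using funpow_commute[of M13 M23 1 j F, OF M123_commute(3)] by simp
  have "(M12 ^^ Suc m) ?X = (M12 ^^ m) (M13 ?X - M23 ?X)"
    unfolding funpow_Suc_right o_apply M12_eq[symmetric] ..
  also have "\<dots> = (M12 ^^ m) ((M23 ^^ n) (M13 F)) - (M12 ^^ m) ((M23 ^^ Suc n) F)"
    unfolding M123_pow_diff c by simp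
  finally have "(M12 ^^ Suc m) ?X r t u
      = (M12 ^^ m) ((M23 ^^ n) (M13 F)) r t u - (M12 ^^ m) ((M23 ^^ Suc n) F) r t u"
    by (simp only: minus_apply)
  also have "\<dots> = subst_mu_minus_lambda s (\<lambda>i j. (M13 ^^ i) ((M23 ^^ j) (M13 F)) r t u) m n
      - subst_mu_minus_lambda s (\<lambda>i j. (M13 ^^ i) ((M23 ^^ j) F) r t u) m (Suc n)"
    unfolding Suc ..
  also have "(\<lambda>i j. (M13 ^^ i) ((M23 ^^ j) (M13 F)) r t u) = (\<lambda>i j. (M13 ^^ Suc i) ((M23 ^^ j) F) r t u)"
    unfolding c[symmetric] funpow_Suc_right o_apply ..
  finally show ?case unfolding subst_Suc .
qed

text \<open>Here z - w = (z - x) + (x - w) is expanded instead; this form feeds the integral term of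
  the Wick formula.\<close>

lemma binomial_M123:
  "(M13 ^^ n) F r t u = (\<Sum>i<Suc n. s (of_nat (n choose i)) ((M23 ^^ (n - i)) ((M12 ^^ i) F) r t u))"
proof (induction n arbitrary: F)
  case (Suc n)
  let ?X = "\<lambda>i j. (M23 ^^ j) ((M12 ^^ i) F) r t u"
  have c: "(M23 ^^ j) ((M12 ^^ i) (M23 F)) = (M23 ^^ Suc j) ((M12 ^^ i) F)" for i j
    using funpow_commute[of M12 M23 i 1 F, OF M123_commute(1)] by (simp add: funpow_swap1)
  have "(M13 ^^ Suc n) F = (M13 ^^ n) (M12 F) + (M13 ^^ n) (M23 F)"
    unfolding funpow_Suc_right o_apply M13_eq[of F] M123_pow_add ..
  then have "(M13 ^^ Suc n) F r t u = (M13 ^^ n) (M12 F) r t u + (M13 ^^ n) (M23 F) r t u"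
    by (simp only: plus_fun_apply)
  also have "\<dots> = (\<Sum>i<Suc n. s (of_nat (n choose i)) (?X (Suc i) (n - i)))
      + (\<Sum>i<Suc n. s (of_nat (n choose i)) (?X i (Suc (n - i))))"
    unfolding Suc c funpow_Suc_right[of _ M12] o_apply ..
  also have "(\<Sum>i<Suc n. s (of_nat (n choose i)) (?X i (Suc (n - i))))
      = ?X 0 (Suc n) + (\<Sum>i<n. s (of_nat (n choose Suc i)) (?X (Suc i) (n - i)))"
    unfolding sum.lessThan_Suc_shift
    by (intro arg_cong2[where f="(+)"] sum.cong) (auto simp: Suc_diff_Suc simp del: funpow.simps)
  also have "(\<Sum>i<n. s (of_nat (n choose Suc i)) (?X (Suc i) (n - i)))
      = (\<Sum>i<Suc n. s (of_nat (n choose Suc i)) (?X (Suc i) (n - i)))"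
    by simp
  also have "(\<Sum>i<Suc n. s (of_nat (n choose i)) (?X (Suc i) (n - i))) + (?X 0 (Suc n)
       + (\<Sum>i<Suc n. s (of_nat (n choose Suc i)) (?X (Suc i) (n - i))))
     = ?X 0 (Suc n) + (\<Sum>i<Suc n. s (of_nat (Suc n choose Suc i)) (?X (Suc i) (n - i)))"
    unfolding binomial_Suc_Suc of_nat_add scale_left_distrib sum.distrib by (simp only: add_ac)
  also have "\<dots> = (\<Sum>i<Suc (Suc n). s (of_nat (Suc n choose i)) (?X i (Suc n - i)))"
    unfolding sum.lessThan_Suc_shift[of _ "Suc n"] by (simp only: binomial_n_0 of_nat_1 scale_one diff_Suc_Suc diff_zero)
  finally show ?case .
qed simp

text \<open>The derivative of (z - w)^n in z is n (z - w)^(n-1). At the residue, t = 0, the first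
  term disappears and the sesquilinearity rule for Ta remains.\<close>

lemma M_pow_dz:
  "(M ^^ n) (\<lambda>t u. s (- of_int t) (F (t - 1) u)) t u
     = s (- of_int t) ((M ^^ n) F (t - 1) u) - s (of_nat n) ((M ^^ (n - 1)) F t u)"
proof (induction n arbitrary: t u)
  case (Suc n)
  have "(M ^^ n) F t u - (M ^^ n) F (t - 1) (u + 1) = (M ^^ Suc n) F (t - 1) u"
    unfolding M_Suc_apply by simp
  moreover have "s (of_nat n) ((M ^^ (n - 1)) F (t + 1) u) - s (of_nat n) ((M ^^ (n - 1)) F t (u + 1))
      = s (of_nat n) ((M ^^ n) F t u)"
    by (cases n) (simp_all add: M_Suc_apply scale_right_diff_distrib del: funpow.simps(2))
  ultimately show ?case
    unfolding M_Suc_apply[of n "\<lambda>t u. s (- of_int t) (F (t - 1) u)"] Suc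
    by (simp add: algebra_simps del: funpow.simps(2))
qed simp

lemma M_pow_dw:
  "(M ^^ n) (\<lambda>t u. s (- of_int u) (F t (u - 1))) t u
     = s (- of_int u) ((M ^^ n) F t (u - 1)) + s (of_nat n) ((M ^^ (n - 1)) F t u)"
proof (induction n arbitrary: t u)
  case (Suc n)
  have "(M ^^ n) F (t + 1) (u - 1) - (M ^^ n) F t u = (M ^^ Suc n) F t (u - 1)"
    unfolding M_Suc_apply by simp
  moreover have "s (of_nat n) ((M ^^ (n - 1)) F (t + 1) u) - s (of_nat n) ((M ^^ (n - 1)) F t (u + 1))
      = s (of_nat n) ((M ^^ n) F t u)"
    by (cases n) (simp_all add: M_Suc_apply scale_right_diff_distrib del: funpow.simps(2))
  ultimately show ?case
    unfolding M_Suc_apply[of n "\<lambda>t u. s (- of_int u) (F t (u - 1))"] Suc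
    by (simp add: algebra_simps del: funpow.simps(2))
qed simp

lemma deriv_pow:
  "(deriv_dist s ^^ j) x t = s ((-1) ^ j * fact j * (of_int t gchoose j)) (x (t - int j))"
proof (induction j arbitrary: t)
  case (Suc j)
  have 1: "of_nat (Suc j) * (of_int t gchoose Suc j :: 'k) = of_int t * (of_int (t - 1) gchoose j)"
    using gbinomial_absorption[of j "of_int t :: 'k"] by simp
  have "(- of_int t) * ((-1) ^ j * fact j * (of_int (t - 1) gchoose j)) =
      (-1) ^ Suc j * fact (Suc j) * (of_int t gchoose Suc j :: 'k)"
  proof -
    have "(- of_int t) * ((-1) ^ j * fact j * (of_int (t - 1) gchoose j)) =
        - ((-1) ^ j * fact j * (of_int t * (of_int (t - 1) gchoose j)) :: 'k)" by (simp add: mult_ac)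
    also have "\<dots> = (-1) ^ Suc j * fact (Suc j) * (of_int t gchoose Suc j)"
      unfolding 1[symmetric] fact_Suc by (simp add: mult_ac del: of_nat_Suc)
    finally show ?thesis .
  qed
  moreover have "t - 1 - int j = t - int (Suc j)" by simp
  ultimately show ?case
    by (simp only: funpow.simps o_apply deriv_dist_def[of s "(deriv_dist s ^^ j) x"] Suc scale_scale)
qed simp

end


section \<open>Graded spaces\<close>

lemma decomposition_sum:
  assumes "decomposition I G x f" "finite J" "{i. f i \<noteq> 0} \<subseteq> J"
  shows "x = (\<Sum>i\<in>J. f i)"
proof -
  have "(\<Sum>i | f i \<noteq> 0. f i) = (\<Sum>i\<in>J. f i)"
    by (rule sum.mono_neutral_left) (use assms in auto)
  then show ?thesis using assms(1) by (simp add: decomposition_def)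
qed

lemma decompositionI:
  assumes "\<And>i. i \<in> I \<Longrightarrow> f i \<in> G i" "\<And>i. i \<notin> I \<Longrightarrow> f i = 0" "finite J" "{i. f i \<noteq> 0} \<subseteq> J"
    "x = (\<Sum>i\<in>J. f i)"
  shows "decomposition I G x f"
proof -
  have "(\<Sum>i | f i \<noteq> 0. f i) = (\<Sum>i\<in>J. f i)"
    by (rule sum.mono_neutral_left) (use assms in auto)
  then show ?thesis using assms finite_subset[OF assms(4,3)] by (simp add: decomposition_def)
qed

lemma component_decomposition:
  assumes "graded_space s I G C" "x \<in> C"
  shows "decomposition I G x (component I G x)"
proof -
  have "\<exists>!f. decomposition I G x f" using assms by (simp add: graded_space_def)
  then show ?thesis unfolding component_def by (rule theI')
qed

lemma component_unique:
  assumes "graded_space s I G C" "x \<in> C" "decomposition I G x f"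
  shows "component I G x = f"
proof -
  have "\<exists>!f. decomposition I G x f" using assms by (simp add: graded_space_def)
  then show ?thesis unfolding component_def
    using assms(3) by (intro the1_equality) auto
qed

lemma component_in:
  assumes "graded_space s I G C" "x \<in> C" "i \<in> I"
  shows "component I G x i \<in> G i"
  using component_decomposition[OF assms(1,2)] assms(3) by (simp add: decomposition_def)

text \<open>The images of the components decompose the image, and decompositions are unique. Applied
  to scalars, to multiplication by an element of some weight, which shifts degrees, and to parity
  projections.\<close>

lemma component_additive_map:
  assumes G: "graded_space s I G C" and G': "graded_space s' I G' C'"
    and f: "\<And>x y. x \<in> C \<Longrightarrow> y \<in> C \<Longrightarrow> f (x + y) = f x + f y"
    and tau: "bij_betw \<tau> I I" "\<And>i x. i \<in> I \<Longrightarrow> x \<in> G i \<Longrightarrow> f x \<in> G' (\<tau> i)"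
    and x: "x \<in> C" "f x \<in> C'" and i: "i \<in> I"
  shows "component I G' (f x) (\<tau> i) = f (component I G x i)"
proof -
  let ?c = "component I G x" and ?S = "{i. component I G x i \<noteq> 0}"
  have d: "decomposition I G x ?c" by (rule component_decomposition[OF G x(1)])
  have S: "finite ?S" "?S \<subseteq> I" using d by (auto simp: decomposition_def)
  have C: "module.subspace s C" "vector_space s" using G by (auto simp: graded_space_def)
  interpret vector_space s by fact
  have c: "?c i \<in> C" for i
    using d G subspace_0[OF C(1)] by (cases "i \<in> I") (auto simp: decomposition_def graded_space_def)
  have f0: "f 0 = 0" using f[of 0 0] subspace_0[OF C(1)] by simp
  have fsum: "f (\<Sum>i\<in>J. ?c i) = (\<Sum>i\<in>J. f (?c i))" if "finite J" for J
    using that by induction (simp_all add: f0 f c subspace_sum[OF C(1)])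
  define g where "g = (\<lambda>j. if j \<in> I then f (?c (inv_into I \<tau> j)) else 0)"
  have inv: "inv_into I \<tau> (\<tau> i) = i" if "i \<in> I" for i
    using tau(1) that by (simp add: bij_betw_def)
  have g: "g (\<tau> i) = f (?c i)" if "i \<in> I" for i
    using that inv bij_betwE[OF tau(1)] by (simp add: g_def)
  have "decomposition I G' (f x) g"
  proof (rule decompositionI[where J = "\<tau> ` ?S"])
    fix j assume "j \<in> I"
    then obtain i where "i \<in> I" "j = \<tau> i" using tau(1) by (auto simp: bij_betw_def)
    then show "g j \<in> G' j" using g tau(2) d by (auto simp: decomposition_def)
  next
    show "{i. g i \<noteq> 0} \<subseteq> \<tau> ` ?S"
    proof clarify
      fix j assume j: "g j \<noteq> 0"
      then have "j \<in> I" by (auto simp: g_def split: if_splits)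
      then obtain i where i: "i \<in> I" "j = \<tau> i" using tau(1) by (auto simp: bij_betw_def)
      then have "f (?c i) \<noteq> 0" using j g by simp
      then have "?c i \<noteq> 0" using f0 by auto
      then show "j \<in> \<tau> ` ?S" using i by blast
    qed
  next
    have inj: "inj_on \<tau> ?S" using tau(1) S(2) by (auto simp: bij_betw_def intro: inj_on_subset)
    have "f x = f (\<Sum>i\<in>?S. ?c i)" using d by (simp add: decomposition_def)
    also have "\<dots> = (\<Sum>i\<in>?S. g (\<tau> i))"
      unfolding fsum[OF S(1)] by (rule sum.cong) (use S(2) in \<open>auto simp: g\<close>)
    also have "\<dots> = (\<Sum>j\<in>\<tau> ` ?S. g j)" by (simp add: sum.reindex[OF inj])
    finally show "f x = (\<Sum>j\<in>\<tau> ` ?S. g j)" .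
  qed (use S in \<open>auto simp: g_def\<close>)
  then show ?thesis using component_unique[OF G' x(2)] g i by simp
qed

lemma component_add:
  assumes "graded_space s I G C" "x \<in> C" "y \<in> C"
  shows "component I G (x + y) i = component I G x i + component I G y i"
proof -
  note d = component_decomposition[OF assms(1,2)] component_decomposition[OF assms(1,3)]
  interpret vector_space s using assms(1) by (simp add: graded_space_def)
  have sub: "subspace C" "\<And>i. i \<in> I \<Longrightarrow> subspace (G i)" using assms(1) by (auto simp: graded_space_def)
  let ?J = "{i. component I G x i \<noteq> 0} \<union> {i. component I G y i \<noteq> 0}"
  have J: "finite ?J" using d by (auto simp: decomposition_def)
  have "decomposition I G (x + y) (\<lambda>i. component I G x i + component I G y i)"
  proof (rule decompositionI[OF _ _ J])
    show "x + y = (\<Sum>i\<in>?J. component I G x i + component I G y i)"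
      unfolding sum.distrib
    by (intro arg_cong2[where f="(+)"] decomposition_sum[OF d(1) J] decomposition_sum[OF d(2) J]) auto
  qed (use d sub in \<open>auto simp: decomposition_def intro: subspace_add\<close>)
  moreover have "x + y \<in> C" using sub assms(2,3) by (simp add: subspace_add)
  ultimately have "component I G (x + y) = (\<lambda>i. component I G x i + component I G y i)"
    by (intro component_unique[OF assms(1)])
  then show ?thesis by (rule fun_cong)
qed

lemma component_homogeneous:
  assumes "graded_space s I G C" "i \<in> I" "x \<in> G i"
  shows "component I G x j = (if j = i then x else 0)"
proof -
  interpret vector_space s using assms(1) by (simp add: graded_space_def)
  have "decomposition I G x (\<lambda>j. if j = i then x else 0)"
    using assms
    by (intro decompositionI[where J="{i}"]) (auto simp: graded_space_def subspace_0)
  moreover have "x \<in> C" using assms by (auto simp: graded_space_def)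
  ultimately have "component I G x = (\<lambda>j. if j = i then x else 0)"
    by (intro component_unique[OF assms(1)])
  then show ?thesis by (rule fun_cong)
qed

lemma component_scale:
  assumes "graded_space s I G C" "x \<in> C" "i \<in> I"
  shows "component I G (s c x) i = s c (component I G x i)"
proof -
  interpret vector_space s using assms(1) by (simp add: graded_space_def)
  have sub: "subspace C" "\<And>i. i \<in> I \<Longrightarrow> subspace (G i)" using assms(1) by (auto simp: graded_space_def)
  show ?thesis
  proof (rule component_additive_map[OF assms(1) assms(1), where \<tau> = "\<lambda>i. i"])
    show "bij_betw (\<lambda>i. i) I I" by (simp add: bij_betw_def)
  qed (use assms sub in \<open>simp_all add: scale_right_distrib subspace_scale\<close>)
qed

section \<open>Parity decompositions and Koszul signs\<close>

lemma UNIV_bit: "(UNIV :: bit set) = {0, 1}"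
  by (auto intro: bit.exhaust)

lemma sum_bit: "(\<Sum>p\<in>UNIV. f p) = f 0 + f (1::bit)"
  by (simp add: UNIV_bit)

lemma decomposition_bit:
  "decomposition UNIV P x f \<longleftrightarrow> (\<forall>p. f p \<in> P p) \<and> x = f 0 + f (1::bit)"
proof -
  have [simp]: "finite (UNIV :: bit set)" by (simp add: UNIV_bit)
  have "finite {i. f i \<noteq> 0}" by (rule finite_subset[of _ UNIV]) simp_all
  moreover have "(\<Sum>i | f i \<noteq> 0. f i) = (\<Sum>i\<in>UNIV. f i)"
    by (rule sum.mono_neutral_left) auto
  ultimately show ?thesis by (simp add: decomposition_def sum_bit)
qed

lemma koszul_add: "koszul p q (x + y) = koszul p q x + koszul p q y"
  by (simp add: koszul_def)

lemma koszul_diff: "koszul p q (x - y) = koszul p q x - koszul p q y"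
  by (simp add: koszul_def)

lemma koszul_minus: "koszul p q (- x) = - koszul p q x"
  by (simp add: koszul_def)

lemma koszul_zero [simp]: "koszul p q 0 = 0"
  by (simp add: koszul_def)

lemma koszul_koszul: "koszul p q (koszul p q x) = x" "koszul p q (koszul q p x) = x"
  by (simp_all add: koszul_def)

lemma koszul_left: "koszul (p + p') q x = koszul p q (koszul p' q x)"
  by (cases p; cases p'; cases q) (simp_all add: koszul_def)

lemma koszul_right: "koszul p (q + q') x = koszul p q (koszul p q' x)"
  by (cases p; cases q'; cases q) (simp_all add: koszul_def)

lemma koszul_fun: "koszul p q f t = koszul p q (f t)"
  by (simp add: koszul_def)


locale super_space_on = char0_space s for s :: "'k::field_char_0 \<Rightarrow> 'w::ab_group_add \<Rightarrow> 'w" +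
  fixes P :: "bit \<Rightarrow> 'w set" and C :: "'w set"
  assumes super: "super_space s P C"
begin

abbreviation pp :: "'w \<Rightarrow> bit \<Rightarrow> 'w" where "pp \<equiv> parity_part P"

lemma C_sub: "subspace C" and P_sub: "subspace (P p)" and P_C: "x \<in> P p \<Longrightarrow> x \<in> C"
  using super by (auto simp: graded_space_def)

lemmas C_closed = subspace_0[OF C_sub] subspace_add[OF C_sub] subspace_diff[OF C_sub]
  subspace_neg[OF C_sub] subspace_scale[OF C_sub] subspace_sum[OF C_sub]

lemmas P_closed = subspace_0[OF P_sub] subspace_add[OF P_sub] subspace_diff[OF P_sub]
  subspace_neg[OF P_sub] subspace_scale[OF P_sub] subspace_sum[OF P_sub]

lemma pp_P: "x \<in> C \<Longrightarrow> pp x p \<in> P p"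
  using component_in[OF super] by simp

lemma pp_C: "x \<in> C \<Longrightarrow> pp x p \<in> C"
  using pp_P P_C by blast

lemma pp_sum: "x \<in> C \<Longrightarrow> pp x 0 + pp x 1 = x"
  using component_decomposition[OF super] by (simp add: decomposition_bit)

lemma pp_add: "x \<in> C \<Longrightarrow> y \<in> C \<Longrightarrow> pp (x + y) p = pp x p + pp y p"
  by (rule component_add[OF super])

lemma pp_scale: "x \<in> C \<Longrightarrow> pp (s c x) p = s c (pp x p)"
  by (rule component_scale[OF super]) simp_all

lemma pp_hom: "x \<in> P p \<Longrightarrow> pp x q = (if q = p then x else 0)"
  using component_homogeneous[OF super] by simp

lemma pp_zero [simp]: "pp 0 q = 0"
  using pp_hom[OF P_closed(1)] by simp

text \<open>As the vanishing of the other component, homogeneity passes to infinite sums, because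
  parity projections are continuous.\<close>

lemma P_iff: assumes "x \<in> C" shows "x \<in> P p \<longleftrightarrow> pp x (p + 1) = 0"
proof
  assume "x \<in> P p"
  then show "pp x (p + 1) = 0" by (cases p) (simp_all add: pp_hom)
next
  assume "pp x (p + 1) = 0"
  then have "x = pp x p" using pp_sum[OF assms] by (cases p) simp_all
  then show "x \<in> P p" using pp_P[OF assms, of p] by simp
qed

lemma koszul_C: "x \<in> C \<Longrightarrow> koszul p q x \<in> C"
  by (simp add: koszul_def C_closed)

lemma koszul_scale: "koszul p q (s c x) = s c (koszul p q x)"
  by (simp add: koszul_def)

end


section \<open>Algebras of modes\<close>

text \<open>Unordered summation in a linear topology. When the members of \<open>\<U>\<close> are
  subspaces, one finite set whose tail lies in U controls all larger partial sums, so no order of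
  the indices is involved.\<close>

definition has_sum_in :: "'w::ab_group_add set \<Rightarrow> 'w set set \<Rightarrow> 'i set \<Rightarrow> ('i \<Rightarrow> 'w) \<Rightarrow> 'w \<Rightarrow> bool" where
  "has_sum_in C \<U> A f x \<longleftrightarrow> f ` A \<subseteq> C \<and> x \<in> C \<and>
     (\<forall>U\<in>\<U>. \<exists>F. finite F \<and> F \<subseteq> A \<and> f ` (A - F) \<subseteq> U \<and> x - sum f F \<in> U)"

locale mode_space = super_space_on s P C
  for s :: "'k::field_char_0 \<Rightarrow> 'w::ab_group_add \<Rightarrow> 'w" and P C +
  fixes \<U> :: "'w set set"
  assumes nbhd_sub: "U \<in> \<U> \<Longrightarrow> subspace U"
    and nbhd_par: "U \<in> \<U> \<Longrightarrow> x \<in> U \<Longrightarrow> x \<in> C \<Longrightarrow> parity_part P x p \<in> U"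
    and nbhd_sep: "x \<in> C \<Longrightarrow> (\<And>U. U \<in> \<U> \<Longrightarrow> x \<in> U) \<Longrightarrow> x = 0"
begin

abbreviation hs :: "'i set \<Rightarrow> ('i \<Rightarrow> 'w) \<Rightarrow> 'w \<Rightarrow> bool" where "hs \<equiv> has_sum_in C \<U>"

lemma hsD:
  assumes "hs A f x"
  shows "i \<in> A \<Longrightarrow> f i \<in> C" "x \<in> C"
    "U \<in> \<U> \<Longrightarrow> \<exists>F. finite F \<and> F \<subseteq> A \<and> f ` (A - F) \<subseteq> U \<and> x - sum f F \<in> U"
  using assms by (auto simp: has_sum_in_def)

text \<open>The definition provides some finite set F', the conclusion holds for every F with small
  tail: the two sets differ by indices whose terms lie in the subspace U.\<close>

lemma hs_approx:
  assumes "hs A f x" "U \<in> \<U>" "finite F" "F \<subseteq> A" "f ` (A - F) \<subseteq> U"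
  shows "x - sum f F \<in> U"
proof -
  obtain F' where F': "finite F'" "F' \<subseteq> A" "f ` (A - F') \<subseteq> U" "x - sum f F' \<in> U"
    using hsD(3)[OF assms(1,2)] by blast
  note U = nbhd_sub[OF assms(2)]
  have "sum f F + sum f (F' - F) = sum f (F \<union> F')"
    using assms(3) F'(1) by (subst sum.union_disjoint[symmetric]) (auto simp: Un_Diff_cancel)
  moreover have "sum f F' + sum f (F - F') = sum f (F \<union> F')"
    using assms(3) F'(1) by (subst sum.union_disjoint[symmetric]) (auto simp: Un_Diff_cancel Un_commute)
  ultimately have "x - sum f F = (x - sum f F') + sum f (F' - F) - sum f (F - F')"
    by (simp add: algebra_simps)
  moreover have "sum f (F' - F) \<in> U" "sum f (F - F') \<in> U"
    by (rule subspace_sum[OF U], use assms(4,5) F'(2,3) in blast)+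
  ultimately show ?thesis
    using subspace_diff[OF U subspace_add[OF U F'(4)]] by (simp only:)
qed

lemma hs_map:
  assumes h: "hs A f x" and g: "\<And>x. x \<in> C \<Longrightarrow> g x \<in> C"
    "\<And>x y. x \<in> C \<Longrightarrow> y \<in> C \<Longrightarrow> g (x + y) = g x + g y"
    and cont: "\<And>U. U \<in> \<U> \<Longrightarrow> \<exists>U'\<in>\<U>. \<forall>x\<in>U' \<inter> C. g x \<in> U"
  shows "hs A (\<lambda>i. g (f i)) (g x)"
  unfolding has_sum_in_def
proof (intro conjI ballI)
  show "(\<lambda>i. g (f i)) ` A \<subseteq> C" "g x \<in> C" using g hsD[OF h] by auto
next
  fix U assume "U \<in> \<U>"
  then obtain U' where U': "U' \<in> \<U>" "\<And>x. x \<in> U' \<Longrightarrow> x \<in> C \<Longrightarrow> g x \<in> U" using cont by blast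
  obtain F where F: "finite F" "F \<subseteq> A" "f ` (A - F) \<subseteq> U'" "x - sum f F \<in> U'"
    using hsD(3)[OF h U'(1)] by blast
  have g0: "g 0 = 0" using g(2)[of 0 0] C_closed by simp
  have sC: "sum f J \<in> C" if "J \<subseteq> A" for J using hsD(1)[OF h] that by (auto intro: C_closed)
  have gs: "J \<subseteq> A \<Longrightarrow> g (sum f J) = (\<Sum>i\<in>J. g (f i))" if "finite J" for J
    using that by induction (use g0 g(2) hsD(1)[OF h] sC in auto)
  have "g x = g (x - sum f F) + g (sum f F)"
    using g(2)[of "x - sum f F" "sum f F"] hsD(2)[OF h] sC[OF F(2)] C_closed by simp
  then have "g x - (\<Sum>i\<in>F. g (f i)) = g (x - sum f F)" using gs F by simp
  moreover have "g (x - sum f F) \<in> U"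
    using U'(2) F hsD(2)[OF h] sC C_closed by auto
  moreover have "(\<lambda>i. g (f i)) ` (A - F) \<subseteq> U" using U'(2) F(3) hsD(1)[OF h] by blast
  ultimately show "\<exists>F. finite F \<and> F \<subseteq> A \<and> (\<lambda>i. g (f i)) ` (A - F) \<subseteq> U \<and> g x - (\<Sum>i\<in>F. g (f i)) \<in> U"
    using F by metis
qed

lemma hs_scale: "hs A f x \<Longrightarrow> hs A (\<lambda>i. s c (f i)) (s c x)"
  by (rule hs_map) (auto simp: C_closed scale_right_distrib intro: subspace_scale[OF nbhd_sub])

lemma hs_pp: "hs A f x \<Longrightarrow> hs A (\<lambda>i. pp (f i) p) (pp x p)"
  by (rule hs_map[where g="\<lambda>x. pp x p"]) (auto simp: pp_C pp_add intro: nbhd_par)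

lemma hs_minus: "hs A f x \<Longrightarrow> hs A (\<lambda>i. - f i) (- x)"
  using hs_scale[of A f x "-1"] by simp

lemma hs_koszul: "hs A f x \<Longrightarrow> hs A (\<lambda>i. koszul p q (f i)) (koszul p q x)"
  using hs_minus by (auto simp: koszul_def)

lemma hs_add:
  assumes "hs A f x" "hs A g y"
  shows "hs A (\<lambda>i. f i + g i) (x + y)"
  unfolding has_sum_in_def
proof (intro conjI ballI)
  show "(\<lambda>i. f i + g i) ` A \<subseteq> C" "x + y \<in> C"
    using hsD[OF assms(1)] hsD[OF assms(2)] C_closed by auto
next
  fix U assume U: "U \<in> \<U>"
  obtain F where F: "finite F" "F \<subseteq> A" "f ` (A - F) \<subseteq> U" using hsD(3)[OF assms(1) U] by blast
  obtain F' where F': "finite F'" "F' \<subseteq> A" "g ` (A - F') \<subseteq> U" using hsD(3)[OF assms(2) U] by blast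
  have 1: "x - sum f (F \<union> F') \<in> U" "y - sum g (F \<union> F') \<in> U"
    using F F' by (auto intro!: hs_approx[OF assms(1) U] hs_approx[OF assms(2) U])
  have "(x + y) - (\<Sum>i\<in>F \<union> F'. f i + g i) = (x - sum f (F \<union> F')) + (y - sum g (F \<union> F'))"
    by (simp add: sum.distrib)
  then have "(x + y) - (\<Sum>i\<in>F \<union> F'. f i + g i) \<in> U" using subspace_add[OF nbhd_sub[OF U] 1] by (simp only:)
  moreover have "(\<lambda>i. f i + g i) ` (A - (F \<union> F')) \<subseteq> U"
    using F F' subspace_add[OF nbhd_sub[OF U]] by blast
  ultimately show "\<exists>F. finite F \<and> F \<subseteq> A \<and> (\<lambda>i. f i + g i) ` (A - F) \<subseteq> U \<and> x + y - (\<Sum>i\<in>F. f i + g i) \<in> U"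
    using F F' by (intro exI[of _ "F \<union> F'"]) auto
qed

lemma hs_diff: "hs A f x \<Longrightarrow> hs A g y \<Longrightarrow> hs A (\<lambda>i. f i - g i) (x - y)"
  using hs_add[OF _ hs_minus, of A f x g y] by simp

lemma hs_finite:
  assumes "finite A" "f ` A \<subseteq> C"
  shows "hs A f (sum f A)"
  unfolding has_sum_in_def
proof (intro conjI ballI)
  show "sum f A \<in> C" using assms by (auto intro!: C_closed)
  show "\<exists>F. finite F \<and> F \<subseteq> A \<and> f ` (A - F) \<subseteq> U \<and> sum f A - sum f F \<in> U" if "U \<in> \<U>" for U
    using assms(1) subspace_0[OF nbhd_sub[OF that]] by (intro exI[of _ A]) simp
qed (rule assms(2))

lemma hs_zero: "hs A (\<lambda>i. 0) 0"
  unfolding has_sum_in_def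
proof (intro conjI ballI)
  show "\<exists>F. finite F \<and> F \<subseteq> A \<and> (\<lambda>i. 0) ` (A - F) \<subseteq> U \<and> 0 - (\<Sum>i\<in>F. 0) \<in> U" if "U \<in> \<U>" for U
    using subspace_0[OF nbhd_sub[OF that]] by (intro exI[of _ "{}"]) auto
qed (auto simp: C_closed)

lemma hs_unique:
  assumes "hs A f x" "hs A f y"
  shows "x = y"
proof -
  have "hs A (\<lambda>i. 0) (x - y)" using hs_diff[OF assms] by simp
  then have "x - y \<in> U" if "U \<in> \<U>" for U
    using hs_approx[of A "\<lambda>i. 0" "x - y" U "{}"] that subspace_0[OF nbhd_sub] by auto
  moreover have "x - y \<in> C"
    by (rule C_closed(3)[OF hsD(2)[OF assms(1)] hsD(2)[OF assms(2)]])
  ultimately have "x - y = 0" by (intro nbhd_sep)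
  then show ?thesis by simp
qed

lemma hs_cong: "(\<And>i. i \<in> A \<Longrightarrow> f i = g i) \<Longrightarrow> hs A f x \<Longrightarrow> hs A g x"
proof -
  assume eq: "\<And>i. i \<in> A \<Longrightarrow> f i = g i" and h: "hs A f x"
  have im: "g ` F = f ` F" "sum g F = sum f F" if "F \<subseteq> A" for F
    using eq that by (auto intro!: sum.cong image_cong)
  show ?thesis using h unfolding has_sum_in_def
    by (metis im Diff_subset order_refl)
qed

lemma hs_superset:
  assumes "hs A f x" "A \<subseteq> B" "\<And>i. i \<in> B - A \<Longrightarrow> f i = 0"
  shows "hs B f x"
  unfolding has_sum_in_def
proof (intro conjI ballI)
  show "f ` B \<subseteq> C"
  proof (intro image_subsetI)
    fix i assume "i \<in> B"
    then show "f i \<in> C" using hsD(1)[OF assms(1)] assms(3) C_closed(1) by (cases "i \<in> A") auto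
  qed
  show "x \<in> C" by (rule hsD(2)[OF assms(1)])
next
  fix U assume U: "U \<in> \<U>"
  obtain F where F: "finite F" "F \<subseteq> A" "f ` (A - F) \<subseteq> U" "x - sum f F \<in> U"
    using hsD(3)[OF assms(1) U] by blast
  have "f ` (B - F) \<subseteq> U"
  proof (intro image_subsetI)
    fix i assume "i \<in> B - F"
    then show "f i \<in> U"
      using F(3) assms(3)[of i] subspace_0[OF nbhd_sub[OF U]] by (cases "i \<in> A") auto
  qed
  then show "\<exists>F. finite F \<and> F \<subseteq> B \<and> f ` (B - F) \<subseteq> U \<and> x - sum f F \<in> U"
    using F order_trans[OF F(2) assms(2)] by (intro exI[of _ F] conjI)
qed

lemma hs_reindex:
  assumes "hs (h ` B) f x" "inj_on h B"
  shows "hs B (\<lambda>i. f (h i)) x"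
  unfolding has_sum_in_def
proof (intro conjI ballI)
  show "(\<lambda>i. f (h i)) ` B \<subseteq> C" "x \<in> C" using hsD[OF assms(1)] by auto
next
  fix U assume U: "U \<in> \<U>"
  obtain F where F: "finite F" "F \<subseteq> h ` B" "f ` (h ` B - F) \<subseteq> U" "x - sum f F \<in> U"
    using hsD(3)[OF assms(1) U] by blast
  define F' where "F' = {i \<in> B. h i \<in> F}"
  have hF: "h ` F' = F" using F(2) by (auto simp: F'_def)
  have inj: "inj_on h F'" using assms(2) by (rule inj_on_subset) (auto simp: F'_def)
  have "finite F'" using F(1) hF inj finite_image_iff by metis
  moreover have "sum f F = (\<Sum>i\<in>F'. f (h i))" using sum.reindex[OF inj, of f] hF by simp
  moreover have "(\<lambda>i. f (h i)) ` (B - F') \<subseteq> U" using F(3) by (auto simp: F'_def)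
  ultimately show "\<exists>F. finite F \<and> F \<subseteq> B \<and> (\<lambda>i. f (h i)) ` (B - F) \<subseteq> U \<and> x - (\<Sum>i\<in>F. f (h i)) \<in> U"
    using F(4) by (intro exI[of _ F']) (auto simp: F'_def)
qed

text \<open>Modulo U, the sum of a fibre equals the sum over the part of F in that fibre, by
  \<open>hs_approx\<close>; for a fibre that misses F it therefore lies in U.\<close>

lemma sum_fibres_in_nbhd:
  assumes "U \<in> \<U>" "finite F" "F \<subseteq> A" "f ` (A - F) \<subseteq> U"
    "\<And>k. k \<in> K \<Longrightarrow> hs {i \<in> A. \<pi> i = k} f (r k)" "\<pi> ` A \<subseteq> K"
  shows "(\<Sum>k\<in>\<pi> ` F. r k) - sum f F \<in> U" "r ` (K - \<pi> ` F) \<subseteq> U"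
proof -
  have fib: "r k - sum f {i \<in> F. \<pi> i = k} \<in> U" if "k \<in> K" for k
    by (rule hs_approx[OF assms(5)[OF that] assms(1)]) (use assms(2-4) in auto)
  have "sum f F = (\<Sum>k\<in>\<pi> ` F. sum f {i \<in> F. \<pi> i = k})"
    using sum.image_gen[OF assms(2), of f \<pi>] by simp
  then have "(\<Sum>k\<in>\<pi> ` F. r k) - sum f F = (\<Sum>k\<in>\<pi> ` F. r k - sum f {i \<in> F. \<pi> i = k})"
    by (simp add: sum_subtractf)
  also have "\<dots> \<in> U" using fib assms(3,6) by (intro subspace_sum[OF nbhd_sub[OF assms(1)]]) auto
  finally show "(\<Sum>k\<in>\<pi> ` F. r k) - sum f F \<in> U" .
  show "r ` (K - \<pi> ` F) \<subseteq> U"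
  proof clarify
    fix k assume k: "k \<in> K" "k \<notin> \<pi> ` F"
    then have "{i \<in> F. \<pi> i = k} = {}" by auto
    then have "sum f {i \<in> F. \<pi> i = k} = 0" by (simp only: sum.empty)
    then show "r k \<in> U" using fib[OF k(1)] by (simp only: diff_0_right)
  qed
qed

lemma hs_fibres:
  assumes h: "hs A f x" and r: "\<And>k. k \<in> K \<Longrightarrow> hs {i \<in> A. \<pi> i = k} f (r k)" and K: "\<pi> ` A \<subseteq> K"
  shows "hs K r x"
  unfolding has_sum_in_def
proof (intro conjI ballI)
  show "r ` K \<subseteq> C" "x \<in> C" using hsD(2)[OF r] hsD(2)[OF h] by auto
next
  fix U assume U: "U \<in> \<U>"
  obtain F where F: "finite F" "F \<subseteq> A" "f ` (A - F) \<subseteq> U" "x - sum f F \<in> U"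
    using hsD(3)[OF h U] by blast
  note fib = sum_fibres_in_nbhd[OF U F(1-3) r K]
  have "x - (\<Sum>k\<in>\<pi> ` F. r k) = (x - sum f F) - ((\<Sum>k\<in>\<pi> ` F. r k) - sum f F)" by simp
  also have "\<dots> \<in> U" by (rule subspace_diff[OF nbhd_sub[OF U] F(4) fib(1)])
  finally show "\<exists>F. finite F \<and> F \<subseteq> K \<and> r ` (K - F) \<subseteq> U \<and> x - sum r F \<in> U"
    using fib(2) F(1) image_mono[OF F(2), of \<pi>] K by (intro exI[of _ "\<pi> ` F"] conjI) simp_all
qed

text \<open>Fibre sums may converge through cancellation while infinitely many terms stay large. The
  hypothesis \<open>null\<close> excludes this and supplies the finite set of exceptional
  indices.\<close>

lemma hs_from_fibres:
  assumes r: "\<And>k. k \<in> K \<Longrightarrow> hs {i \<in> A. \<pi> i = k} f (r k)" and x: "hs K r x" and K: "\<pi> ` A \<subseteq> K"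
    and null: "\<And>U. U \<in> \<U> \<Longrightarrow> finite {i \<in> A. f i \<notin> U}"
  shows "hs A f x"
  unfolding has_sum_in_def
proof (intro conjI ballI)
  show "f ` A \<subseteq> C" using hsD(1)[OF r] K by blast
  show "x \<in> C" by (rule hsD(2)[OF x])
next
  fix U assume U: "U \<in> \<U>"
  define F where "F = {i \<in> A. f i \<notin> U}"
  have F: "finite F" "F \<subseteq> A" "f ` (A - F) \<subseteq> U" using null[OF U] by (auto simp: F_def)
  note fib = sum_fibres_in_nbhd[OF U F r K]
  have "x - sum r (\<pi> ` F) \<in> U"
    by (rule hs_approx[OF x U]) (use F(1) image_mono[OF F(2), of \<pi>] fib(2) K in simp_all)
  then have "(x - sum r (\<pi> ` F)) + ((\<Sum>k\<in>\<pi> ` F. r k) - sum f F) \<in> U"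
    using subspace_add[OF nbhd_sub[OF U] _ fib(1)] by blast
  then have "x - sum f F \<in> U" by simp
  then show "\<exists>F. finite F \<and> F \<subseteq> A \<and> f ` (A - F) \<subseteq> U \<and> x - sum f F \<in> U"
    using F by (intro exI[of _ F] conjI)
qed

end

text \<open>
  \<open>C\<close> is the algebra containing the modes, \<open>\<U>\<close> a basis of neighbourhoods of \<open>0\<close> for a linear
  topology on it, and \<open>D\<close> a space of distributions whose modes \<open>a\<^sub>t\<close> tend to \<open>0\<close>, uniformly
  after multiplication from the left, as \<open>t \<rightarrow> \<infinity>\<close>.
\<close>

locale mode_algebra = mode_space s P C \<U>
  for s :: "'k::field_char_0 \<Rightarrow> 'w::ab_group_add \<Rightarrow> 'w" and P C \<U> +
  fixes m :: "'w \<Rightarrow> 'w \<Rightarrow> 'w" and e :: 'w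
    and \<sigma> :: "(nat \<Rightarrow> 'w) \<Rightarrow> 'w" and D :: "'w distribution set"
  assumes m_closed: "x \<in> C \<Longrightarrow> y \<in> C \<Longrightarrow> m x y \<in> C"
    and m_add_left: "x \<in> C \<Longrightarrow> y \<in> C \<Longrightarrow> z \<in> C \<Longrightarrow> m (x + y) z = m x z + m y z"
    and m_add_right: "x \<in> C \<Longrightarrow> y \<in> C \<Longrightarrow> z \<in> C \<Longrightarrow> m x (y + z) = m x y + m x z"
    and m_scale_left: "x \<in> C \<Longrightarrow> y \<in> C \<Longrightarrow> m (s k x) y = s k (m x y)"
    and m_scale_right: "x \<in> C \<Longrightarrow> y \<in> C \<Longrightarrow> m x (s k y) = s k (m x y)"
    and m_assoc: "x \<in> C \<Longrightarrow> y \<in> C \<Longrightarrow> z \<in> C \<Longrightarrow> m (m x y) z = m x (m y z)"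
    and m_par: "x \<in> P p \<Longrightarrow> y \<in> P q \<Longrightarrow> m x y \<in> P (p + q)"
    and e_par: "e \<in> P 0"
    and m_e: "x \<in> C \<Longrightarrow> m e x = x" "x \<in> C \<Longrightarrow> m x e = x"
    and nbhd_left: "c \<in> C \<Longrightarrow> U \<in> \<U> \<Longrightarrow> \<exists>U'\<in>\<U>. \<forall>x\<in>U' \<inter> C. m c x \<in> U"
    and nbhd_right: "c \<in> C \<Longrightarrow> U \<in> \<U> \<Longrightarrow> \<exists>U'\<in>\<U>. \<forall>x\<in>U' \<inter> C. m x c \<in> U"
    and D_C: "a \<in> D \<Longrightarrow> a t \<in> C"
    and D_zero: "0 \<in> D"
    and D_add: "a \<in> D \<Longrightarrow> b \<in> D \<Longrightarrow> a + b \<in> D"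
    and D_scale: "a \<in> D \<Longrightarrow> (\<lambda>t. s k (a t)) \<in> D"
    and D_shift: "a \<in> D \<Longrightarrow> (\<lambda>t. a (t + i)) \<in> D"
    and D_left: "c \<in> C \<Longrightarrow> a \<in> D \<Longrightarrow> (\<lambda>t. m c (a t)) \<in> D"
    and D_right: "c \<in> C \<Longrightarrow> a \<in> D \<Longrightarrow> (\<lambda>t. m (a t) c) \<in> D"
    and D_par: "a \<in> D \<Longrightarrow> (\<lambda>t. parity_part P (a t) p) \<in> D"
    and D_null: "a \<in> D \<Longrightarrow> U \<in> \<U> \<Longrightarrow> \<exists>N. \<forall>t\<ge>N. \<forall>x\<in>C. m x (a t) \<in> U"
    and D_sum: "a \<in> D \<Longrightarrow> b \<in> D \<Longrightarrow>
      \<exists>x. has_sum_in C \<U> UNIV (\<lambda>n. m (a (- 1 - int n)) (b (int n))) x"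
    and sigma: "has_sum_in C \<U> UNIV f x \<Longrightarrow> \<sigma> f = x"
begin

lemma m_zero: "x \<in> C \<Longrightarrow> m 0 x = 0" "x \<in> C \<Longrightarrow> m x 0 = 0"
  using m_add_left[of 0 0 x] m_add_right[of x 0 0] C_closed by auto

lemma m_minus: "x \<in> C \<Longrightarrow> y \<in> C \<Longrightarrow> m (- x) y = - m x y" "x \<in> C \<Longrightarrow> y \<in> C \<Longrightarrow> m x (- y) = - m x y"
  using m_scale_left[of x y "-1"] m_scale_right[of x y "-1"] by simp_all

lemma m_diff: "x \<in> C \<Longrightarrow> y \<in> C \<Longrightarrow> z \<in> C \<Longrightarrow> m (x - y) z = m x z - m y z"
    "x \<in> C \<Longrightarrow> y \<in> C \<Longrightarrow> z \<in> C \<Longrightarrow> m x (y - z) = m x y - m x z"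
  using m_add_left[of x "- y" z] m_add_right[of x y "- z"] C_closed by (simp_all add: m_minus)

lemma m_koszul:
  "x \<in> C \<Longrightarrow> y \<in> C \<Longrightarrow> m (koszul p q x) y = koszul p q (m x y)"
  "x \<in> C \<Longrightarrow> y \<in> C \<Longrightarrow> m x (koszul p q y) = koszul p q (m x y)"
  by (simp_all add: koszul_def m_minus)

lemma m_sum:
  assumes "finite J" "\<And>i. i \<in> J \<Longrightarrow> f i \<in> C" "c \<in> C"
  shows "m (\<Sum>i\<in>J. f i) c = (\<Sum>i\<in>J. m (f i) c)" "m c (\<Sum>i\<in>J. f i) = (\<Sum>i\<in>J. m c (f i))"
  using assms(1,2)
  by (induction J) (simp_all add: m_zero m_add_left m_add_right C_closed assms(3))

lemma hs_left: "hs A f x \<Longrightarrow> c \<in> C \<Longrightarrow> hs A (\<lambda>i. m c (f i)) (m c x)"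
  by (rule hs_map) (auto simp: m_closed m_add_right nbhd_left)

lemma hs_right: "hs A f x \<Longrightarrow> c \<in> C \<Longrightarrow> hs A (\<lambda>i. m (f i) c) (m x c)"
  by (rule hs_map[where g="\<lambda>x. m x c"]) (auto simp: m_closed m_add_left nbhd_right)

lemma hs_subset:
  assumes h: "hs B f x" and "A \<subseteq> B" and z: "\<And>i. i \<in> B - A \<Longrightarrow> f i = 0"
  shows "hs A f x"
  unfolding has_sum_in_def
proof (intro conjI ballI)
  show "f ` A \<subseteq> C" using hsD(1)[OF h] \<open>A \<subseteq> B\<close> by auto
  show "x \<in> C" by (rule hsD(2)[OF h])
next
  fix U assume U: "U \<in> \<U>"
  obtain F where F: "finite F" "F \<subseteq> B" "f ` (B - F) \<subseteq> U" "x - sum f F \<in> U"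
    using hsD(3)[OF h U] by blast
  have "sum f (F \<inter> A) = sum f F"
    by (rule sum.mono_neutral_left) (use F z in auto)
  then have "x - sum f (F \<inter> A) \<in> U" using F(4) by simp
  moreover have "f ` (A - F \<inter> A) \<subseteq> U" using F(3) \<open>A \<subseteq> B\<close> by auto
  ultimately show "\<exists>F. finite F \<and> F \<subseteq> A \<and> f ` (A - F) \<subseteq> U \<and> x - sum f F \<in> U"
    using F(1) by (intro exI[of _ "F \<inter> A"]) simp
qed

lemma hs_single: "k \<in> A \<Longrightarrow> f k \<in> C \<Longrightarrow> (\<And>i. i \<in> A \<Longrightarrow> i \<noteq> k \<Longrightarrow> f i = 0) \<Longrightarrow> hs A f (f k)"
  using hs_superset[OF hs_finite[of "{k}" f], of A] by simp

lemma hs_Suc: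
  assumes "hs UNIV f x"
  shows "hs UNIV (\<lambda>n. f (Suc n)) (x - f 0)"
proof -
  let ?g = "\<lambda>n::nat. if n = 0 then f 0 else 0"
  have "hs UNIV ?g (f 0)"
  proof -
    have "hs UNIV ?g (sum ?g {0})"
      by (rule hs_superset[OF hs_finite]) (use hsD(1)[OF assms, of 0] in auto)
    then show ?thesis by simp
  qed
  then have "hs UNIV (\<lambda>n. f n - ?g n) (x - f 0)" using hs_diff[OF assms] by simp
  then have "hs (range Suc) (\<lambda>n. f n - ?g n) (x - f 0)"
  proof (rule hs_subset)
    show "f i - ?g i = 0" if "i \<in> UNIV - range Suc" for i using that by (cases i) auto
  qed simp
  then have "hs UNIV (\<lambda>n. f (Suc n) - ?g (Suc n)) (x - f 0)" by (rule hs_reindex) simp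
  then show ?thesis by simp
qed

subsection \<open>The pairing of distributions\<close>

text \<open>The residue of a(z)_+ b(z), where a(z)_+ collects the modes of negative index. As
  \<open>sh v\<close> is multiplication by z^v, both halves of mode \<open>v\<close> of the normal
  ordered product have this shape.\<close>

definition pair :: "'w distribution \<Rightarrow> 'w distribution \<Rightarrow> 'w" where
  "pair a b = \<sigma> (\<lambda>n. m (a (- 1 - int n)) (b (int n)))"

definition sh :: "int \<Rightarrow> 'w distribution \<Rightarrow> 'w distribution" where
  "sh i a = (\<lambda>t. a (t + i))"

definition PP :: "'w distribution \<Rightarrow> bit \<Rightarrow> 'w distribution" where
  "PP a p = (\<lambda>t. pp (a t) p)"

abbreviation DP :: "bit \<Rightarrow> 'w distribution set" where
  "DP p \<equiv> {a \<in> D. \<forall>t. a t \<in> P p}"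

lemma sh_apply: "sh i a t = a (t + i)"
  by (simp add: sh_def)

lemma PP_apply: "PP a p t = pp (a t) p"
  by (simp add: PP_def)

lemma sh_linear:
  "sh i 0 = 0" "sh i (a + b) = sh i a + sh i b" "sh i (a - b) = sh i a - sh i b"
  "sh i (\<lambda>t. s k (a t)) = (\<lambda>t. s k (sh i a t))" "sh i (koszul p q a) = koszul p q (sh i a)"
  by (simp_all add: sh_def fun_eq_iff koszul_fun)

lemma sh_sh: "sh i (sh j a) = sh (i + j) a" "sh 0 a = a"
  by (simp_all add: sh_def add_ac)

lemma sh_D [simp]: "a \<in> D \<Longrightarrow> sh i a \<in> D"
  unfolding sh_def by (rule D_shift)

lemma PP_D [simp]: "a \<in> D \<Longrightarrow> PP a p \<in> D"
  unfolding PP_def by (rule D_par)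

lemma sh_DP: "a \<in> DP p \<Longrightarrow> sh i a \<in> DP p"
  by (simp add: sh_apply D_shift)

lemma D_minus: "a \<in> D \<Longrightarrow> - a \<in> D"
  using D_scale[of a "-1"] by (simp add: fun_Compl_def)

lemma D_diff: "a \<in> D \<Longrightarrow> b \<in> D \<Longrightarrow> a - b \<in> D"
  using D_add[OF _ D_minus, of a b] by simp

lemma D_koszul: "a \<in> D \<Longrightarrow> koszul p q a \<in> D"
  by (simp add: koszul_def D_minus)

lemma pair_hs: "a \<in> D \<Longrightarrow> b \<in> D \<Longrightarrow> hs UNIV (\<lambda>n. m (a (- 1 - int n)) (b (int n))) (pair a b)"
  using D_sum sigma unfolding pair_def by metis

lemma pair_eqI: "hs UNIV (\<lambda>n. m (a (- 1 - int n)) (b (int n))) x \<Longrightarrow> pair a b = x"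
  unfolding pair_def by (rule sigma)

lemma pair_C: "a \<in> D \<Longrightarrow> b \<in> D \<Longrightarrow> pair a b \<in> C"
  using hsD(2)[OF pair_hs] .

lemma pair_zero: "b \<in> D \<Longrightarrow> pair 0 b = 0" "b \<in> D \<Longrightarrow> pair b 0 = 0"
  by (rule pair_eqI, simp add: m_zero D_C hs_zero)+

lemma pair_add:
  "a \<in> D \<Longrightarrow> a' \<in> D \<Longrightarrow> b \<in> D \<Longrightarrow> pair (a + a') b = pair a b + pair a' b"
  "a \<in> D \<Longrightarrow> a' \<in> D \<Longrightarrow> b \<in> D \<Longrightarrow> pair b (a + a') = pair b a + pair b a'"
   by (rule pair_eqI, rule hs_cong[OF _ hs_add[OF pair_hs pair_hs]]; simp add: m_add_left m_add_right D_C)+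

lemma pair_scale:
  "a \<in> D \<Longrightarrow> b \<in> D \<Longrightarrow> pair (\<lambda>t. s k (a t)) b = s k (pair a b)"
  "a \<in> D \<Longrightarrow> b \<in> D \<Longrightarrow> pair b (\<lambda>t. s k (a t)) = s k (pair b a)"
   by (rule pair_eqI, rule hs_cong[OF _ hs_scale[OF pair_hs]]; simp add: m_scale_left m_scale_right D_C)+

lemma pair_minus:
  "a \<in> D \<Longrightarrow> b \<in> D \<Longrightarrow> pair (- a) b = - pair a b"
  "a \<in> D \<Longrightarrow> b \<in> D \<Longrightarrow> pair b (- a) = - pair b a"
  by (rule pair_eqI, rule hs_cong[OF _ hs_minus[OF pair_hs]]; simp add: m_minus D_C)+

lemma pair_diff:
  "a \<in> D \<Longrightarrow> a' \<in> D \<Longrightarrow> b \<in> D \<Longrightarrow> pair (a - a') b = pair a b - pair a' b"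
  "a \<in> D \<Longrightarrow> a' \<in> D \<Longrightarrow> b \<in> D \<Longrightarrow> pair b (a - a') = pair b a - pair b a'"
   by (rule pair_eqI, rule hs_cong[OF _ hs_diff[OF pair_hs pair_hs]]; simp add: m_diff D_C)+

lemma pair_koszul:
  "a \<in> D \<Longrightarrow> b \<in> D \<Longrightarrow> pair (koszul p q a) b = koszul p q (pair a b)"
  "a \<in> D \<Longrightarrow> b \<in> D \<Longrightarrow> pair b (koszul p q a) = koszul p q (pair b a)"
  by (simp_all add: koszul_def pair_minus)

text \<open>The last identity lets a factor pass through the middle; it cancels the mixed terms when
  a commutator is distributed over a pairing.\<close>

lemma pair_mult:
  assumes "a \<in> D" "b \<in> D" "c \<in> C"
  shows "pair (\<lambda>t. m c (a t)) b = m c (pair a b)" "pair a (\<lambda>t. m (b t) c) = m (pair a b) c"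
    "pair (\<lambda>t. m (a t) c) b = pair a (\<lambda>t. m c (b t))"
proof -
  show "pair (\<lambda>t. m c (a t)) b = m c (pair a b)"
    by (rule pair_eqI, rule hs_cong[OF _ hs_left[OF pair_hs]]) (simp_all add: m_assoc D_C assms)
  show "pair a (\<lambda>t. m (b t) c) = m (pair a b) c"
    by (rule pair_eqI, rule hs_cong[OF _ hs_right[OF pair_hs]]) (simp_all add: m_assoc D_C assms)
  show "pair (\<lambda>t. m (a t) c) b = pair a (\<lambda>t. m c (b t))"
    by (rule pair_eqI, rule hs_cong[OF _ pair_hs]) (simp_all add: m_assoc D_C D_left assms)
qed

lemma pair_single:
  assumes "a \<in> D" "b \<in> D" "\<And>n. n \<noteq> k \<Longrightarrow> m (a (- 1 - int n)) (b (int n)) = 0"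
  shows "pair a b = m (a (- 1 - int k)) (b (int k))"
  by (rule pair_eqI, rule hs_single[where f = "\<lambda>n. m (a (- 1 - int n)) (b (int n))" and k = k])
    (use assms in \<open>simp_all add: m_closed D_C\<close>)

lemma pair_par:
  assumes "a \<in> DP p" "b \<in> DP q"
  shows "pair a b \<in> P (p + q)"
proof -
  have ab: "a \<in> D" "b \<in> D" using assms by auto
  have "hs UNIV (\<lambda>n. pp (m (a (- 1 - int n)) (b (int n))) (p + q + 1)) (pp (pair a b) (p + q + 1))"
    by (rule hs_pp[OF pair_hs[OF ab]])
  moreover have "pp (m (a (- 1 - int n)) (b (int n))) (p + q + 1) = 0" for n
  proof -
    have 1: "m (a (- 1 - int n)) (b (int n)) \<in> P (p + q)" by (rule m_par) (use assms in auto)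
    show ?thesis by (rule P_iff[OF P_C[OF 1], THEN iffD1, OF 1])
  qed
  ultimately have "pp (pair a b) (p + q + 1) = 0"
    by (simp only:) (rule hs_unique[OF _ hs_zero])
  then show ?thesis by (rule P_iff[OF pair_C[OF ab], THEN iffD2])
qed

text \<open>The two series share all terms but one: a_0 b_0 crosses the border between the negative
  and the nonnegative modes of \<open>a\<close>.\<close>

lemma pair_shift:
  assumes "a \<in> D" "b \<in> D"
  shows "pair (sh 1 a) b = m (a 0) (b 0) + pair a (sh 1 b)"
proof -
  have "hs UNIV (\<lambda>n. m (sh 1 a (- 1 - int (Suc n))) (b (int (Suc n))))
    (pair (sh 1 a) b - m (sh 1 a (- 1 - int 0)) (b (int 0)))"
    by (rule hs_Suc[OF pair_hs[OF sh_D]]) (use assms in auto)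
  then have "pair a (sh 1 b) = pair (sh 1 a) b - m (sh 1 a (- 1 - int 0)) (b (int 0))"
    by (intro pair_eqI) (simp add: sh_apply add.commute)
  then show ?thesis by (simp add: sh_apply)
qed

lemma pair_shift_nat:
  assumes "a \<in> D" "b \<in> D"
  shows "pair (sh (int n) a) b
    = (\<Sum>i<n. m (a (int n - 1 - int i)) (b (int i))) + pair a (sh (int n) b)"
  using assms(2)
proof (induction n arbitrary: b)
  case (Suc n)
  have "pair (sh (int (Suc n)) a) b = pair (sh 1 (sh (int n) a)) b"
    by (simp add: sh_sh)
  also have "\<dots> = m (sh (int n) a 0) (b 0) + pair (sh (int n) a) (sh 1 b)"
    by (rule pair_shift) (use assms(1) Suc.prems in auto)
  also have "pair (sh (int n) a) (sh 1 b)
      = (\<Sum>i<n. m (a (int n - 1 - int i)) (sh 1 b (int i))) + pair a (sh (int n) (sh 1 b))"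
    by (rule Suc.IH) (use Suc.prems in auto)
  also have "(\<Sum>i<n. m (a (int n - 1 - int i)) (sh 1 b (int i)))
      = (\<Sum>i<n. m (a (int (Suc n) - 1 - int (Suc i))) (b (int (Suc i))))"
    by (intro sum.cong refl arg_cong2[where f=m] arg_cong[where f=a]) (simp_all add: sh_apply add.commute)
  also have "sh (int n) (sh 1 b) = sh (int (Suc n)) b" by (simp add: sh_sh add.commute)
  finally show ?case by (simp add: sum.lessThan_Suc_shift add.assoc sh_apply[of _ _ 0] del: sum.lessThan_Suc)
qed (simp add: sh_sh)

text \<open>Integration by parts under the residue. The second series begins with a zero term, and
  shifted by one index it cancels the first term by term.\<close>

lemma pair_deriv:
  assumes "a \<in> D" "b \<in> D" "deriv_dist s a \<in> D" "deriv_dist s b \<in> D"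
  shows "pair (deriv_dist s a) b + pair a (deriv_dist s b) = 0"
proof -
  have "hs UNIV (\<lambda>n. m (a (- 1 - int (Suc n))) (deriv_dist s b (int (Suc n))))
      (pair a (deriv_dist s b) - m (a (- 1 - int 0)) (deriv_dist s b (int 0)))"
    by (rule hs_Suc[OF pair_hs]) (use assms in auto)
  then have "hs UNIV (\<lambda>n. m (a (- 1 - int (Suc n))) (deriv_dist s b (int (Suc n)))) (pair a (deriv_dist s b))"
    using m_zero(2)[OF D_C[OF assms(1)]] by (simp add: deriv_dist_def)
  from hs_add[OF pair_hs[OF assms(3,2)] this]
  have "hs UNIV (\<lambda>n. m (deriv_dist s a (- 1 - int n)) (b (int n)) + m (a (- 1 - int (Suc n))) (deriv_dist s b (int (Suc n))))
     (pair (deriv_dist s a) b + pair a (deriv_dist s b))" .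
  moreover have "m (deriv_dist s a (- 1 - int n)) (b (int n)) + m (a (- 1 - int (Suc n))) (deriv_dist s b (int (Suc n))) = 0" for n
  proof -
    have "- 1 - int n - 1 = - 1 - int (Suc n)" "int (Suc n) - 1 = int n" by simp_all
    then show ?thesis
      unfolding deriv_dist_def
      by (simp only: m_scale_left[OF D_C D_C, OF assms(1,2)] m_scale_right[OF D_C D_C, OF assms(1,2)]
          scale_left_distrib[symmetric]) simp
  qed
  ultimately show ?thesis using hs_unique[OF _ hs_zero] by simp
qed


subsection \<open>The normal ordered product\<close>

abbreviation NO :: "'w distribution \<Rightarrow> 'w distribution \<Rightarrow> 'w distribution" where
  "NO \<equiv> normal_ordered_product m P \<sigma>"

text \<open>The parities are arguments and not extracted from \<open>a\<close> and \<open>b\<close>,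
  which keeps the expression additive for fixed \<open>p\<close>, \<open>q\<close> and avoids the
  ambiguous parity of 0.\<close>

definition nop :: "bit \<Rightarrow> bit \<Rightarrow> 'w distribution \<Rightarrow> 'w distribution \<Rightarrow> 'w distribution" where
  "nop p q a b v = pair a (sh v b) + koszul p q (pair (sh v b) a)"

lemma NO_eq:
  "NO a b v = pair a (sh v b) + (\<Sum>p\<in>{0,1}. \<Sum>q\<in>{0,1}. koszul p q (pair (sh v (PP b q)) (PP a p)))"
proof -
  have "- 1 - int n + v = v - int n - 1" "int n + v = v + int n" for n by simp_all
  then show ?thesis by (simp only: normal_ordered_product_def pair_def sh_apply PP_apply)
qed

lemma PP_hom: "a \<in> DP p \<Longrightarrow> PP a q = (if q = p then a else 0)"
  using pp_hom[of "a t" p q for t] by (intro ext) (auto simp: PP_apply)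

lemma PP_DP: "a \<in> D \<Longrightarrow> PP a p \<in> DP p"
  by (auto simp: PP_apply pp_P D_C D_par)

lemma PP_sum: "a \<in> D \<Longrightarrow> PP a 0 + PP a 1 = a"
  by (intro ext) (simp add: PP_apply pp_sum D_C)

lemma PP_add: "a \<in> D \<Longrightarrow> b \<in> D \<Longrightarrow> PP (a + b) p = PP a p + PP b p"
  by (intro ext) (simp add: PP_apply pp_add D_C)

lemma PP_scale: "a \<in> D \<Longrightarrow> PP (\<lambda>t. s k (a t)) p = (\<lambda>t. s k (PP a p t))"
  by (intro ext) (simp add: PP_apply pp_scale D_C)

lemma PP_deriv: "a \<in> D \<Longrightarrow> PP (deriv_dist s a) p = deriv_dist s (PP a p)"
  unfolding deriv_dist_def by (intro ext) (simp only: PP_apply pp_scale D_C)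

lemma NO_hom:
  assumes "a \<in> DP p" "b \<in> DP q"
  shows "NO a b = nop p q a b"
proof
  fix v
  have D: "a \<in> D" "b \<in> D" "sh v b \<in> D" using assms by auto
  have *: "koszul p' q' (pair (sh v (PP b q')) (PP a p')) =
      (if p' = p \<and> q' = q then koszul p q (pair (sh v b) a) else 0)" for p' q'
    unfolding PP_hom[OF assms(1)] PP_hom[OF assms(2)]
    by (cases "p' = p"; cases "q' = q") (simp_all add: pair_zero D sh_linear D_zero)
  show "NO a b v = nop p q a b v"
    unfolding NO_eq nop_def * by (cases p; cases q) simp_all
qed

lemma NO_add:
  assumes "a \<in> D" "a' \<in> D" "b \<in> D"
  shows "NO (a + a') b = NO a b + NO a' b" "NO b (a + a') = NO b a + NO b a'"
  by (rule ext, simp add: assms NO_eq PP_add sh_linear pair_add koszul_add)+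

lemma NO_scale:
  assumes "a \<in> D" "b \<in> D"
  shows "NO (\<lambda>t. s k (a t)) b = (\<lambda>t. s k (NO a b t))" "NO b (\<lambda>t. s k (a t)) = (\<lambda>t. s k (NO b a t))"
  by (rule ext, simp only: NO_eq PP_scale assms sh_linear, simp only: pair_scale assms PP_D sh_D koszul_scale
      scale_sum_right scale_right_distrib)+

lemma NO_par: "a \<in> DP p \<Longrightarrow> b \<in> DP q \<Longrightarrow> NO a b v \<in> P (p + q)"
proof -
  assume a: "a \<in> DP p" and b: "b \<in> DP q"
  have "pair a (sh v b) \<in> P (p + q)" "pair (sh v b) a \<in> P (q + p)"
    by (rule pair_par[OF a sh_DP[OF b]], rule pair_par[OF sh_DP[OF b] a])
  then show ?thesis unfolding NO_hom[OF a b] nop_def koszul_def add.commute[of q p]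
    by (simp only: P_closed split: if_split) (simp add: P_closed del: plus_bit_def)
qed

lemma NO_deriv:
  assumes "a \<in> D" "b \<in> D" "deriv_dist s a \<in> D" "deriv_dist s b \<in> D"
  shows "deriv_dist s (NO a b) = NO (deriv_dist s a) b + NO a (deriv_dist s b)"
proof
  fix v
  have key: "s (- of_int v) (pair a (sh (v - 1) b)) = pair (deriv_dist s a) (sh v b) + pair a (sh v (deriv_dist s b))"
    "s (- of_int v) (pair (sh (v - 1) b) a) = pair (sh v (deriv_dist s b)) a + pair (sh v b) (deriv_dist s a)"
    if ab: "a \<in> D" "b \<in> D" "deriv_dist s a \<in> D" "deriv_dist s b \<in> D" for a b
  proof -
    note [simp] = ab
    let ?b = "\<lambda>t. s (- of_int v) (sh (v - 1) b t)"
    have b': "?b \<in> D" by (rule D_scale) simp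
    \<comment> \<open>The Leibniz rule for z^v b(z): the derivative of z^v contributes v z^(v-1),
      and \<open>?b\<close> carries the opposite factor -v.\<close>
    have eq: "deriv_dist s (sh v b) = sh v (deriv_dist s b) - ?b"
    proof
      fix t
      have "t + (v - 1) = t - 1 + v" "t + v - 1 = t - 1 + v" by simp_all
      then show "deriv_dist s (sh v b) t = (sh v (deriv_dist s b) - ?b) t"
        unfolding deriv_dist_def sh_apply minus_apply by (simp only: scale_left_diff_distrib[symmetric]) simp
    qed
    have dD: "deriv_dist s (sh v b) \<in> D" unfolding eq by (rule D_diff[OF sh_D[OF ab(4)] b'])
    have 1: "pair (deriv_dist s a) (sh v b) + pair a (deriv_dist s (sh v b)) = 0"
      "pair (deriv_dist s (sh v b)) a + pair (sh v b) (deriv_dist s a) = 0"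
      by (rule pair_deriv; simp add: dD)+
    have 2: "pair a (deriv_dist s (sh v b)) = pair a (sh v (deriv_dist s b)) - s (- of_int v) (pair a (sh (v - 1) b))"
      "pair (deriv_dist s (sh v b)) a = pair (sh v (deriv_dist s b)) a - s (- of_int v) (pair (sh (v - 1) b) a)"
      unfolding eq by (simp_all only: pair_diff b' pair_scale ab sh_D)
    show "s (- of_int v) (pair a (sh (v - 1) b)) = pair (deriv_dist s a) (sh v b) + pair a (sh v (deriv_dist s b))"
      using 1(1) unfolding 2 by (simp only: add_diff_eq right_minus_eq)
    show "s (- of_int v) (pair (sh (v - 1) b) a) = pair (sh v (deriv_dist s b)) a + pair (sh v b) (deriv_dist s a)"
      using 1(2) unfolding 2 by (simp only: diff_add_eq right_minus_eq)
  qed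
  have PPd: "deriv_dist s (PP a p) \<in> D" "deriv_dist s (PP b p) \<in> D" for p
    using PP_D[OF assms(3)] PP_D[OF assms(4)] by (simp_all only: PP_deriv assms)
  have "deriv_dist s (NO a b) v = s (- of_int v) (NO a b (v - 1))" by (simp add: deriv_dist_def)
  also have "\<dots> = s (- of_int v) (pair a (sh (v - 1) b)) + (\<Sum>p\<in>{0,1}. \<Sum>q\<in>{0,1}. koszul p q
       (s (- of_int v) (pair (sh (v - 1) (PP b q)) (PP a p))))"
    unfolding NO_eq scale_right_distrib scale_sum_right koszul_scale ..
  also have "\<dots> = NO (deriv_dist s a) b v + NO a (deriv_dist s b) v"
    unfolding key[OF assms] key(2)[OF PP_D[OF assms(1)] PP_D[OF assms(2)] PPd] NO_eq PP_deriv[OF assms(1)] PP_deriv[OF assms(2)]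
      koszul_add sum.distrib by (simp only: add_ac)
  finally show "deriv_dist s (NO a b) v = (NO (deriv_dist s a) b + NO a (deriv_dist s b)) v" by simp
qed

text \<open>A pairing with the unit has at most one nonzero term. For \<open>NO a one\<close> it
  sits in the second half of the product when \<open>v\<close> is nonnegative and in the first half
  otherwise.\<close>

lemma D_one_unit:
  assumes one: "one = (\<lambda>t. if t = -1 then e else 0)" "one \<in> D" and a: "a \<in> DP p"
  shows "NO one a = a" "NO a one = a"
proof -
  have o: "one \<in> DP 0" using one e_par by (auto simp: P_closed)
  have [simp]: "a \<in> D" using a by auto
  have z: "m (a t) 0 = 0" "m 0 (a t) = 0" for t by (simp_all add: m_zero D_C)
  have o1: "sh v one (int k) = (if v + int k = - 1 then e else 0)"
    "sh v one (- 1 - int k) = (if v = int k then e else 0)"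
    "one (int k) = 0" "one (- 1 - int k) = (if k = 0 then e else 0)" for v k
    by (auto simp: sh_apply one(1))
  show "NO one a = a"
  proof
    fix v
    have "pair one (sh v a) = m (one (- 1 - int 0)) (sh v a (int 0))"
      by (rule pair_single) (simp_all add: one(2) o1, simp add: sh_apply z)
    moreover have "pair (sh v a) one = m (sh v a (- 1 - int 0)) (one (int 0))"
      by (rule pair_single) (simp_all add: one(2) o1, simp add: sh_apply z)
    ultimately show "NO one a v = a v" unfolding NO_hom[OF o a] nop_def o1
      by (simp add: sh_apply m_e D_C z)
  qed
  show "NO a one = a"
  proof
    fix v
    show "NO a one v = a v"
    proof (cases "v \<ge> 0")
      case True
      have "pair a (sh v one) = m (a (- 1 - int 0)) (sh v one (int 0))"
        using True by (intro pair_single) (simp_all add: one(2) o1 z)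
      moreover have "pair (sh v one) a = m (sh v one (- 1 - int (nat v))) (a (int (nat v)))"
        using True by (intro pair_single) (auto simp: one(2) o1 z)
      ultimately show ?thesis unfolding NO_hom[OF a o] nop_def o1
        using True by (simp add: m_e D_C z koszul_def)
    next
      case False
      have "pair a (sh v one) = m (a (- 1 - int (nat (- 1 - v)))) (sh v one (int (nat (- 1 - v))))"
        using False by (intro pair_single) (auto simp: one(2) o1 z)
      moreover have "pair (sh v one) a = m (sh v one (- 1 - int 0)) (a (int 0))"
        using False by (intro pair_single) (simp_all add: one(2) o1 z)
      ultimately show ?thesis unfolding NO_hom[OF a o] nop_def o1
        using False by (simp add: m_e D_C z koszul_def)
    qed
  qed
qed


subsection \<open>Brackets\<close>

abbreviation sc :: "'w \<Rightarrow> 'w \<Rightarrow> 'w" where "sc \<equiv> supercomm m P"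

abbreviation K :: "'w distribution \<Rightarrow> 'w distribution \<Rightarrow> 'w distribution2" where
  "K \<equiv> comm_dist m P"

lemma K_apply: "K a b t u = sc (a t) (b u)"
  by (simp add: comm_dist_def)

lemma bracket_eq: "bracket_dist m P a b n = (M ^^ n) (K a b) 0"
  by (simp add: bracket_dist_def res_z_def)

lemma sc_hom: "x \<in> P p \<Longrightarrow> y \<in> P q \<Longrightarrow> sc x y = m x y - koszul p q (m y x)"
proof -
  assume x: "x \<in> P p" and y: "y \<in> P q"
  have [simp]: "x \<in> C" "y \<in> C" "0 \<in> C" using P_C x y C_closed by auto
  show ?thesis unfolding supercomm_def pp_hom[OF x] pp_hom[OF y]
    by (cases p; cases q) (simp_all add: m_zero)
qed

lemma sc_C: "x \<in> C \<Longrightarrow> y \<in> C \<Longrightarrow> sc x y \<in> C"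
  unfolding supercomm_def by (intro C_closed koszul_C m_closed pp_C)

lemma sc_add:
  assumes "x \<in> C" "y \<in> C" "z \<in> C"
  shows "sc (x + y) z = sc x z + sc y z" "sc z (x + y) = sc z x + sc z y"
  unfolding supercomm_def pp_add[OF assms(1,2)]
  by (simp_all only: m_add_left m_add_right pp_C assms koszul_add add_diff_add sum.distrib)

lemma sc_scale:
  assumes "x \<in> C" "y \<in> C"
  shows "sc (s k x) y = s k (sc x y)" "sc x (s k y) = s k (sc x y)"
  unfolding supercomm_def pp_scale[OF assms(1)] pp_scale[OF assms(2)]
  by (simp_all only: m_scale_left m_scale_right pp_C assms koszul_scale scale_right_diff_distrib[symmetric] scale_sum_right)

lemma sc_minus: "x \<in> C \<Longrightarrow> y \<in> C \<Longrightarrow> sc (- x) y = - sc x y" "x \<in> C \<Longrightarrow> y \<in> C \<Longrightarrow> sc x (- y) = - sc x y"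
  using sc_scale[of x y "-1"] by simp_all

lemma sc_diff:
  "x \<in> C \<Longrightarrow> y \<in> C \<Longrightarrow> z \<in> C \<Longrightarrow> sc (x - y) z = sc x z - sc y z"
  "x \<in> C \<Longrightarrow> y \<in> C \<Longrightarrow> z \<in> C \<Longrightarrow> sc z (x - y) = sc z x - sc z y"
  using sc_add[of x "- y" z] C_closed by (simp_all add: sc_minus)

lemma sc_koszul: "x \<in> C \<Longrightarrow> y \<in> C \<Longrightarrow> sc x (koszul p q y) = koszul p q (sc x y)"
  by (simp add: koszul_def sc_minus)

lemma sc_par:
  assumes "x \<in> P p" "y \<in> P q"
  shows "sc x y \<in> P (p + q)"
proof -
  have 1: "m x y \<in> P (p + q)" by (rule m_par[OF assms])
  have 2: "m y x \<in> P (p + q)" unfolding add.commute[of p q] by (rule m_par[OF assms(2,1)])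
  show ?thesis
  proof (cases "p = 1 \<and> q = 1")
    case True
    then have "sc x y = m x y + m y x" by (simp add: sc_hom[OF assms] koszul_def)
    then show ?thesis using P_closed(2)[OF 1 2] by (simp only:)
  next
    case False
    then have "sc x y = m x y - m y x" unfolding sc_hom[OF assms] koszul_def by (simp only: if_False)
    then show ?thesis using P_closed(3)[OF 1 2] by (simp only:)
  qed
qed

lemma sc_skew: "x \<in> P p \<Longrightarrow> y \<in> P q \<Longrightarrow> sc x y = - koszul p q (sc y x)"
  by (simp add: sc_hom koszul_def)

lemma sc_Jacobi:
  assumes "x \<in> P p" "y \<in> P q" "z \<in> P r"
  shows "sc (sc x y) z = sc x (sc y z) - koszul p q (sc y (sc x z))"
proof -
  note C = P_C[OF assms(1)] P_C[OF assms(2)] P_C[OF assms(3)]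
  show ?thesis
    unfolding sc_hom[OF sc_par[OF assms(1,2)] assms(3)] sc_hom[OF assms(1) sc_par[OF assms(2,3)]]
      sc_hom[OF assms(2) sc_par[OF assms(1,3)]]
    unfolding sc_hom[OF assms(1,2)] sc_hom[OF assms(2,3)] sc_hom[OF assms(1,3)]
      koszul_left koszul_right
    by (simp add: m_diff m_koszul m_closed koszul_C C m_assoc koszul_diff)
      (simp add: koszul_def)
qed

lemma K_C: "a \<in> D \<Longrightarrow> b \<in> D \<Longrightarrow> K a b t u \<in> C"
  by (simp add: K_apply sc_C D_C)

lemma K_add: "a \<in> D \<Longrightarrow> a' \<in> D \<Longrightarrow> b \<in> D \<Longrightarrow> K (a + a') b = K a b + K a' b"
   "a \<in> D \<Longrightarrow> a' \<in> D \<Longrightarrow> b \<in> D \<Longrightarrow> K b (a + a') = K b a + K b a'"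
  by (intro ext, simp add: K_apply sc_add D_C)+

lemma K_scale: "a \<in> D \<Longrightarrow> b \<in> D \<Longrightarrow> K (\<lambda>t. s k (a t)) b = (\<lambda>t u. s k (K a b t u))"
   "a \<in> D \<Longrightarrow> b \<in> D \<Longrightarrow> K a (\<lambda>t. s k (b t)) = (\<lambda>t u. s k (K a b t u))"
  by (intro ext, simp add: K_apply sc_scale D_C)+

lemma M_pow_scale: "(M ^^ n) (\<lambda>t u. s k (F t u)) t u = s k ((M ^^ n) F t u)"
  by (rule M_pow_hom[of F UNIV]) (auto simp: scale_right_diff_distrib)

lemma K_skew: "a \<in> DP p \<Longrightarrow> b \<in> DP q \<Longrightarrow> K a b t u = - koszul p q (K b a u t)"
  unfolding K_apply by (rule sc_skew) auto

text \<open>Two-variable distributions that can enter a pairing in the second variable at each fixed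
  first index. Commutators are of this kind, and multiplication by z - w preserves it.\<close>

abbreviation D2 :: "bit \<Rightarrow> 'w distribution2 set" where
  "D2 p \<equiv> {R. \<forall>t. R t \<in> DP p}"

lemma sc_dist:
  assumes "x \<in> P p" "b \<in> DP q"
  shows "(\<lambda>u. sc x (b u)) = (\<lambda>u. m x (b u)) - koszul p q (\<lambda>u. m (b u) x)" "(\<lambda>u. sc x (b u)) \<in> DP (p + q)"
proof -
  show eq: "(\<lambda>u. sc x (b u)) = (\<lambda>u. m x (b u)) - koszul p q (\<lambda>u. m (b u) x)"
    using assms by (intro ext) (simp add: sc_hom koszul_fun)
  have "(\<lambda>u. sc x (b u)) \<in> D"
    unfolding eq using assms P_C[OF assms(1)] by (intro D_diff D_koszul D_left D_right) auto
  moreover have "sc x (b u) \<in> P (p + q)" for u using assms by (intro sc_par) auto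
  ultimately show "(\<lambda>u. sc x (b u)) \<in> DP (p + q)" by blast
qed

lemma K_D2: "a \<in> DP p \<Longrightarrow> b \<in> DP q \<Longrightarrow> K a b \<in> D2 (p + q)"
  using sc_dist(2)[of "a t" p b q for t] unfolding comm_dist_def by simp

lemma M_sh: "M R t = R (t + 1) - sh 1 (R t)"
  by (intro ext) (simp add: M_apply sh_apply)

lemma DP_diff: "a \<in> DP p \<Longrightarrow> b \<in> DP p \<Longrightarrow> a - b \<in> DP p"
  by (simp add: D_diff P_closed)

lemma M_D2: "R \<in> D2 p \<Longrightarrow> M R \<in> D2 p"
  unfolding mem_Collect_eq[of _ "\<lambda>R. \<forall>t. R t \<in> DP p"] M_sh by (intro allI DP_diff sh_DP) auto

lemma M_pow_D2: "R \<in> D2 p \<Longrightarrow> (M ^^ n) R \<in> D2 p"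
proof (induction n)
  case (Suc n)
  then have "(M ^^ n) R \<in> D2 p" by blast
  then show ?case unfolding funpow.simps o_apply by (rule M_D2)
qed simp

lemma bracket_DP: "a \<in> DP p \<Longrightarrow> b \<in> DP q \<Longrightarrow> bracket_dist m P a b n \<in> DP (p + q)"
  unfolding bracket_eq using M_pow_D2[OF K_D2, of a p b q n] by blast

text \<open>From \<open>M_pow_dz\<close> and \<open>M_pow_dw\<close>; in the second rule the two
  terms with n (z - w)^(n-1) cancel.\<close>

lemma bracket_deriv:
  assumes "a \<in> D" "b \<in> D"
  shows "bracket_dist m P (deriv_dist s a) b n
      = (\<lambda>u. if n = 0 then 0 else - s (of_nat n) (bracket_dist m P a b (n - 1) u))"
    and "bracket_dist m P (deriv_dist s a) b n + bracket_dist m P a (deriv_dist s b) n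
      = deriv_dist s (bracket_dist m P a b n)"
proof -
  have K1: "K (deriv_dist s a) b = (\<lambda>t u. s (- of_int t) (K a b (t - 1) u))"
    and K2: "K a (deriv_dist s b) = (\<lambda>t u. s (- of_int u) (K a b t (u - 1)))"
    unfolding K_apply deriv_dist_def comm_dist_def by (simp_all only: sc_scale D_C assms)
  show 1: "bracket_dist m P (deriv_dist s a) b n
      = (\<lambda>u. if n = 0 then 0 else - s (of_nat n) (bracket_dist m P a b (n - 1) u))"
    unfolding bracket_eq K1 by (rule ext, subst M_pow_dz) simp
  show "bracket_dist m P (deriv_dist s a) b n + bracket_dist m P a (deriv_dist s b) n
      = deriv_dist s (bracket_dist m P a b n)"
    unfolding 1 unfolding bracket_eq K2
    by (rule ext, subst plus_fun_apply, subst M_pow_dw) (simp add: deriv_dist_def)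
qed

lemma sc_e: "x \<in> C \<Longrightarrow> sc e x = 0" "x \<in> C \<Longrightarrow> sc x e = 0" "x \<in> C \<Longrightarrow> sc 0 x = 0" "x \<in> C \<Longrightarrow> sc x 0 = 0"
proof -
  assume x: "x \<in> C"
  note h = pp_P[OF x, of 0] pp_P[OF x, of 1]
  have "sc e (pp x 0 + pp x 1) = 0" "sc (pp x 0 + pp x 1) e = 0"
    using h[THEN P_C] P_C[OF e_par]
    by (simp_all add: sc_add sc_hom[OF e_par h(1)] sc_hom[OF e_par h(2)] sc_hom[OF h(1) e_par] sc_hom[OF h(2) e_par] m_e koszul_def)
  then show "sc e x = 0" "sc x e = 0" by (simp_all add: pp_sum x)
  show "sc 0 x = 0" "sc x 0 = 0" using sc_scale(1)[OF x x, of 0] sc_scale(2)[OF x x, of 0] by simp_all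
qed

lemma bracket_one:
  assumes "one = (\<lambda>t. if t = -1 then e else 0)" "a \<in> D"
  shows "bracket_dist m P one a n = 0" "bracket_dist m P a one n = 0"
proof -
  have "K one a = 0" "K a one = 0"
    by (intro ext; simp add: K_apply assms(1) sc_e D_C[OF assms(2)])+
  then show "bracket_dist m P one a n = 0" "bracket_dist m P a one n = 0"
    by (simp_all only: bracket_eq M_pow_zero zero_fun_apply)
qed


subsection \<open>The Jacobi identity\<close>

text \<open>The residue in z and x of (x - w)^j (z - x)^i [[a(z),b(x)],c(w)].
  \<open>bracket_bracket_right\<close> and \<open>bracket_bracket_middle\<close> use the same three
  variables, so the Jacobi identity for modes can be applied under the residue.\<close>

lemma bracket_bracket_left:
  assumes "a \<in> D" "b \<in> D" "c \<in> D"
  shows "bracket_dist m P (bracket_dist m P a b i) c j v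
    = (M23 ^^ j) ((M12 ^^ i) (\<lambda>r t u. sc (K a b r t) (c u))) 0 0 v"
  unfolding bracket_eq M123_pow(3) M123_pow(1)
proof (rule arg_cong[where f = "\<lambda>F. (M ^^ j) F 0 v"], intro ext)
  fix t u
  show "K ((M ^^ i) (K a b) 0) c t u = (M ^^ i) (\<lambda>r t. sc (K a b r t) (c u)) 0 t"
    unfolding K_apply[of "(M ^^ i) (K a b) 0"]
    by (rule M_pow_hom[of _ C, symmetric]) (auto simp: K_C assms C_closed sc_diff D_C)
qed

lemma bracket_bracket_right:
  assumes "a \<in> D" "b \<in> D" "c \<in> D"
  shows "bracket_dist m P a (bracket_dist m P b c j) i v
    = (M13 ^^ i) ((M23 ^^ j) (\<lambda>r t u. sc (a r) (K b c t u))) 0 0 v"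
  unfolding bracket_eq M123_pow(2) M123_pow(3)
proof (rule arg_cong[where f = "\<lambda>F. (M ^^ i) F 0 v"], intro ext)
  fix r u
  show "K a ((M ^^ j) (K b c) 0) r u = (M ^^ j) (\<lambda>t u. sc (a r) (K b c t u)) 0 u"
    unfolding K_apply[of a]
    by (rule M_pow_hom[of _ C, symmetric]) (auto simp: K_C assms C_closed sc_diff D_C)
qed

lemma bracket_bracket_middle:
  assumes "a \<in> D" "b \<in> D" "c \<in> D"
  shows "bracket_dist m P b (bracket_dist m P a c i) j v
    = (M13 ^^ i) ((M23 ^^ j) (\<lambda>r t u. sc (b t) (K a c r u))) 0 0 v"
  unfolding funpow_commute[of M13 M23, OF M123_commute(3)]
  unfolding bracket_eq M123_pow(3) M123_pow(2)
proof (rule arg_cong[where f = "\<lambda>F. (M ^^ j) F 0 v"], intro ext)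
  fix t u
  show "K b ((M ^^ i) (K a c) 0) t u = (M ^^ i) (\<lambda>r u. sc (b t) (K a c r u)) 0 u"
    unfolding K_apply[of b]
    by (rule M_pow_hom[of _ C, symmetric]) (auto simp: K_C assms C_closed sc_diff D_C)
qed

lemma M123_koszul:
  "(M13 ^^ i) ((M23 ^^ j) (koszul p q F)) = koszul p q ((M13 ^^ i) ((M23 ^^ j) F))"
proof -
  have neg: "(M23 ^^ j) (- F) = - (M23 ^^ j) F" "(M13 ^^ i) (- G) = - (M13 ^^ i) G" for F G
    using M123_pow_diff(3)[of j 0 F] M123_pow_diff(3)[of j 0 0] M123_pow_diff(2)[of i 0 G] M123_pow_diff(2)[of i 0 0]
    by simp_all
  show ?thesis by (simp add: koszul_def neg)
qed

text \<open>The Jacobi identity for modes splits the triple commutator, and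
  \<open>subst_M123\<close> rewrites the power of z - x in terms of the powers of z - w and x - w
  that belong to the two nested brackets.\<close>

lemma bracket_Jacobi:
  assumes "a \<in> DP p" "b \<in> DP q" "c \<in> DP r"
  shows "bracket_dist m P (bracket_dist m P a b i) c j v
    = subst_mu_minus_lambda s (\<lambda>i j. bracket_dist m P a (bracket_dist m P b c j) i v) i j
      - koszul p q (subst_mu_minus_lambda s (\<lambda>i j. bracket_dist m P b (bracket_dist m P a c i) j v) i j)"
proof -
  have D: "a \<in> D" "b \<in> D" "c \<in> D" using assms by auto
  let ?F = "\<lambda>r t u. sc (K a b r t) (c u)"
  let ?F1 = "\<lambda>r t u. sc (a r) (K b c t u)" and ?F2 = "\<lambda>r t u. sc (b t) (K a c r u)"
  have F: "?F = ?F1 - koszul p q ?F2"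
  proof (intro ext)
    fix r' t u
    have "a r' \<in> P p" "b t \<in> P q" "c u \<in> P r" using assms by auto
    from sc_Jacobi[OF this] show "?F r' t u = (?F1 - koszul p q ?F2) r' t u"
      by (simp add: K_apply koszul_fun)
  qed
  have k: "subst_mu_minus_lambda s (\<lambda>i j. koszul p q (G i j)) i j = koszul p q (subst_mu_minus_lambda s G i j)" for G i j
    by (simp add: koszul_def subst_mu_minus_lambda_def sum_negf)
  have d: "subst_mu_minus_lambda s (\<lambda>i j. G i j - H i j) i j = subst_mu_minus_lambda s G i j - subst_mu_minus_lambda s H i j" for G H i j
    by (simp only: subst_mu_minus_lambda_def scale_right_diff_distrib sum_subtractf)
  have "bracket_dist m P (bracket_dist m P a b i) c j v
      = subst_mu_minus_lambda s (\<lambda>i j. (M13 ^^ i) ((M23 ^^ j) ?F) 0 0 v) i j"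
    unfolding bracket_bracket_left[OF D] subst_M123[symmetric]
    by (simp only: funpow_commute[of M12 M23, OF M123_commute(1)])
  also have "(\<lambda>i j. (M13 ^^ i) ((M23 ^^ j) ?F) 0 0 v) =
      (\<lambda>i j. (M13 ^^ i) ((M23 ^^ j) ?F1) 0 0 v - koszul p q ((M13 ^^ i) ((M23 ^^ j) ?F2) 0 0 v))"
    unfolding F M123_pow_diff M123_koszul by (simp add: koszul_fun)
  finally show ?thesis
    unfolding d k bracket_bracket_right[OF D] bracket_bracket_middle[OF D] .
qed


subsection \<open>The Wick formula\<close>

text \<open>Commutation with \<open>x\<close> is a superderivation: the terms with \<open>x\<close>
  between \<open>a\<close> and \<open>b\<close> occur with opposite signs, by the balance rule in
  \<open>pair_mult\<close>.\<close>

lemma sc_pair: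
  assumes "x \<in> P p" "a \<in> DP q" "b \<in> DP r"
  shows "sc x (pair a b) = pair (\<lambda>t. sc x (a t)) b + koszul p q (pair a (\<lambda>t. sc x (b t)))"
proof -
  have x: "x \<in> C" and D: "a \<in> D" "b \<in> D" using assms P_C by auto
  note m = pair_mult[OF D x] pair_mult[OF D(2,1) x]
  have "pair (\<lambda>t. sc x (a t)) b = m x (pair a b) - koszul p q (pair (\<lambda>t. m (a t) x) b)"
    unfolding sc_dist(1)[OF assms(1,2)]
    by (simp add: pair_diff pair_koszul D D_left D_right D_koszul x m)
  moreover have "pair a (\<lambda>t. sc x (b t)) = pair (\<lambda>t. m (a t) x) b - koszul p r (m (pair a b) x)"
    unfolding sc_dist(1)[OF assms(1,3)]
    by (simp add: pair_diff pair_koszul D D_left D_right D_koszul x m)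
  moreover have "sc x (pair a b) = m x (pair a b) - koszul p q (koszul p r (m (pair a b) x))"
    unfolding sc_hom[OF assms(1) pair_par[OF assms(2,3)]] koszul_right ..
  ultimately show ?thesis by (simp add: koszul_diff)
qed

lemma nop_diff:
  "a \<in> D \<Longrightarrow> a' \<in> D \<Longrightarrow> b \<in> D \<Longrightarrow> nop p q (a - a') b v = nop p q a b v - nop p q a' b v"
  "a \<in> D \<Longrightarrow> a' \<in> D \<Longrightarrow> b \<in> D \<Longrightarrow> nop p q b (a - a') v = nop p q b a v - nop p q b a' v"
  by (simp_all add: nop_def sh_linear pair_diff koszul_diff)

lemma nop_sh_right: "nop p q b (sh 1 x) v = nop p q b x (v + 1)"
  by (simp add: nop_def sh_sh)

text \<open>\<open>pair_shift\<close> leaves one boundary term in each half, x_0 c_v and c_v x_0;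
  together they form a supercommutator.\<close>

lemma nop_sh_left:
  assumes "x \<in> D" "c \<in> D"
  shows "nop p q (sh 1 x) c v - nop p q x c (v + 1) = m (x 0) (c v) - koszul p q (m (c v) (x 0))"
proof -
  have 1: "pair (sh 1 x) (sh v c) = m (x 0) (c v) + pair x (sh (v + 1) c)"
    using pair_shift[OF assms(1) sh_D[OF assms(2)], of v]
    by (simp only: sh_sh sh_apply[of v c 0] add.commute[of 1 v] add_0)
  have 2: "pair (sh (v + 1) c) x = m (c v) (x 0) + pair (sh v c) (sh 1 x)"
    using pair_shift[OF sh_D[OF assms(2)] assms(1), of v]
    by (simp only: sh_sh sh_apply[of v c 0] add.commute[of 1 v] add_0)
  show ?thesis unfolding nop_def 1 2 by (simp add: koszul_add)
qed

lemma sc_nop: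
  assumes "x \<in> P p" "b \<in> DP q" "c \<in> DP r"
  shows "sc x (nop q r b c v) = nop (p + q) r (\<lambda>t. sc x (b t)) c v
    + koszul p q (nop q (p + r) b (\<lambda>t. sc x (c t)) v)"
proof -
  have x: "x \<in> C" and D: "b \<in> D" "c \<in> D" using assms P_C by auto
  have sh: "(\<lambda>t. sc x (sh v c t)) = sh v (\<lambda>t. sc x (c t))" by (simp add: sh_def)
  note 1 = sc_pair[OF assms(1,2) sh_DP[OF assms(3)], of v] sc_pair[OF assms(1) sh_DP[OF assms(3)] assms(2), of v]
  show ?thesis
    unfolding nop_def
    by (simp add: sc_add sc_koszul koszul_C pair_C D x 1 sh koszul_add koszul_left koszul_right koszul_koszul)
      (simp add: koszul_def)
qed

text \<open>In the right factor multiplication by w merely shifts the mode of the product, so there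
  is no defect.\<close>

lemma M_pow_nop_right:
  assumes "b \<in> D" "R \<in> D2 r"
  shows "(M ^^ n) (\<lambda>t. nop p q b (R t)) t u = nop p q b ((M ^^ n) R t) u"
  using assms(2)
proof (induction n arbitrary: R t u)
  case (Suc n)
  have "M (\<lambda>t. nop p q b (R t)) = (\<lambda>t. nop p q b (M R t))"
    unfolding M_sh[of R] using Suc.prems
    by (intro ext, subst nop_diff(2)) (simp_all add: assms(1) M_apply nop_sh_right)
  then show ?case unfolding M_Suc using Suc.IH[OF M_D2[OF Suc.prems]] by simp
qed simp

text \<open>
  Multiplication by \<open>z - w\<close> does not commute with the normal ordered product of \<open>R(z,x)\<close> and
  \<open>c(w)\<close> at \<open>x = w\<close>; the defect is a commutator, and iterating it yields the integral term.
\<close>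

lemma M_nop_left:
  assumes "R \<in> D2 p" "c \<in> DP q"
  shows "M (\<lambda>t. nop p q (R t) c) = (\<lambda>t. nop p q (M R t) c) + (\<lambda>t u. sc (R t 0) (c u))"
proof (intro ext)
  fix t u
  have R: "R t \<in> D" "R (t + 1) \<in> D" "c \<in> D" "R t 0 \<in> P p" "c u \<in> P q" using assms by auto
  show "M (\<lambda>t. nop p q (R t) c) t u = ((\<lambda>t. nop p q (M R t) c) + (\<lambda>t u. sc (R t 0) (c u))) t u"
    by (simp add: M_sh[of R] nop_diff(1) R M_apply[of _ t u] sc_hom[OF R(4,5)]
        nop_sh_left[OF R(1,3), of p q u, symmetric])
qed

text \<open>The first step leaves the defect [R(z,x),c(w)], which the remaining powers of z - w = (z
  - x) + (x - w) multiply, as expanded by \<open>binomial_M123\<close>. Pascal's rule merges this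
  with the defects that the induction hypothesis gives for (z - x) R.\<close>

lemma M_pow_nop_left:
  assumes "R \<in> D2 p" "c \<in> DP q"
  shows "(M ^^ n) (\<lambda>t. nop p q (R t) c) 0 v = nop p q ((M ^^ n) R 0) c v
    + (\<Sum>i<n. s (of_nat (n choose i))
        ((M23 ^^ (n - 1 - i)) ((M12 ^^ i) (\<lambda>r t u. sc (R r t) (c u))) 0 0 v))"
  using assms(1)
proof (induction n arbitrary: R)
  case (Suc n)
  define F where "F = (\<lambda>r t u. sc (R r t) (c u))"
  let ?X = "\<lambda>i j. (M23 ^^ j) ((M12 ^^ i) F) 0 0 v"
  have F: "(\<lambda>r t u. sc (M R r t) (c u)) = M12 F"
    unfolding F_def M12_def
  proof (intro ext)
    fix r t u
    have C: "R (r + 1) t \<in> C" "R r (t + 1) \<in> C" "c u \<in> C" using Suc.prems assms(2) D_C by auto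
    show "sc (M R r t) (c u) = sc (R (r + 1) t) (c u) - sc (R r (t + 1)) (c u)"
      by (simp only: M_apply sc_diff C)
  qed
  have "(M ^^ Suc n) (\<lambda>t. nop p q (R t) c) 0 v
      = (M ^^ n) (\<lambda>t. nop p q (M R t) c) 0 v + (M ^^ n) (\<lambda>t u. F t 0 u) 0 v"
    unfolding M_Suc M_nop_left[OF Suc.prems assms(2)] M_pow_add F_def by simp
  also have "(M ^^ n) (\<lambda>t. nop p q (M R t) c) 0 v = nop p q ((M ^^ n) (M R) 0) c v
      + (\<Sum>i<n. s (of_nat (n choose i)) (?X (Suc i) (n - 1 - i)))"
    unfolding Suc.IH[OF M_D2[OF Suc.prems]] F funpow_Suc_right[of _ M12] o_apply ..
  also have "(M ^^ n) (\<lambda>t u. F t 0 u) 0 v = (M13 ^^ n) F 0 0 v"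
    by (simp add: M123_pow(2))
  also have "\<dots> = ?X 0 n + (\<Sum>i<n. s (of_nat (n choose Suc i)) (?X (Suc i) (n - Suc i)))"
    unfolding binomial_M123 sum.lessThan_Suc_shift by simp
  finally have "(M ^^ Suc n) (\<lambda>t. nop p q (R t) c) 0 v = nop p q ((M ^^ Suc n) R 0) c v + (?X 0 n
      + ((\<Sum>i<n. s (of_nat (n choose i)) (?X (Suc i) (n - 1 - i)))
        + (\<Sum>i<n. s (of_nat (n choose Suc i)) (?X (Suc i) (n - Suc i)))))"
    unfolding M_Suc by (simp only: add_ac)
  also have "(\<Sum>i<n. s (of_nat (n choose i)) (?X (Suc i) (n - 1 - i)))
        + (\<Sum>i<n. s (of_nat (n choose Suc i)) (?X (Suc i) (n - Suc i)))
      = (\<Sum>i<n. s (of_nat (Suc n choose Suc i)) (?X (Suc i) (Suc n - 1 - Suc i)))"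
    unfolding sum.distrib[symmetric] binomial_Suc_Suc of_nat_add scale_left_distrib by simp
  also have "?X 0 n + \<dots> = (\<Sum>i<Suc n. s (of_nat (Suc n choose i)) (?X i (Suc n - 1 - i)))"
    unfolding sum.lessThan_Suc_shift by simp
  finally show ?case unfolding F_def .
qed simp

text \<open>The commutator with \<open>a\<close> falls on \<open>b\<close> or on \<open>c\<close>.
  Multiplication by (z - w)^n has no defect in the second case; in the first the defects are the
  iterated brackets of \<open>bracket_bracket_left\<close>.\<close>

lemma bracket_Wick:
  assumes "a \<in> DP p" "b \<in> DP q" "c \<in> DP r" "nop q r b c \<in> D"
  shows "bracket_dist m P a (nop q r b c) n v = nop (p + q) r (bracket_dist m P a b n) c v
    + koszul p q (nop q (p + r) b (bracket_dist m P a c n) v)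
    + (\<Sum>i<n. s (of_nat (n choose i)) (bracket_dist m P (bracket_dist m P a b i) c (n - 1 - i) v))"
proof -
  have D: "a \<in> D" "b \<in> D" "c \<in> D" using assms by auto
  have "K a (nop q r b c) = (\<lambda>t. nop (p + q) r (K a b t) c) + koszul p q (\<lambda>t. nop q (p + r) b (K a c t))"
  proof (intro ext)
    fix t u
    have "a t \<in> P p" using assms by auto
    from sc_nop[OF this assms(2,3), of u]
    show "K a (nop q r b c) t u
        = ((\<lambda>t. nop (p + q) r (K a b t) c) + koszul p q (\<lambda>t. nop q (p + r) b (K a c t))) t u"
      by (simp add: koszul_fun comm_dist_def)
  qed
  moreover have "(M ^^ n) (koszul p q F) = koszul p q ((M ^^ n) F)" for F :: "'w distribution2"
    by (simp add: koszul_def M_pow_minus)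
  ultimately have "bracket_dist m P a (nop q r b c) n v
      = (M ^^ n) (\<lambda>t. nop (p + q) r (K a b t) c) 0 v
        + koszul p q ((M ^^ n) (\<lambda>t. nop q (p + r) b (K a c t)) 0 v)"
    by (simp only: bracket_eq M_pow_add plus_fun_apply koszul_fun)
  then show ?thesis
    unfolding M_pow_nop_left[OF K_D2[OF assms(1,2)] assms(3)] M_pow_nop_right[OF D(2) K_D2[OF assms(1,3)]]
      bracket_bracket_left[OF D] unfolding bracket_eq by (simp add: algebra_simps)
qed


subsection \<open>The commutator of the normal ordered product\<close>

text \<open>Each difference compares a pairing with z^v on one factor to the same pairing with z^v
  on the other. By \<open>pair_shift_nat\<close> finitely many products remain, and those of the two
  halves combine to commutators.\<close>

lemma nop_commutator:
  assumes "a \<in> DP p" "b \<in> DP q"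
  shows "nop p q a b v - koszul p q (nop q p b a v) = comm_coeff (K a b) v"
proof -
  have D: "a \<in> D" "b \<in> D" using assms by auto
  have sc: "K a b t u = m (a t) (b u) - koszul p q (m (b u) (a t))" for t u
    unfolding K_apply using assms by (intro sc_hom) auto
  have 1: "nop p q a b v - koszul p q (nop q p b a v) =
    (pair a (sh v b) - pair (sh v a) b) + koszul p q (pair (sh v b) a - pair b (sh v a))"
    unfolding nop_def koszul_add koszul_koszul koszul_diff by simp
  have kd: "(\<Sum>i<n. f i - koszul p q (g i)) = (\<Sum>i<n. f i) - koszul p q (\<Sum>i<n. g i)"
    for n and f g :: "nat \<Rightarrow> 'w"
    by (simp add: koszul_def sum.distrib sum_subtractf sum_negf)
  show ?thesis
  proof (cases v rule: int_cases2)
    case (nonneg n)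
    \<comment> \<open>Reversing this sum aligns its terms with those of the other half, so that each
      index gives one commutator.\<close>
    have "(\<Sum>i<n. m (b (int n - 1 - int i)) (a (int i))) = (\<Sum>i<n. m (b (int i)) (a (int n - 1 - int i)))"
      by (subst sum.nat_diff_reindex[symmetric])
        (auto intro!: sum.cong arg_cong2[where f=m] arg_cong[where f=a] arg_cong[where f=b])
    then show ?thesis
      unfolding 1 unfolding nonneg comm_coeff_def sc kd
      by (simp add: pair_shift_nat D koszul_def)
  next
    case (nonpos n)
    let ?a = "sh (- int n) a" and ?b = "sh (- int n) b"
    have eq: "sh (int n) ?a = a" "sh (int n) ?b = b" by (simp_all add: sh_sh)
    have 2: "pair a ?b = (\<Sum>i<n. m (?a (int n - 1 - int i)) (?b (int i))) + pair ?a b"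
      "pair b ?a = (\<Sum>i<n. m (?b (int n - 1 - int i)) (?a (int i))) + pair ?b a"
      using pair_shift_nat[of ?a ?b n] pair_shift_nat[of ?b ?a n] D by (simp_all add: eq)
    have "(\<Sum>i<n. m (?b (int n - 1 - int i)) (?a (int i))) = (\<Sum>i<n. m (b (v + int i)) (a (- 1 - int i)))"
      unfolding nonpos sh_apply
      by (subst sum.nat_diff_reindex[symmetric])
        (auto intro!: sum.cong arg_cong2[where f=m] arg_cong[where f=a] arg_cong[where f=b])
    moreover have "(\<Sum>i<n. m (?a (int n - 1 - int i)) (?b (int i))) = (\<Sum>i<n. m (a (- 1 - int i)) (b (v + int i)))"
      unfolding nonpos sh_apply
      by (auto intro!: sum.cong arg_cong2[where f=m] arg_cong[where f=a] arg_cong[where f=b])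
    moreover have "comm_coeff (K a b) v = (\<Sum>i<n. K a b (- 1 - int i) (v + int i))"
      unfolding nonpos comm_coeff_def by (cases "n = 0") simp_all
    ultimately show ?thesis
      unfolding 1 unfolding sc kd unfolding nonpos 2 by (simp add: koszul_def)
  qed
qed


subsection \<open>Quasi-associativity\<close>

lemma nop_hs:
  assumes "a \<in> D" "b \<in> D"
  shows "hs UNIV (\<lambda>n. m (a (- 1 - int n)) (b (v + int n)) + koszul p q (m (b (v - 1 - int n)) (a (int n))))
    (nop p q a b v)"
proof -
  have "- 1 - int n + v = v - 1 - int n" "int n + v = v + int n" for n by simp_all
  then show ?thesis
    using hs_add[OF pair_hs[OF assms(1) sh_D[OF assms(2)], of v] hs_koszul[OF pair_hs[OF sh_D[OF assms(2)] assms(1), of v], of p q]]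
    unfolding nop_def sh_apply by (simp only:)
qed

definition null :: "(nat \<times> nat \<Rightarrow> 'w) \<Rightarrow> bool" where
  "null X \<longleftrightarrow> (\<forall>U\<in>\<U>. finite {x. X x \<notin> U})"

text \<open>Uniformity in \<open>j\<close> leaves finitely many rows, each with finitely many
  exceptional entries.\<close>

lemma nullI:
  assumes "\<And>U. U \<in> \<U> \<Longrightarrow> \<exists>N. \<forall>i\<ge>N. \<forall>j. X (i, j) \<in> U"
    "\<And>U i. U \<in> \<U> \<Longrightarrow> \<exists>N. \<forall>j\<ge>N. X (i, j) \<in> U"
  shows "null X"
  unfolding null_def
proof
  fix U assume U: "U \<in> \<U>"
  obtain N where N: "\<And>i j. i \<ge> N \<Longrightarrow> X (i, j) \<in> U" using assms(1)[OF U] by blast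
  obtain L where L: "\<And>i j. j \<ge> L i \<Longrightarrow> X (i, j) \<in> U" using assms(2)[OF U] by metis
  have "{x. X x \<notin> U} \<subseteq> Sigma {..<N} (\<lambda>i. {..<L i})"
  proof (clarsimp)
    fix i j assume "X (i, j) \<notin> U"
    then show "i < N \<and> j < L i" using N L not_le by metis
  qed
  then show "finite {x. X x \<notin> U}" by (rule finite_subset) auto
qed

lemma null_add: "null X \<Longrightarrow> null Y \<Longrightarrow> null (\<lambda>x. X x + Y x)"
  unfolding null_def
proof
  fix U assume n: "\<forall>U\<in>\<U>. finite {x. X x \<notin> U}" "\<forall>U\<in>\<U>. finite {x. Y x \<notin> U}" and U: "U \<in> \<U>"
  have "{x. X x + Y x \<notin> U} \<subseteq> {x. X x \<notin> U} \<union> {x. Y x \<notin> U}"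
    using subspace_add[OF nbhd_sub[OF U]] by auto
  then show "finite {x. X x + Y x \<notin> U}" by (rule finite_subset) (use n U in auto)
qed

lemma null_koszul: "null X \<Longrightarrow> null (\<lambda>x. koszul p q (X x))"
  unfolding null_def
proof
  fix U assume n: "\<forall>U\<in>\<U>. finite {x. X x \<notin> U}" and U: "U \<in> \<U>"
  have "{x. koszul p q (X x) \<notin> U} \<subseteq> {x. X x \<notin> U}"
    using subspace_neg[OF nbhd_sub[OF U]] by (auto simp: koszul_def)
  then show "finite {x. koszul p q (X x) \<notin> U}" by (rule finite_subset) (use n U in auto)
qed

lemma null_swap: "null X \<Longrightarrow> null (\<lambda>(i, j). X (j, i))"
  unfolding null_def
proof
  fix U assume n: "\<forall>U\<in>\<U>. finite {x. X x \<notin> U}" and U: "U \<in> \<U>"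
  have "{x. (case x of (i, j) \<Rightarrow> X (j, i)) \<notin> U} = prod.swap -` {x. X x \<notin> U}"
    by (simp add: vimage_def case_prod_beta prod.swap_def)
  moreover have "finite (prod.swap -` {x. X x \<notin> U})"
    by (rule finite_vimageI) (use n U in auto)
  ultimately show "finite {x. (case x of (i, j) \<Rightarrow> X (j, i)) \<notin> U}" by (simp only:)
qed

lemma D_null_nat:
  assumes "a \<in> D" "U \<in> \<U>"
  shows "\<exists>N. \<forall>n\<ge>N. \<forall>x\<in>C. m x (a (v + int n)) \<in> U"
proof -
  obtain N where N: "\<forall>t\<ge>N. \<forall>x\<in>C. m x (a t) \<in> U" using D_null[OF assms] by blast
  show ?thesis
  proof (intro exI[of _ "nat (N - v)"] allI impI ballI)
    fix n x assume "nat (N - v) \<le> n" "x \<in> C"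
    then show "m x (a (v + int n)) \<in> U" using N by auto
  qed
qed

lemma D_null_nat_right:
  assumes "a \<in> D" "U \<in> \<U>" "y \<in> C"
  shows "\<exists>N. \<forall>n\<ge>N. \<forall>x\<in>C. m (m x (a (v + int n))) y \<in> U"
proof -
  obtain U' where U': "U' \<in> \<U>" "\<forall>x\<in>U' \<inter> C. m x y \<in> U" using nbhd_right[OF assms(3,2)] by blast
  obtain N where "\<forall>n\<ge>N. \<forall>x\<in>C. m x (a (v + int n)) \<in> U'" using D_null_nat[OF assms(1) U'(1)] by blast
  then show ?thesis using U'(2) m_closed D_C[OF assms(1)] by (intro exI[of _ N]) auto
qed

lemma null_diagonal:
  assumes "\<And>i j. f i j \<in> C" "c \<in> D"
  shows "null (\<lambda>(i, j). m (f i j) (c (v + int i + int j)))"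
proof (rule nullI; unfold prod.case)
  fix U i assume "U \<in> \<U>"
  then obtain N where N: "\<forall>n\<ge>N. \<forall>x\<in>C. m x (c (v + int n)) \<in> U"
    using D_null_nat[OF assms(2)] by blast
  have *: "m (f i j) (c (v + int i + int j)) \<in> U" if "i + j \<ge> N" for i j
    using N[rule_format, OF that assms(1)[of i j]] by (simp add: add.assoc)
  show "\<exists>N. \<forall>i\<ge>N. \<forall>j. m (f i j) (c (v + int i + int j)) \<in> U"
    and "\<exists>N. \<forall>j\<ge>N. m (f i j) (c (v + int i + int j)) \<in> U"
    by (intro exI[of _ N]; simp add: *)+
qed

text \<open>For large \<open>i\<close> the last factor makes the term small uniformly in the rest.
  For fixed \<open>i\<close> the middle factor does, followed by the continuous right multiplication
  with a_i.\<close>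

lemma null_iterated:
  assumes "\<And>i j. f i j \<in> C" "c \<in> D" "a \<in> D"
  shows "null (\<lambda>(i, j). m (m (f i j) (c (w i + int j))) (a (int i)))"
proof (rule nullI; unfold prod.case)
  fix U assume U: "U \<in> \<U>"
  obtain N where N: "\<forall>n\<ge>N. \<forall>x\<in>C. m x (a (0 + int n)) \<in> U"
    using D_null_nat[OF assms(3) U] by blast
  then show "\<exists>N. \<forall>i\<ge>N. \<forall>j. m (m (f i j) (c (w i + int j))) (a (int i)) \<in> U"
    using assms(1) by (intro exI[of _ N]) (simp add: m_closed D_C assms(2))
  fix i
  obtain N where "\<forall>n\<ge>N. \<forall>x\<in>C. m (m x (c (w i + int n))) (a (int i)) \<in> U"
    using D_null_nat_right[OF assms(2) U D_C[OF assms(3)]] by blast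
  then show "\<exists>N. \<forall>j\<ge>N. m (m (f i j) (c (w i + int j))) (a (int i)) \<in> U"
    using assms(1) by (intro exI[of _ N]) simp
qed

text \<open>The double series for mode \<open>v\<close> of a(bc), with \<open>i\<close> the
  summation index of the outer product and \<open>j\<close> that of the inner one. The four terms
  are the choices of putting each of a, b to the left of c with negative index or to the right with
  nonnegative index.\<close>

definition assoc_family ::
  "bit \<Rightarrow> bit \<Rightarrow> bit \<Rightarrow> 'w distribution \<Rightarrow> 'w distribution \<Rightarrow> 'w distribution \<Rightarrow> int \<Rightarrow> nat \<times> nat \<Rightarrow> 'w" where
  "assoc_family p q r a b c v = (\<lambda>(i, j).
     (m (m (a (- 1 - int i)) (b (- 1 - int j))) (c (v + int i + int j))
       + koszul q r (m (m (a (- 1 - int i)) (c (v - 1 - int j + int i))) (b (int j))))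
     + koszul p (q + r)
        (m (m (b (- 1 - int j)) (c (v - 1 - int i + int j))) (a (int i))
       + koszul q r (m (m (c (v - 1 - int i - 1 - int j)) (b (int j))) (a (int i)))))"

lemma assoc_family_null:
  assumes D: "a \<in> D" "b \<in> D" "c \<in> D"
  shows "null (assoc_family p q r a b c v)"
proof -
  note C = D_C[OF D(1)] D_C[OF D(2)] D_C[OF D(3)]
  have 1: "null (\<lambda>(i, j). m (m (a (- 1 - int i)) (b (- 1 - int j))) (c (v + int i + int j)))"
    by (rule null_diagonal) (intro m_closed C, rule D)
  have 2: "null (\<lambda>(j, i). m (m (a (- 1 - int i)) (c (v - 1 - int j + int i))) (b (int j)))"
    by (rule null_iterated[OF C(1) D(3,2)])
  have 3: "null (\<lambda>(i, j). m (m (b (- 1 - int j)) (c (v - 1 - int i + int j))) (a (int i)))"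
    by (rule null_iterated[OF C(2) D(3,1)])
  have 4: "null (\<lambda>(i, j). m (m (c (v - 1 - int i - 1 - int j)) (b (int j))) (a (int i)))"
    using null_iterated[OF C(3) D(2,1), where w = "\<lambda>_. 0"] by simp
  from null_add[OF null_add[OF 1 null_koszul[OF null_swap[OF 2]]] null_koszul[OF null_add[OF 3 null_koszul[OF 4]]],
      of q r p "q + r" q r]
  show ?thesis unfolding assoc_family_def by (simp only: case_prod_beta' fst_conv snd_conv)
qed

text \<open>Rows converge because the modes of bc are series in \<open>j\<close> and multiplication
  is continuous; nullity upgrades the iterated sum to an unordered one.\<close>

lemma assoc_family_hs:
  assumes D: "a \<in> D" "b \<in> D" "c \<in> D" and bc: "nop q r b c \<in> D"
  shows "hs UNIV (assoc_family p q r a b c v) (nop p (q + r) a (nop q r b c) v)"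
proof (rule hs_from_fibres[where \<pi> = fst and K = UNIV])
  let ?r = "\<lambda>i. m (a (- 1 - int i)) (nop q r b c (v + int i))
    + koszul p (q + r) (m (nop q r b c (v - 1 - int i)) (a (int i)))"
  note C = D_C[OF D(1)] D_C[OF D(2)] D_C[OF D(3)] m_closed koszul_C C_closed
  show "hs UNIV ?r (nop p (q + r) a (nop q r b c) v)" by (rule nop_hs[OF D(1) bc])
  show "hs {x \<in> UNIV. fst x = i} (assoc_family p q r a b c v) (?r i)" for i
  proof -
    have "hs UNIV (\<lambda>j. m (a (- 1 - int i))
          (m (b (- 1 - int j)) (c (v + int i + int j)) + koszul q r (m (c (v + int i - 1 - int j)) (b (int j))))
        + koszul p (q + r) (m (m (b (- 1 - int j)) (c (v - 1 - int i + int j))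
            + koszul q r (m (c (v - 1 - int i - 1 - int j)) (b (int j)))) (a (int i)))) (?r i)"
      by (intro hs_add hs_koszul hs_left hs_right nop_hs D C)
    moreover have "v + int i - 1 - int j = v - 1 - int j + int i" for j by simp
    ultimately have "hs UNIV (\<lambda>j. assoc_family p q r a b c v (i, j)) (?r i)"
      by (elim hs_cong[rotated], simp only:) (simp add: assoc_family_def m_add_left m_add_right m_koszul m_assoc C)
    then have "hs (snd ` {x \<in> UNIV. fst x = i}) (\<lambda>j. assoc_family p q r a b c v (i, j)) (?r i)"
      by (simp add: image_def)
    then have "hs {x \<in> UNIV. fst x = i} (\<lambda>x. assoc_family p q r a b c v (i, snd x)) (?r i)"
      by (rule hs_reindex) (auto simp: inj_on_def prod_eq_iff)
    then show ?thesis by (rule hs_cong[rotated]) auto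
  qed
  show "finite {x \<in> UNIV. assoc_family p q r a b c v x \<notin> U}" if "U \<in> \<U>" for U
    using assoc_family_null[OF D, of p q r v] that by (simp add: null_def)
qed simp

lemma koszul_sum: "(\<Sum>x\<in>A. koszul p q (f x)) = koszul p q (\<Sum>x\<in>A. f x :: 'w)"
  by (simp add: koszul_def sum_negf)

text \<open>The terms with a and b on opposite sides of c occur in both expansions and cancel. In
  the others a and b are adjacent and combine to their commutator.\<close>

lemma assoc_family_cancel:
  assumes C: "a1 \<in> C" "a0 \<in> C" "b1 \<in> C" "b0 \<in> C" "c1 \<in> C" "c2 \<in> C" "c3 \<in> C" "c4 \<in> C"
  shows "m (m a1 b1) c1 + koszul q r (m (m a1 c2) b0)
      + koszul p (q + r) (m (m b1 c3) a0 + koszul q r (m (m c4 b0) a0))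
      - koszul p q (m (m b1 a1) c1 + koszul p r (m (m b1 c3) a0)
          + koszul q (p + r) (m (m a1 c2) b0 + koszul p r (m (m c4 a0) b0)))
    = m (m a1 b1 - koszul p q (m b1 a1)) c1
      - koszul (p + q) r (m c4 (m a0 b0 - koszul p q (m b0 a0)))"
  unfolding koszul_left koszul_right
  by (simp add: m_diff m_koszul m_closed koszul_C m_assoc C koszul_add koszul_diff)
    (simp add: koszul_def)

text \<open>After \<open>assoc_family_cancel\<close> the double series involves only [a_t,b_u] with
  both indices negative or both nonnegative. Its antidiagonal sums are the modes of [a,b] by
  \<open>nop_commutator\<close>, so regrouping gives the series of the product of [a,b] with
  c.\<close>

lemma nop_quasi_assoc:
  assumes h: "a \<in> DP p" "b \<in> DP q" "c \<in> DP r"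
    and D': "nop q r b c \<in> D" "nop p r a c \<in> D" "nop p q a b \<in> D" "nop q p b a \<in> D"
  shows "nop (p + q) r (nop p q a b - koszul p q (nop q p b a)) c v
    = nop p (q + r) a (nop q r b c) v - koszul p q (nop q (p + r) b (nop p r a c) v)"
proof -
  have D: "a \<in> D" "b \<in> D" "c \<in> D" using h by auto
  note C = D_C[OF D(1)] D_C[OF D(2)] D_C[OF D(3)] m_closed koszul_C C_closed
  define d where "d = nop p q a b - koszul p q (nop q p b a)"
  have dD: "d \<in> D" unfolding d_def by (intro D_diff D_koszul D')
  have d: "d w = comm_coeff (K a b) w" for w
    unfolding d_def using nop_commutator[OF h(1,2)] by (simp add: koszul_fun)
  have sc: "K a b t u = m (a t) (b u) - koszul p q (m (b u) (a t))" for t u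
    unfolding K_apply using h by (intro sc_hom) auto
  let ?R = "nop p (q + r) a (nop q r b c) v - koszul p q (nop q (p + r) b (nop p r a c) v)"
  let ?f = "\<lambda>(i, j). m (K a b (- 1 - int i) (- 1 - int j)) (c (v + int i + int j))
      - koszul (p + q) r (m (c (v - 1 - int i - 1 - int j)) (K a b (int i) (int j)))"
  have "hs (prod.swap ` UNIV) (assoc_family q p r b a c v) (nop q (p + r) b (nop p r a c) v)"
    using assoc_family_hs[OF D(2,1,3) D'(2)] by simp
  then have "hs UNIV (\<lambda>x. assoc_family q p r b a c v (prod.swap x)) (nop q (p + r) b (nop p r a c) v)"
    by (rule hs_reindex) simp
  from hs_diff[OF assoc_family_hs[OF D D'(1)] hs_koszul[OF this]]
  have "hs UNIV (\<lambda>x. assoc_family p q r a b c v x - koszul p q (assoc_family q p r b a c v (prod.swap x))) ?R" .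
  then have f: "hs UNIV ?f ?R"
  proof (rule hs_cong[rotated])
    fix x :: "nat \<times> nat"
    obtain i j where x: "x = (i, j)" by (cases x)
    have idx: "v - 1 - int j - 1 - int i = v - 1 - int i - 1 - int j" "v + int j + int i = v + int i + int j"
      by simp_all
    show "assoc_family p q r a b c v x - koszul p q (assoc_family q p r b a c v (prod.swap x)) = ?f x"
      unfolding x assoc_family_def prod.swap_def fst_conv snd_conv prod.case sc idx
      by (rule assoc_family_cancel) (rule C)+
  qed
  \<comment> \<open>On i + j = n the negative indices add up to mode -1 - n of \<open>d\<close> and,
    up to sign, the nonnegative ones to mode n + 1. Mode 0 is skipped, which is correct because
    \<open>d 0 = 0\<close>.\<close>
  let ?r = "\<lambda>n. m (d (- 1 - int n)) (c (v + int n)) + koszul (p + q) r (m (c (v - 1 - int (Suc n))) (d (int (Suc n))))"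
  have r: "hs UNIV ?r ?R"
  proof (rule hs_fibres[OF f, where \<pi> = "\<lambda>(i, j). i + j"])
    fix n :: nat
    let ?A = "{x \<in> UNIV. (case x of (i, j) \<Rightarrow> i + j) = n}"
    \<comment> \<open>Two parametrizations are needed: \<open>comm_coeff\<close> counts by the first
      index at negative modes and by the second at nonnegative ones.\<close>
    have A: "?A = (\<lambda>i. (i, n - i)) ` {..n}" by (auto simp: image_iff)
    have A': "?A = (\<lambda>i. (n - i, i)) ` {..n}" by (auto simp: image_iff)
    have fin: "finite ?A" unfolding A by simp
    have fC: "?f ` ?A \<subseteq> C" by (auto intro!: C K_C D)
    have "sum ?f ?A = (\<Sum>(i, j)\<in>?A. m (K a b (- 1 - int i) (- 1 - int j)) (c (v + int i + int j)))
       - koszul (p + q) r (\<Sum>(i, j)\<in>?A. m (c (v - 1 - int i - 1 - int j)) (K a b (int i) (int j)))"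
      unfolding case_prod_beta sum_subtractf koszul_sum ..
    also have "(\<Sum>(i, j)\<in>?A. m (K a b (- 1 - int i) (- 1 - int j)) (c (v + int i + int j)))
        = (\<Sum>i\<le>n. m (K a b (- 1 - int i) (- 1 - int n + int i)) (c (v + int n)))"
      unfolding A by (subst sum.reindex) (auto simp: inj_on_def of_nat_diff algebra_simps intro!: sum.cong)
    also have "\<dots> = m (d (- 1 - int n)) (c (v + int n))"
    proof -
      have "nat (- (- 1 - int n)) = Suc n" by simp
      then show ?thesis
        unfolding d comm_coeff_def lessThan_Suc_atMost[symmetric]
        by (subst m_sum(1)[symmetric]) (auto intro!: K_C D C)
    qed
    also have "(\<Sum>(i, j)\<in>?A. m (c (v - 1 - int i - 1 - int j)) (K a b (int i) (int j)))
        = (\<Sum>i\<le>n. m (c (v - 1 - int (Suc n))) (K a b (int (Suc n) - 1 - int i) (int i)))"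
      unfolding A' by (subst sum.reindex) (auto simp: inj_on_def of_nat_diff algebra_simps intro!: sum.cong)
    also have "\<dots> = - m (c (v - 1 - int (Suc n))) (d (int (Suc n)))"
    proof -
      have "d (int (Suc n)) = - (\<Sum>i\<le>n. K a b (int (Suc n) - 1 - int i) (int i))"
        unfolding d comm_coeff_def nat_int lessThan_Suc_atMost[symmetric] by simp
      then show ?thesis
        by (simp only: m_minus m_sum C K_C D finite_atMost minus_minus)
    qed
    finally have "sum ?f ?A = ?r n" by (simp add: koszul_minus)
    then show "hs ?A ?f (?r n)" using hs_finite[OF fin fC] by simp
  qed simp
  have d0: "d 0 = 0" unfolding d comm_coeff_def by simp
  have "hs UNIV (\<lambda>n. m (sh v c (- 1 - int (Suc n))) (d (int (Suc n))))
      (pair (sh v c) d - m (sh v c (- 1 - int 0)) (d (int 0)))"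
    by (rule hs_Suc[OF pair_hs[OF sh_D[OF D(3)] dD]])
  then have "hs UNIV (\<lambda>n. m (sh v c (- 1 - int (Suc n))) (d (int (Suc n)))) (pair (sh v c) d)"
    by (simp only: of_nat_0 d0 m_zero D_C[OF sh_D[OF D(3)]] diff_0_right)
  from hs_add[OF pair_hs[OF dD sh_D[OF D(3), of v]] hs_koszul[OF this, of "p + q" r]]
  have "hs UNIV (\<lambda>n. m (d (- 1 - int n)) (sh v c (int n)) + koszul (p + q) r (m (sh v c (- 1 - int (Suc n))) (d (int (Suc n)))))
    (nop (p + q) r d c v)" unfolding nop_def .
  moreover have "sh v c (int n) = c (v + int n)" "sh v c (- 1 - int (Suc n)) = c (v - 1 - int (Suc n))" for n
    by (simp_all add: sh_apply algebra_simps)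
  ultimately have "hs UNIV ?r (nop (p + q) r d c v)" by (simp only:)
  from hs_unique[OF this r] show ?thesis unfolding d_def .
qed

end


section \<open>Vertex subalgebras\<close>

locale mode_subalgebra = mode_algebra s P C \<U> m e \<sigma> D
  for s :: "'k::field_char_0 \<Rightarrow> 'w::ab_group_add \<Rightarrow> 'w" and P C \<U> m e \<sigma> D +
  fixes V :: "'w distribution set"
  assumes V: "vertex_subalgebra (dist_valg s m e P \<sigma> D) V"
begin

abbreviation B :: "('k, 'w distribution) valg" where
  "B \<equiv> restrict_valg (dist_valg s m e P \<sigma> D) V"

abbreviation fs :: "'k \<Rightarrow> 'w distribution \<Rightarrow> 'w distribution" where
  "fs \<equiv> (\<lambda>k a t. s k (a t))"

abbreviation VP :: "bit \<Rightarrow> 'w distribution set" where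
  "VP p \<equiv> DP p \<inter> V"

abbreviation br :: "'w distribution \<Rightarrow> 'w distribution \<Rightarrow> nat \<Rightarrow> 'w distribution" where
  "br \<equiv> bracket_dist m P"

abbreviation one :: "'w distribution" where
  "one \<equiv> (\<lambda>t. if t = -1 then e else 0)"

lemma B_simps: "vcar B = V" "vscale B = fs" "vpar B = VP" "vT B = deriv_dist s" "vmul B = NO" "vbr B = br" "vone B = one"
  by (simp_all add: restrict_valg_def dist_valg_def)

lemma V_facts: "V \<subseteq> D" "super_subspace fs DP V" "one \<in> V" "\<And>a. a \<in> V \<Longrightarrow> deriv_dist s a \<in> V"
  "\<And>a b. a \<in> V \<Longrightarrow> b \<in> V \<Longrightarrow> NO a b \<in> V" "\<And>a b t. a \<in> V \<Longrightarrow> b \<in> V \<Longrightarrow> br a b t \<in> V"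
  "\<And>a b. a \<in> V \<Longrightarrow> b \<in> V \<Longrightarrow> \<exists>N. \<forall>t\<ge>N. br a b t = 0"
  using V unfolding vertex_subalgebra_def polynomial_bracket_on_def dist_valg_def by simp_all

lemmas V_T = V_facts(4) and V_NO = V_facts(5) and V_br = V_facts(6)

lemma V_D: "a \<in> V \<Longrightarrow> a \<in> D"
  using V_facts(1) by (rule subsetD)

lemma V_sub: "module.subspace fs V"
  using V_facts(2) by (simp add: super_subspace_def)

lemma V_add: "a \<in> V \<Longrightarrow> b \<in> V \<Longrightarrow> a + b \<in> V" and V_scale: "a \<in> V \<Longrightarrow> fs k a \<in> V" and V_zero: "0 \<in> V"
proof -
  interpret F: vector_space fs by (rule fun_vector_space)
  show "a \<in> V \<Longrightarrow> b \<in> V \<Longrightarrow> a + b \<in> V" "a \<in> V \<Longrightarrow> fs k a \<in> V" "0 \<in> V"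
    using F.subspace_add[OF V_sub] F.subspace_scale[OF V_sub] F.subspace_0[OF V_sub] by auto
qed

lemma V_minus: "a \<in> V \<Longrightarrow> - a \<in> V"
  using V_scale[of a "-1"] by (simp add: fun_Compl_def)

lemma V_diff: "a \<in> V \<Longrightarrow> b \<in> V \<Longrightarrow> a - b \<in> V"
  using V_add[OF _ V_minus, of a b] by simp

lemma V_koszul: "a \<in> V \<Longrightarrow> koszul p q a \<in> V"
  by (simp add: koszul_def V_minus)

lemma VP_diff: "a \<in> VP p \<Longrightarrow> b \<in> VP p \<Longrightarrow> a - b \<in> VP p"
  using DP_diff V_diff by blast

lemma VP_koszul: "a \<in> VP r \<Longrightarrow> koszul p q a \<in> VP r"
  using D_koszul[of a p q] V_koszul[of a p q] P_closed(4)[of "a t" r for t]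
  by (auto simp: koszul_def)

lemma decomposition_PP:
  assumes "a \<in> D" "decomposition UNIV Q a f" "\<And>p. Q p \<subseteq> DP p"
  shows "f = PP a"
proof
  fix p
  have f: "f 0 \<in> DP 0" "f 1 \<in> DP 1" "a = f 0 + f 1" using assms(2,3) by (auto simp: decomposition_bit)
  then have "PP a p = PP (f 0) p + PP (f 1) p" using PP_add[of "f 0" "f 1" p] by simp
  then show "f p = PP a p" unfolding PP_hom[OF f(1)] PP_hom[OF f(2)] by (cases p) simp_all
qed

lemma parity_part_dist:
  assumes "a \<in> D"
  shows "parity_part DP a p = PP a p"
proof -
  have "decomposition UNIV DP a (PP a)"
    unfolding decomposition_bit by (intro conjI allI PP_DP assms PP_sum[OF assms, symmetric])
  then have "component UNIV DP a = PP a"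
    unfolding component_def by (rule the_equality[where P = "decomposition UNIV DP a"]) (rule decomposition_PP[OF assms _ order_refl])
  then show ?thesis by simp
qed

lemma V_PP: "a \<in> V \<Longrightarrow> PP a p \<in> V"
proof -
  assume a: "a \<in> V"
  then have "parity_part DP a p \<in> V" using V_facts(2) unfolding super_subspace_def by blast
  then show ?thesis using parity_part_dist[OF V_D[OF a]] by simp
qed

text \<open>The axioms leave the third argument inhomogeneous, whereas the signs in nested products
  need its parity.\<close>

lemma V_homogeneous_induct [consumes 1, case_names homogeneous add]:
  assumes "c \<in> V" "\<And>r c. c \<in> VP r \<Longrightarrow> Q c" "\<And>c d. c \<in> V \<Longrightarrow> d \<in> V \<Longrightarrow> Q c \<Longrightarrow> Q d \<Longrightarrow> Q (c + d)"
  shows "Q c"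
proof -
  have h: "PP c p \<in> VP p" for p by (rule IntI[OF PP_DP[OF V_D[OF assms(1)]] V_PP[OF assms(1)]])
  have "Q (PP c 0 + PP c 1)"
    by (rule assms(3)[OF V_PP[OF assms(1)] V_PP[OF assms(1)] assms(2)[OF h] assms(2)[OF h]])
  then show ?thesis using PP_sum[OF V_D[OF assms(1)]] by simp
qed

lemma deriv_DP: "a \<in> VP p \<Longrightarrow> deriv_dist s a \<in> VP p"
proof -
  assume a: "a \<in> VP p"
  then have "deriv_dist s a \<in> V" using V_T by blast
  moreover have "deriv_dist s a t \<in> P p" for t
    unfolding deriv_dist_def using a by (intro P_closed(5)) auto
  ultimately show ?thesis using V_D by blast
qed

lemma deriv_add: "deriv_dist s (a + b) = deriv_dist s a + deriv_dist s b"
  and deriv_scale: "deriv_dist s (fs k a) = fs k (deriv_dist s a)"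
  unfolding deriv_dist_def by (intro ext, simp add: scale_right_distrib)+

lemma br_add: "a \<in> V \<Longrightarrow> a' \<in> V \<Longrightarrow> b \<in> V \<Longrightarrow> br (a + a') b n = br a b n + br a' b n"
   "a \<in> V \<Longrightarrow> a' \<in> V \<Longrightarrow> b \<in> V \<Longrightarrow> br b (a + a') n = br b a n + br b a' n"
  unfolding bracket_eq by (simp_all only: K_add V_D M_pow_add plus_fun_apply)

lemma br_scale: "a \<in> V \<Longrightarrow> b \<in> V \<Longrightarrow> br (fs k a) b n = fs k (br a b n)"
   "a \<in> V \<Longrightarrow> b \<in> V \<Longrightarrow> br a (fs k b) n = fs k (br a b n)"
  unfolding bracket_eq by (intro ext, simp only: K_scale V_D M_pow_scale)+

lemma B_super: "super_space fs VP V"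
  unfolding graded_space_def
proof (intro conjI ballI)
  interpret F: vector_space fs by (rule fun_vector_space)
  show "vector_space fs" by (rule fun_vector_space)
  show "module.subspace fs V" by (rule V_sub)
  fix p
  show "module.subspace fs (VP p)"
  proof (rule F.subspaceI)
    show "0 \<in> VP p" using D_zero V_zero P_closed by simp
    show "x + y \<in> VP p" if "x \<in> VP p" "y \<in> VP p" for x y
      using that D_add V_add P_closed(2) by simp
    show "fs k x \<in> VP p" if "x \<in> VP p" for k x
      using that D_scale V_scale P_closed(5) by simp
  qed
  show "VP p \<subseteq> V" by blast
next
  fix a assume a: "a \<in> V"
  show "\<exists>!f. decomposition UNIV VP a f"
  proof
    show "decomposition UNIV VP a (PP a)"
      unfolding decomposition_bit
      by (intro conjI allI IntI PP_DP V_D V_PP a PP_sum[OF V_D[OF a], symmetric])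
    show "f = PP a" if "decomposition UNIV VP a f" for f
      by (rule decomposition_PP[OF V_D[OF a] that]) blast
  qed
qed

lemma B_vertex_algebra: "vertex_algebra B"
  unfolding vertex_algebra_def unbounded_vertex_algebra_def B_simps
proof (intro conjI allI ballI)
  show "super_space fs VP V" by (rule B_super)
  show "even_bilinear_on fs V VP NO"
    unfolding even_bilinear_on_def lin_on_def
  proof (intro conjI ballI allI)
    fix p q a b assume "a \<in> VP p" "b \<in> VP q"
    then show "NO a b \<in> VP (p + q)"
      using NO_par[of a p b q] V_NO[of a b] V_D[of "NO a b"] by simp
  qed (simp_all only: V_NO NO_add NO_scale V_D)
  show "lin_on fs V (deriv_dist s)"
    unfolding lin_on_def by (simp only: deriv_add deriv_scale) simp
  show "deriv_dist s a \<in> VP p" if "a \<in> VP p" for p a by (rule deriv_DP[OF that])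
  show "even_bilinear_on fs V VP (\<lambda>a b. br a b n)" for n
    unfolding even_bilinear_on_def lin_on_def
  proof (intro conjI ballI allI)
    fix p q a b assume "a \<in> VP p" "b \<in> VP q"
    then show "br a b n \<in> VP (p + q)"
      using bracket_DP[of a p b q n] V_br[of a b n] by simp
  qed (simp_all only: V_br br_add br_scale)
  show "polynomial_bracket_on B V"
    unfolding polynomial_bracket_on_def B_simps using V_facts(7) by blast
  show "one \<in> V" by (rule V_facts(3))
next
  fix a assume a: "a \<in> V"
  show "deriv_dist s a \<in> V" by (rule V_T[OF a])
  have "NO one a = a \<and> NO a one = a" using a
  proof (induction rule: V_homogeneous_induct)
    case (homogeneous r c)
    then show ?case using D_one_unit[OF refl V_D[OF V_facts(3)], of c r] by simp
  next
    case (add c d)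
    then show ?case
      by (simp only: NO_add[OF V_D[OF add(1)] V_D[OF add(2)] V_D[OF V_facts(3)]] simp_thms)
  qed
  then show "NO one a = a" "NO a one = a" by auto
  show "br one a t = 0" "br a one t = 0" for t
    by (rule bracket_one[OF refl V_D[OF a]])+
  fix b assume b: "b \<in> V"
  show "deriv_dist s (NO a b) = NO (deriv_dist s a) b + NO a (deriv_dist s b)"
    by (rule NO_deriv) (simp_all only: V_D V_T a b)
  show "deriv_dist s (br a b t) = br (deriv_dist s a) b t + br a (deriv_dist s b) t" for t
    using bracket_deriv(2)[OF V_D[OF a] V_D[OF b]] by simp
  show "br (deriv_dist s a) b t = (if t = 0 then 0 else - fs (of_nat t) (br a b (t - 1)))" for t
    using bracket_deriv(1)[OF V_D[OF a] V_D[OF b]] by (intro ext) simp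
qed

lemma V_bound:
  assumes "a \<in> V" "b \<in> V"
  shows "\<exists>N. (\<forall>j\<ge>N. br a b j = 0) \<and> (\<forall>j\<ge>N. br b a j = 0)"
proof -
  obtain N N' where N: "\<forall>t\<ge>N. br a b t = 0" "\<forall>t\<ge>N'. br b a t = 0"
    using V_facts(7)[OF assms] V_facts(7)[OF assms(2,1)] by blast
  then show ?thesis by (intro exI[of _ "max N N'"]) simp
qed

lemma NO_nop: "a \<in> VP p \<Longrightarrow> b \<in> VP q \<Longrightarrow> NO a b = nop p q a b"
  by (rule NO_hom) auto

lemma nop_V: "a \<in> VP p \<Longrightarrow> b \<in> VP q \<Longrightarrow> nop p q a b \<in> VP (p + q)"
  using NO_par[of a p b q] V_NO[of a b] V_D[of "NO a b"] NO_nop[of a p b q] by simp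

lemma br_VP: "a \<in> VP p \<Longrightarrow> b \<in> VP q \<Longrightarrow> br a b n \<in> VP (p + q)"
  using bracket_DP[of a p b q n] V_br[of a b n] by simp

lemma B_quasi_associative: "quasi_associative B"
  unfolding quasi_associative_def vcomm_def B_simps
proof (intro allI ballI)
  fix p q a b c assume h: "a \<in> VP p" "b \<in> VP q" and c: "c \<in> V"
  have V: "a \<in> V" "b \<in> V" using h by auto
  let ?d = "NO a b - koszul p q (NO b a)"
  have dV: "?d \<in> V" by (intro V_diff V_koszul V_NO V)
  show "NO ?d c = NO a (NO b c) - koszul p q (NO b (NO a c))"
    using c
  proof (induction rule: V_homogeneous_induct)
    case (homogeneous r c)
    have "nop q p b a \<in> VP (p + q)" using nop_V[OF h(2,1)] by (simp only: add.commute)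
    then have d: "?d \<in> VP (p + q)"
      unfolding NO_nop[OF h] NO_nop[OF h(2,1)] by (intro VP_diff VP_koszul nop_V h)
    have "NO ?d c = nop (p + q) r ?d c" by (rule NO_nop[OF d homogeneous])
    moreover have "NO a (NO b c) = nop p (q + r) a (nop q r b c)"
      using NO_nop[OF h(1) nop_V[OF h(2) homogeneous]] unfolding NO_nop[OF h(2) homogeneous] .
    moreover have "NO b (NO a c) = nop q (p + r) b (nop p r a c)"
      using NO_nop[OF h(2) nop_V[OF h(1) homogeneous]] unfolding NO_nop[OF h(1) homogeneous] .
    moreover have "nop (p + q) r ?d c v = nop p (q + r) a (nop q r b c) v - koszul p q (nop q (p + r) b (nop p r a c) v)" for v
      unfolding NO_nop[OF h] NO_nop[OF h(2,1)]
      by (rule nop_quasi_assoc) (use h homogeneous nop_V[OF h] nop_V[OF h(2,1)] nop_V[OF h(2) homogeneous] nop_V[OF h(1) homogeneous] in \<open>simp_all only: Int_iff mem_Collect_eq simp_thms\<close>)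
    ultimately show ?case by (intro ext, subst minus_apply) (simp only: koszul_fun)
  next
    case (add c d)
    note D = V_D[OF add(1)] V_D[OF add(2)] V_D[OF dV] V_D[OF V(1)] V_D[OF V(2)] V_D[OF V_NO]
    have 1: "NO ?d (c + d) = NO ?d c + NO ?d d" by (rule NO_add(2)[OF D(1-3)])
    have 2: "NO b (c + d) = NO b c + NO b d" by (rule NO_add(2)[OF D(1,2,5)])
    have 3: "NO a (c + d) = NO a c + NO a d" by (rule NO_add(2)[OF D(1,2,4)])
    have 4: "NO a (NO b c + NO b d) = NO a (NO b c) + NO a (NO b d)"
      by (rule NO_add(2)[OF D(6) D(6) D(4)]) (rule V add)+
    have 5: "NO b (NO a c + NO a d) = NO b (NO a c) + NO b (NO a d)"
      by (rule NO_add(2)[OF D(6) D(6) D(5)]) (rule V add)+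
    show ?case unfolding 1 2 3 4 5 add(3,4) koszul_add by (simp only: add_diff_add)
  qed
qed

lemma subst_fun: "subst_mu_minus_lambda fs G i j v = subst_mu_minus_lambda s (\<lambda>i j. G i j v) i j"
  by (simp add: subst_mu_minus_lambda_def sum_fun_apply)

lemma subst_add:
  "subst_mu_minus_lambda fs (\<lambda>i j. G i j + H i j) i j = subst_mu_minus_lambda fs G i j + subst_mu_minus_lambda fs H i j"
  by (intro ext, simp only: plus_fun_apply subst_fun)
    (simp only: subst_mu_minus_lambda_def scale_right_distrib sum.distrib)

lemma B_Jacobi: "lambda_Jacobi B"
  unfolding lambda_Jacobi_def B_simps
proof (intro allI ballI)
  fix p q a b c i j assume h: "a \<in> VP p" "b \<in> VP q" and c: "c \<in> V"
  have V: "a \<in> V" "b \<in> V" using h by auto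
  show "br (br a b i) c j = subst_mu_minus_lambda fs (\<lambda>i j. br a (br b c j) i) i j
       - koszul p q (subst_mu_minus_lambda fs (\<lambda>i j. br b (br a c i) j) i j)"
    using c
  proof (induction rule: V_homogeneous_induct)
    case (homogeneous r c)
    show ?case
      by (rule ext, subst bracket_Jacobi[of a p b q c r])
        (use h homogeneous in \<open>simp_all add: subst_fun koszul_fun\<close>)
  next
    case (add c d)
    note 1 = br_add(2)[OF add(1,2)]
    show ?case
      unfolding 1[OF V_br[OF V]] 1[OF V(1)] 1[OF V(2)]
        br_add(2)[OF V_br[OF V(2) add(1)] V_br[OF V(2) add(2)] V(1)]
        br_add(2)[OF V_br[OF V(1) add(1)] V_br[OF V(1) add(2)] V(2)]
        subst_add koszul_add add(3,4) by (simp only: add_diff_add)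
  qed
qed

lemma B_Wick: "Wick_formula B"
  unfolding Wick_formula_def B_simps
proof (intro allI ballI)
  fix p q a b c n assume h: "a \<in> VP p" "b \<in> VP q" and c: "c \<in> V"
  have V: "a \<in> V" "b \<in> V" using h by auto
  show "br a (NO b c) n = NO (br a b n) c + koszul p q (NO b (br a c n))
      + (\<Sum>i<n. fs (of_nat (n choose i)) (br (br a b i) c (n - 1 - i)))"
    using c
  proof (induction rule: V_homogeneous_induct)
    case (homogeneous r c)
    have "nop q r b c \<in> D" using nop_V[OF h(2) homogeneous] by blast
    then have "br a (nop q r b c) n v = nop (p + q) r (br a b n) c v
        + koszul p q (nop q (p + r) b (br a c n) v)
        + (\<Sum>i<n. s (of_nat (n choose i)) (br (br a b i) c (n - 1 - i) v))" for v
      by (intro bracket_Wick) (use h homogeneous in blast)+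
    then show ?case
      unfolding NO_nop[OF h(2) homogeneous] NO_nop[OF br_VP[OF h] homogeneous]
        NO_nop[OF h(2) br_VP[OF h(1) homogeneous]]
      by (intro ext) (simp only: plus_fun_apply koszul_fun sum_fun_apply)
  next
    case (add c d)
    note D = V_D[OF add(1)] V_D[OF add(2)]
    have 1: "NO b (c + d) = NO b c + NO b d" by (rule NO_add(2)[OF D V_D[OF V(2)]])
    have 2: "NO (br a b n) (c + d) = NO (br a b n) c + NO (br a b n) d"
      by (rule NO_add(2)[OF D V_D[OF V_br[OF V]]])
    have 3: "NO b (br a c n + br a d n) = NO b (br a c n) + NO b (br a d n)"
      by (rule NO_add(2)[OF V_D[OF V_br[OF V(1) add(1)]] V_D[OF V_br[OF V(1) add(2)]] V_D[OF V(2)]])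
    have 4: "fs k (x + y) = fs k x + fs k y" for k x y by (intro ext) (simp add: scale_right_distrib)
    show ?case
      unfolding 1 2 br_add(2)[OF add(1,2) V(1)] 3 br_add(2)[OF add(1,2) V_br[OF V]]
        br_add(2)[OF V_NO[OF V(2) add(1)] V_NO[OF V(2) add(2)] V(1)] 4 sum.distrib koszul_add add(3,4)
      by (simp only: add_ac)
  qed
qed

section \<open>Skew-symmetry and the commutator formula in terms of delta expansions\<close>

lemma divT_B: "divT B j x v = s ((-1) ^ j * (of_int v gchoose j)) (x (v - int j))"
proof -
  have "inverse (fact j) * ((-1) ^ j * fact j * x) = (-1) ^ j * x" for x :: 'k
  proof -
    have "inverse (fact j) * ((-1) ^ j * fact j * x) = (inverse (fact j) * fact j) * ((-1) ^ j * x)"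
      by (simp only: mult_ac)
    then show ?thesis by simp
  qed
  then show ?thesis unfolding divT_def B_simps deriv_pow scale_scale by (simp only:)
qed

text \<open>Skew-symmetry compares the residues of [a(z),b(w)] with those of the signed expansion
  built from the brackets of b and a, its variables exchanged. No locality is assumed, so the
  identity serves both implications.\<close>

lemma skew_rhs:
  assumes "\<And>j. j \<ge> N \<Longrightarrow> br b a j = 0"
  shows "(- koszul p q (finsum (\<lambda>j. fs ((-1) ^ (i + j)) (divT B j (br b a (i + j)))))) v
    = (M ^^ i) (\<lambda>t u. - koszul p q (delta_expansion N (br b a) u t)) 0 v"
proof -
  have f: "finsum (\<lambda>j. fs ((-1) ^ (i + j)) (divT B j (br b a (i + j))))
      = (\<Sum>j<N. fs ((-1) ^ (i + j)) (divT B j (br b a (i + j))))"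
    by (rule finsum_eq) (simp add: assms fun_eq_iff divT_B)
  have c: "(-1) ^ (i + j) * ((-1) ^ j * x) = (-1) ^ i * x" for j and x :: 'k
    by (cases "even j") (simp_all add: power_add)
  have "finsum (\<lambda>j. fs ((-1) ^ (i + j)) (divT B j (br b a (i + j)))) v
      = (\<Sum>j<N. s ((-1) ^ i * (of_int v gchoose j)) (br b a (j + i) (v - int j)))"
    unfolding f sum_fun_apply unfolding divT_B scale_scale c by (simp only: add.commute)
  also have "\<dots> = (M ^^ i) (\<lambda>t u. delta_expansion N (br b a) u t) 0 v"
    by (rule delta_expansion_swap[OF assms, symmetric])
  finally have 1: "finsum (\<lambda>j. fs ((-1) ^ (i + j)) (divT B j (br b a (i + j)))) v = \<dots>" .
  have 2: "(\<lambda>t u. - koszul p q (delta_expansion N (br b a) u t)) = - koszul p q (\<lambda>t u. delta_expansion N (br b a) u t)"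
    by (intro ext) (simp add: koszul_fun)
  have "(M ^^ i) (koszul p q F) = koszul p q ((M ^^ i) F)" for F :: "'w distribution2"
    by (simp add: koszul_def M_pow_minus)
  then show ?thesis
    unfolding 2 by (simp only: M_pow_minus uminus_apply koszul_fun 1)
qed

text \<open>With \<open>commutator_NO\<close>, the commutator formula says exactly that the
  commutator and its delta expansion have the same antidiagonal sums.\<close>

lemma comm_rhs:
  assumes "\<And>j. j \<ge> N \<Longrightarrow> br a b j = 0"
  shows "finsum (\<lambda>i. fs ((-1) ^ i) (divT B (i + 1) (br a b i))) v = comm_coeff (delta_expansion N (br a b)) v"
proof -
  have f: "finsum (\<lambda>i. fs ((-1) ^ i) (divT B (i + 1) (br a b i)))
      = (\<Sum>i<N. fs ((-1) ^ i) (divT B (i + 1) (br a b i)))"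
    by (rule finsum_eq) (simp add: assms fun_eq_iff divT_B)
  have c: "(-1) ^ i * ((-1) ^ (i + 1) * x) = - x" for i and x :: 'k
    by (cases "even i") simp_all
  have idx: "v - int (i + 1) = v - 1 - int i" for i by simp
  show ?thesis
    unfolding f sum_fun_apply unfolding divT_B scale_scale c comm_coeff_delta_expansion
    by (simp only: idx Suc_eq_plus1 sum_negf scale_minus_left)
qed

lemma commutator_NO:
  "a \<in> VP p \<Longrightarrow> b \<in> VP q \<Longrightarrow> vcomm B p q a b v = comm_coeff (K a b) v"
  unfolding vcomm_def B_simps using nop_commutator[of a p b q v]
  by (simp add: NO_nop[of a p b q] NO_nop[of b q a p] koszul_fun)

lemma br_M: "br a b = (\<lambda>j. (M ^^ j) (K a b) 0)"
  by (simp add: fun_eq_iff bracket_eq)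

lemma delta_of_local:
  assumes "\<And>j. j \<ge> N \<Longrightarrow> br a b j = 0" "\<exists>n. (M ^^ n) (K a b) = 0"
  shows "K a b = delta_expansion N (br a b)"
  using local_iff_delta_expansion[of N "K a b"] assms unfolding br_M by simp

text \<open>Locality identifies the commutator of b and a with its expansion; exchanging the
  variables expresses that of a and b through the same coefficients, and \<open>skew_rhs\<close>
  takes the residues.\<close>

lemma local_imp_skew: assumes "local_set m P V" shows "skew_symmetric B"
  unfolding skew_symmetric_def B_simps
proof (intro allI ballI ext)
  fix p q a b i v assume h: "a \<in> VP p" "b \<in> VP q"
  then have "a \<in> V" "b \<in> V" by auto
  then obtain N where "\<forall>j\<ge>N. br a b j = 0" "\<forall>j\<ge>N. br b a j = 0"
    using V_bound[of a b] by blast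
  note N = this[rule_format]
  have "\<exists>n. (M ^^ n) (K b a) = 0" using assms h unfolding local_set_def by blast
  note ba = delta_of_local[OF N(2) this]
  have ab: "K a b = (\<lambda>t u. - koszul p q (delta_expansion N (br b a) u t))"
  proof (intro ext)
    fix t u
    have "K a b t u = - koszul p q (K b a u t)" by (rule K_skew) (use h in blast)+
    then show "K a b t u = - koszul p q (delta_expansion N (br b a) u t)" by (simp only: ba)
  qed
  have "br a b i v = (M ^^ i) (K a b) 0 v" by (simp only: bracket_eq)
  also have "\<dots> = (M ^^ i) (\<lambda>t u. - koszul p q (delta_expansion N (br b a) u t)) 0 v"
    by (simp only: ab)
  also have "\<dots> = (- koszul p q (finsum (\<lambda>j. fs ((-1) ^ (i + j)) (divT B j (br b a (i + j)))))) v"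
    by (rule skew_rhs[OF N(2), symmetric])
  finally show "br a b i v = (- koszul p q (finsum (\<lambda>j. fs ((-1) ^ (i + j)) (divT B j (br b a (i + j)))))) v" .
qed

lemma local_imp_commutator: assumes "local_set m P V" shows "commutator_formula B"
  unfolding commutator_formula_def B_simps
proof (intro allI ballI ext)
  fix p q a b v assume h: "a \<in> VP p" "b \<in> VP q"
  then have "a \<in> V" "b \<in> V" by auto
  then obtain N where "\<forall>j\<ge>N. br a b j = 0" using V_bound[of a b] by blast
  note N = this[rule_format]
  have "\<exists>n. (M ^^ n) (K a b) = 0" using assms h unfolding local_set_def by blast
  note ab = delta_of_local[OF N(1) this]
  have "vcomm B p q a b v = comm_coeff (K a b) v" by (rule commutator_NO[OF h])
  also have "\<dots> = comm_coeff (delta_expansion N (br a b)) v"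
    by (rule arg_cong[where f = "\<lambda>F. comm_coeff F v"]) (rule ab)
  also have "\<dots> = finsum (\<lambda>i. fs ((-1) ^ i) (divT B (i + 1) (br a b i))) v"
    by (rule comm_rhs[OF N, symmetric])
  finally show "vcomm B p q a b v = finsum (\<lambda>i. fs ((-1) ^ i) (divT B (i + 1) (br a b i))) v" .
qed

text \<open>
  The commutator formula only sees antidiagonal sums of modes of \<open>K a b - \<Sum>\<^sub>j (a\<^sub>jb) \<partial>\<^sub>w\<^sup>(\<^sup>j\<^sup>) \<delta>\<close>;
  applying it to all derivatives of \<open>a\<close> separates the individual modes.
\<close>

lemma commutator_imp_neg:
  assumes comm: "commutator_formula B" and b: "b \<in> VP q"
    and "a \<in> VP p" "\<And>j. j \<ge> N \<Longrightarrow> br a b j = 0"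
  shows "(K a b - delta_expansion N (br a b)) (- 1 - int k) (- 1 - int l) = 0"
  using assms(3,4)
proof (induction l arbitrary: k a N rule: less_induct)
  case (less l)
  show ?case using less.prems
  proof (induction k arbitrary: a N)
    case 0
    \<comment> \<open>Mode -1 - l of the formula sums \<open>?E\<close> over the antidiagonal from
      (-1, -1 - l) to (-1 - l, -1). All entries but the first have a second index closer to -1 and
      vanish by the outer induction.\<close>
    let ?E = "K a b - delta_expansion N (br a b)"
    have "vcomm B p q a b = finsum (\<lambda>i. fs ((-1) ^ i) (divT B (i + 1) (br a b i)))"
      by (rule comm[unfolded commutator_formula_def B_simps, rule_format, OF 0(1) b])
    then have "comm_coeff ?E (- 1 - int l) = 0"
      by (simp only: comm_coeff_diff commutator_NO[OF 0(1) b, symmetric] comm_rhs[OF 0(2), symmetric] diff_self)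
    moreover have "comm_coeff ?E (- 1 - int l) = (\<Sum>i<Suc l. ?E (- 1 - int i) (- 1 - int l + int i))"
    proof -
      have "nat (- (- 1 - int l)) = Suc l" "\<not> - 1 - int l \<ge> 0" by simp_all
      then show ?thesis unfolding comm_coeff_def by (simp only: if_False)
    qed
    moreover have "\<dots> = ?E (- 1 - int 0) (- 1 - int l + int 0)
        + (\<Sum>i<l. ?E (- 1 - int (Suc i)) (- 1 - int l + int (Suc i)))"
      by (rule sum.lessThan_Suc_shift)
    moreover have "(\<Sum>i<l. ?E (- 1 - int (Suc i)) (- 1 - int l + int (Suc i))) = 0"
    proof (rule sum.neutral, rule ballI)
      fix i assume "i \<in> {..<l}"
      then have i: "l - Suc i < l" "- 1 - int l + int (Suc i) = - 1 - int (l - Suc i)" by auto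
      show "?E (- 1 - int (Suc i)) (- 1 - int l + int (Suc i)) = 0"
        unfolding i(2) by (rule less.IH[OF i(1) 0(1)]) (rule 0(2))
    qed
    ultimately show ?case by simp
  next
    case (Suc k)
    \<comment> \<open>Mode -1 - k of the derivative is k + 1 times mode -2 - k of \<open>a\<close>,
      and k + 1 is invertible in characteristic 0. Hence the inner induction hypothesis for
      \<open>?T\<close> settles the next index; the brackets of \<open>?T\<close> may extend one
      step further than those of \<open>a\<close>.\<close>
    let ?T = "deriv_dist s a"
    have a: "a \<in> D" "b \<in> D" using Suc.prems(1) b by auto
    have br: "br ?T b = (\<lambda>j v. if j = 0 then 0 else - s (of_nat j) (br a b (j - 1) v))"
      by (intro ext) (simp add: bracket_deriv(1)[OF a])
    have "(K ?T b - delta_expansion (Suc N) (br ?T b)) (- 1 - int k) (- 1 - int l) = 0"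
    proof (rule Suc.IH[OF deriv_DP[OF Suc.prems(1)]])
      show "br ?T b j = 0" if "j \<ge> Suc N" for j
        unfolding br using that Suc.prems(2)[of "j - 1"] by (auto simp: fun_eq_iff)
    qed
    moreover have "K ?T b (- 1 - int k) (- 1 - int l)
        = s (- of_int (- 1 - int k)) (K a b (- 1 - int k - 1) (- 1 - int l))"
      unfolding K_apply deriv_dist_def by (simp only: sc_scale D_C a)
    ultimately have "s (- of_int (- 1 - int k))
        ((K a b - delta_expansion N (br a b)) (- 1 - int k - 1) (- 1 - int l)) = 0"
      unfolding br minus_apply delta_expansion_deriv scale_right_diff_distrib by (simp only:)
    moreover have "(- of_int (- 1 - int k) :: 'k) \<noteq> 0"
      using of_nat_neq_0[of k, where ?'a = 'k] by (simp add: add.commute)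
    ultimately have "(K a b - delta_expansion N (br a b)) (- 1 - int k - 1) (- 1 - int l) = 0"
      by (simp only: scale_eq_0_iff simp_thms)
    moreover have "- 1 - int k - 1 = - 1 - int (Suc k)" by simp
    ultimately show ?case by (simp only:)
  qed
qed

lemma associative_imp_local_homogeneous:
  assumes comm: "commutator_formula B" and skew: "skew_symmetric B"
    and h: "a \<in> VP p" "b \<in> VP q"
  shows "\<exists>n. (M ^^ n) (K a b) = 0"
proof -
  have "a \<in> V" "b \<in> V" using h by auto
  then obtain N where "\<forall>j\<ge>N. br a b j = 0" "\<forall>j\<ge>N. br b a j = 0"
    using V_bound[of a b] by blast
  note N = this[rule_format]
  let ?d = "delta_expansion N (br a b)"
  \<comment> \<open>This distribution is local and agrees with \<open>K a b\<close> for nonnegative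
    \<open>u\<close>. Skew-symmetry gives it the brackets of \<open>a\<close> and \<open>b\<close>
    as residues, so it equals \<open>?d\<close>.\<close>
  let ?D = "\<lambda>t u. - koszul p q (delta_expansion N (br b a) u t)"
  have D: "(M ^^ i) ?D 0 = br a b i" for i
  proof
    fix v
    have eq: "br a b i = - koszul p q (finsum (\<lambda>j. fs ((-1) ^ (i + j)) (divT B j (br b a (i + j)))))"
      using skew[unfolded skew_symmetric_def B_simps, rule_format, OF h] .
    show "(M ^^ i) ?D 0 v = br a b i v"
      unfolding eq by (rule skew_rhs[OF N(2), symmetric])
  qed
  have "(M ^^ N) (delta_expansion N (br b a)) = delta_expansion N (\<lambda>j. br b a (j + N))"
    by (rule M_pow_delta_expansion) (rule N(2))
  also have "\<dots> = 0" by (simp add: delta_expansion_def fun_eq_iff N)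
  finally have "(M ^^ N) (delta_expansion N (br b a)) = 0" .
  then have 0: "(M ^^ N) (\<lambda>t u. delta_expansion N (br b a) u t) = 0"
    using M_pow_swap[of N "delta_expansion N (br b a)"] by (intro ext) simp
  have "?D = - koszul p q (\<lambda>t u. delta_expansion N (br b a) u t)" by (intro ext) (simp add: koszul_fun)
  then have "(M ^^ N) ?D = 0" by (simp only: M_pow_minus koszul_def 0 if_cancel minus_zero split: if_split)
      (simp add: M_pow_minus 0)
  then have "?D = delta_expansion N (\<lambda>j. (M ^^ j) ?D 0)"
    using local_iff_delta_expansion[of N ?D] D N(1) by auto
  then have Dd: "?D = ?d" by (simp only: D)
  have "K a b = ?d"
  proof (intro ext)
    fix t u :: int
    consider "t \<ge> 0" | "u \<ge> 0" | "t < 0" "u < 0" by linarith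
    then show "K a b t u = ?d t u"
    proof cases
      case 1
      then show ?thesis using delta_expansion_nonneg[of N "K a b" t u] N(1) unfolding br_M by simp
    next
      case 2
      have "K a b t u = - koszul p q (K b a u t)" by (rule K_skew) (use h in blast)+
      also have "K b a u t = delta_expansion N (br b a) u t"
        using delta_expansion_nonneg[of N "K b a" u t] N(2) 2 unfolding br_M by simp
      also have "- koszul p q \<dots> = ?d t u" using fun_cong[OF fun_cong[OF Dd]] .
      finally show ?thesis .
    next
      case 3
      then have tu: "t = - 1 - int (nat (- 1 - t))" "u = - 1 - int (nat (- 1 - u))" by auto
      have "(K a b - ?d) (- 1 - int (nat (- 1 - t))) (- 1 - int (nat (- 1 - u))) = 0"
        by (rule commutator_imp_neg[OF comm h(2,1) N(1)])
      then show ?thesis unfolding tu[symmetric] by simp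
    qed
  qed
  then show ?thesis using local_iff_delta_expansion[of N "K a b"] N(1) unfolding br_M by simp
qed

lemma associative_imp_local:
  assumes "commutator_formula B" "skew_symmetric B"
  shows "local_set m P V"
  unfolding local_set_def
proof (intro ballI)
  fix a b assume ab: "a \<in> V" "b \<in> V"
  note D = V_D[OF ab(1)] V_D[OF ab(2)]
  have hom: "PP a p \<in> VP p" "PP b p \<in> VP p" for p
    using PP_DP[OF D(1)] PP_DP[OF D(2)] V_PP[OF ab(1)] V_PP[OF ab(2)] by auto
  have "\<forall>p q. \<exists>n. (M ^^ n) (K (PP a p) (PP b q)) = 0"
    using associative_imp_local_homogeneous[OF assms hom(1) hom(2)] by blast
  then obtain n where n: "\<And>p q. (M ^^ n p q) (K (PP a p) (PP b q)) = 0" by metis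
  define N where "N = n 0 0 + n 0 1 + n 1 0 + n 1 1"
  have N: "(M ^^ N) (K (PP a p) (PP b q)) = 0" for p q
  proof -
    have "n p q \<le> N" unfolding N_def by (cases p; cases q) simp_all
    then show ?thesis by (rule M_pow_zero_mono[OF n])
  qed
  have "K a b = K (PP a 0 + PP a 1) (PP b 0 + PP b 1)" using PP_sum[OF D(1)] PP_sum[OF D(2)] by simp
  also have "\<dots> = K (PP a 0) (PP b 0) + K (PP a 0) (PP b 1) + (K (PP a 1) (PP b 0) + K (PP a 1) (PP b 1))"
    by (simp only: K_add PP_D D D_add add_ac)
  finally have "(M ^^ N) (K a b) = 0" by (simp only: M_pow_add N add_0)
  then show "\<exists>n. (M ^^ n) (K a b) = 0" by blast
qed

theorem associative_iff_local:
  "associative_vertex_algebra (restrict_valg (dist_valg s m e P \<sigma> D) V) \<longleftrightarrow> local_set m P V"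
proof
  assume "associative_vertex_algebra B"
  then have "commutator_formula B" "skew_symmetric B"
    unfolding associative_vertex_algebra_def by simp_all
  then show "local_set m P V" by (rule associative_imp_local)
next
  assume loc: "local_set m P V"
  show "associative_vertex_algebra B"
    unfolding associative_vertex_algebra_def
    by (intro conjI B_vertex_algebra B_quasi_associative B_Jacobi B_Wick local_imp_skew[OF loc]
        local_imp_commutator[OF loc])
qed

end


section \<open>Fields on a vector space\<close>

locale super_vector_space = super_space_on s PE UNIV
  for s :: "'k::field_char_0 \<Rightarrow> 'e::ab_group_add \<Rightarrow> 'e" and PE
begin

abbreviation fsc :: "'k \<Rightarrow> ('e \<Rightarrow> 'e) \<Rightarrow> 'e \<Rightarrow> 'e" where
  "fsc \<equiv> \<lambda>c f v. s c (f v)"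

abbreviation Lin :: "('e \<Rightarrow> 'e) set" where
  "Lin \<equiv> {f. Vector_Spaces.linear s s f}"

text \<open>Pointwise convergence with the vector space discrete. Only homogeneous vectors are
  tested, which makes the neighbourhoods stable under parity projections.\<close>

definition point_nbhds :: "('e \<Rightarrow> 'e) set set" where
  "point_nbhds = {{f. \<forall>v\<in>F. f v = 0} | F. finite F \<and> F \<subseteq> (\<Union>q. PE q)}"

lemma Lin_iff: "f \<in> Lin \<longleftrightarrow> (\<forall>x y. f (x + y) = f x + f y) \<and> (\<forall>c x. f (s c x) = s c (f x))"
  using vector_space_axioms by (simp add: Vector_Spaces.linear_iff)

lemma Lin_add: "f \<in> Lin \<Longrightarrow> f (x + y) = f x + f y" and Lin_scale: "f \<in> Lin \<Longrightarrow> f (s c x) = s c (f x)"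
  unfolding Lin_iff by blast+

lemma Lin_zero: "f \<in> Lin \<Longrightarrow> f 0 = 0"
  using Lin_scale[of f 0 0] by simp

lemmas pp_UNIV = pp_P[OF UNIV_I] pp_add[OF UNIV_I UNIV_I] pp_scale[OF UNIV_I] pp_sum[OF UNIV_I]

lemma Lin_pr: "f \<in> Lin \<Longrightarrow> f (pp v 0) + f (pp v 1) = f v"
  by (simp only: Lin_add[symmetric] pp_UNIV(4))

lemma end_par_iff: "f \<in> end_par s PE p \<longleftrightarrow> f \<in> Lin \<and> (\<forall>q v. v \<in> PE q \<longrightarrow> f v \<in> PE (p + q))"
  unfolding end_par_def by auto

definition fpart :: "('e \<Rightarrow> 'e) \<Rightarrow> bit \<Rightarrow> 'e \<Rightarrow> 'e" where
  "fpart f p = (\<lambda>v. pp (f (pp v 0)) p + pp (f (pp v 1)) (p + 1))"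

lemma fpart_hom:
  assumes "f \<in> Lin" "v \<in> PE q"
  shows "fpart f p v = pp (f v) (p + q)"
proof (cases q)
  case zero
  then show ?thesis using pp_hom[OF assms(2)] Lin_zero[OF assms(1)] by (simp add: fpart_def pp_zero)
next
  case one
  then show ?thesis using pp_hom[OF assms(2)] Lin_zero[OF assms(1)] by (simp add: fpart_def pp_zero)
qed

lemma fpart_end_par: "f \<in> Lin \<Longrightarrow> fpart f p \<in> end_par s PE p"
  unfolding end_par_iff
proof (intro conjI allI impI)
  assume f: "f \<in> Lin"
  show "fpart f p \<in> Lin"
    unfolding Lin_iff fpart_def by (simp only: pp_UNIV(2) pp_UNIV(3) Lin_add[OF f] Lin_scale[OF f] scale_right_distrib add_ac simp_thms)
  show "fpart f p v \<in> PE (p + q)" if "v \<in> PE q" for q v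
    unfolding fpart_hom[OF f that] by (rule pp_UNIV(1))
qed

lemma fpart_sum: "f \<in> Lin \<Longrightarrow> fpart f 0 + fpart f 1 = f"
proof
  fix v assume f: "f \<in> Lin"
  have "(fpart f 0 + fpart f 1) v = (pp (f (pp v 0)) 0 + pp (f (pp v 0)) 1) + (pp (f (pp v 1)) 0 + pp (f (pp v 1)) 1)"
    unfolding fpart_def by simp
  then show "(fpart f 0 + fpart f 1) v = f v" by (simp only: pp_UNIV(4) Lin_pr[OF f])
qed

lemma fun_vs: "vector_space fsc"
  by (rule fun_vector_space)

lemma end_super: "super_space fsc (end_par s PE) Lin"
  unfolding graded_space_def
proof (intro conjI ballI)
  interpret F: vector_space fsc by (rule fun_vs)
  show "vector_space fsc" by (rule fun_vs)
  have L: "0 \<in> Lin" "f + g \<in> Lin" "fsc k f \<in> Lin" if "f \<in> Lin" "g \<in> Lin" for f g k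
    using that unfolding Lin_iff by (simp_all add: scale_right_distrib scale_left_commute)
  have z: "0 \<in> Lin" unfolding Lin_iff by simp
  show "module.subspace fsc Lin"
    by (rule F.subspaceI) (use L z in simp_all)
  fix p
  show "module.subspace fsc (end_par s PE p)"
  proof (rule F.subspaceI)
    show "0 \<in> end_par s PE p" using z by (simp add: end_par_iff P_closed)
    show "f + g \<in> end_par s PE p" if "f \<in> end_par s PE p" "g \<in> end_par s PE p" for f g
      using that L(2)[of f g] by (simp add: end_par_iff P_closed)
    show "fsc k f \<in> end_par s PE p" if "f \<in> end_par s PE p" for k f
      using that L(3)[of f f k] by (simp add: end_par_iff P_closed)
  qed
  show "end_par s PE p \<subseteq> Lin" using end_par_iff by blast
next
  fix f assume f: "f \<in> Lin"
  show "\<exists>!g. decomposition UNIV (end_par s PE) f g"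
  proof
    show "decomposition UNIV (end_par s PE) f (fpart f)"
      unfolding decomposition_bit by (intro conjI allI fpart_end_par f fpart_sum[OF f, symmetric])
    fix g assume "decomposition UNIV (end_par s PE) f g"
    then have g: "\<And>p. g p \<in> end_par s PE p" "f = g 0 + g 1" by (auto simp: decomposition_bit)
    have hom: "g p v = pp (f v) (p + q)" if v: "v \<in> PE q" for p q v
    proof -
      have "g 0 v \<in> PE (0 + q)" "g 1 v \<in> PE (1 + q)" using g(1) v unfolding end_par_iff by blast+
      moreover have "f v = g 0 v + g 1 v" using g(2) by simp
      ultimately show ?thesis by (cases p; cases q) (simp_all add: pp_UNIV(2) pp_hom)
    qed
    show "g = fpart f"
    proof (intro ext)
      fix p v
      have "g p \<in> Lin" using g(1) unfolding end_par_iff by blast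
      then have "g p v = g p (pp v 0) + g p (pp v 1)" by (simp only: Lin_pr)
      then show "g p v = fpart f p v" by (simp add: hom[OF pp_UNIV(1)] fpart_def)
    qed
  qed
qed

lemma end_parity_part: "f \<in> Lin \<Longrightarrow> parity_part (end_par s PE) f = fpart f"
  by (rule component_unique[OF end_super])
    (auto simp: decomposition_bit fpart_end_par fpart_sum)

lemma eventually_point: "a \<in> fields_on s \<Longrightarrow> finite F \<Longrightarrow> \<exists>N. \<forall>t\<ge>N. \<forall>v\<in>F. a t v = 0"
proof -
  assume a: "a \<in> fields_on s" and F: "finite F"
  have "\<forall>v\<in>F. eventually (\<lambda>t. a t v = 0) at_top"
    using a unfolding fields_on_def eventually_at_top_linorder by blast
  then have "eventually (\<lambda>t. \<forall>v\<in>F. a t v = 0) at_top" by (rule eventually_ball_finite[OF F])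
  then show ?thesis unfolding eventually_at_top_linorder .
qed

lemma fields_Lin: "a \<in> fields_on s \<Longrightarrow> a t \<in> Lin"
  by (simp add: fields_on_def)

lemma fieldsI:
  assumes "\<And>t. a t \<in> Lin" "\<And>v. \<exists>N. \<forall>t\<ge>N. a t v = 0"
  shows "a \<in> fields_on s"
  using assms by (simp add: fields_on_def)

lemma Lin_comp: "f \<in> Lin \<Longrightarrow> g \<in> Lin \<Longrightarrow> f \<circ> g \<in> Lin"
  unfolding Lin_iff by simp

lemma Lin_sub: "module.subspace fsc Lin"
  using end_super by (simp add: graded_space_def)

text \<open>At each vector the series is finite, since b_n kills it for large \<open>n\<close>.
  Linearity of the sum follows from a bound common to the vectors involved.\<close>

lemma fields_sum_exists:
  assumes a: "a \<in> fields_on s" and b: "b \<in> fields_on s"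
  shows "\<exists>x. has_sum_in Lin point_nbhds UNIV (\<lambda>n. a (- 1 - int n) \<circ> b (int n)) x"
proof -
  interpret F: vector_space fsc by (rule fun_vs)
  note La = fields_Lin[OF a] and Lb = fields_Lin[OF b]
  let ?f = "\<lambda>n. a (- 1 - int n) \<circ> b (int n)"
  define x where "x = (\<lambda>v. finsum (\<lambda>n. ?f n v))"
  have bound: "\<exists>N. \<forall>n\<ge>N. \<forall>v\<in>F. ?f n v = 0" if F: "finite F" for F
  proof -
    obtain N where N: "\<forall>t\<ge>N. \<forall>v\<in>F. b t v = 0" using eventually_point[OF b F] by blast
    show ?thesis
    proof (intro exI[of _ "nat N"] allI impI ballI)
      fix n v assume "nat N \<le> n" "v \<in> F"
      then have "b (int n) v = 0" using N by simp
      then show "?f n v = 0" using Lin_zero[OF La] by simp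
    qed
  qed
  have x: "x v = (\<Sum>n<N. ?f n v)" if "\<forall>n\<ge>N. ?f n v = 0" for N v
    unfolding x_def by (rule finsum_eq) (use that in blast)
  have "x \<in> Lin"
    unfolding Lin_iff
  proof (intro conjI allI)
    fix v w
    obtain N where N: "\<forall>n\<ge>N. \<forall>u\<in>{v, w, v + w}. ?f n u = 0" using bound[of "{v, w, v + w}"] by auto
    have "x v = (\<Sum>n<N. ?f n v)" "x w = (\<Sum>n<N. ?f n w)" "x (v + w) = (\<Sum>n<N. ?f n (v + w))"
      by (rule x, use N in blast)+
    then show "x (v + w) = x v + x w"
      by (simp only: sum.distrib[symmetric] Lin_add[OF Lin_comp[OF La Lb]])
  next
    fix c v
    obtain N where N: "\<forall>n\<ge>N. \<forall>u\<in>{v, s c v}. ?f n u = 0" using bound[of "{v, s c v}"] by auto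
    have "x v = (\<Sum>n<N. ?f n v)" "x (s c v) = (\<Sum>n<N. ?f n (s c v))"
      by (rule x, use N in blast)+
    then show "x (s c v) = s c (x v)"
      by (simp only: scale_sum_right Lin_scale[OF Lin_comp[OF La Lb]])
  qed
  have "has_sum_in Lin point_nbhds UNIV ?f x"
    unfolding has_sum_in_def
  proof (intro conjI ballI)
    show "range ?f \<subseteq> Lin" using Lin_comp[OF La Lb] by blast
    show "x \<in> Lin" by fact
    fix U assume "U \<in> point_nbhds"
    then obtain F where U: "U = {f. \<forall>v\<in>F. f v = 0}" and F: "finite F" unfolding point_nbhds_def by blast
    obtain N where N: "\<forall>n\<ge>N. \<forall>v\<in>F. ?f n v = 0" using bound[OF F] by blast
    have "x - sum ?f {..<N} \<in> U"
      unfolding U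
    proof (intro CollectI ballI)
      fix v assume "v \<in> F"
      then have "x v = (\<Sum>n<N. ?f n v)" by (intro x) (use N in blast)
      then show "(x - sum ?f {..<N}) v = 0" by (simp only: minus_apply sum_fun_apply) simp
    qed
    moreover have "?f ` (UNIV - {..<N}) \<subseteq> U"
    proof (intro image_subsetI)
      fix n assume "n \<in> UNIV - {..<N}"
      then have "\<forall>v\<in>F. ?f n v = 0" using N by (auto simp only: Diff_iff lessThan_iff not_less)
      then show "?f n \<in> U" unfolding U by blast
    qed
    ultimately show "\<exists>F. finite F \<and> F \<subseteq> UNIV \<and> ?f ` (UNIV - F) \<subseteq> U \<and> x - sum ?f F \<in> U"
      by (intro exI[of _ "{..<N}"] conjI) simp_all
  qed
  then show ?thesis by blast
qed

lemma point_sum_finsum: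
  assumes h: "has_sum_in Lin point_nbhds UNIV f x"
  shows "(\<lambda>v. finsum (\<lambda>n. f n v)) = x"
proof
  fix v
  have L: "f n \<in> Lin" "x \<in> Lin" for n using h unfolding has_sum_in_def by auto
  \<comment> \<open>Neighbourhoods test homogeneous vectors only, so \<open>v\<close> is replaced by
    its two components.\<close>
  let ?U = "{f. \<forall>u\<in>{pp v 0, pp v 1}. f u = 0} :: ('e \<Rightarrow> 'e) set"
  have "?U \<in> point_nbhds" unfolding point_nbhds_def using pp_UNIV(1) by blast
  then have "\<exists>F. finite F \<and> F \<subseteq> UNIV \<and> f ` (UNIV - F) \<subseteq> ?U \<and> x - sum f F \<in> ?U"
    using h unfolding has_sum_in_def by (elim conjE) (rule bspec)
  then obtain F where F: "finite F" "f ` (UNIV - F) \<subseteq> ?U" "x - sum f F \<in> ?U"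
    by (elim exE conjE)
  have U: "g v = 0" if "g \<in> ?U" "g \<in> Lin" for g
    using that(1) Lin_pr[OF that(2), of v] by simp
  have "f n v = 0" if "n \<notin> F" for n
    using F(2) that by (intro U L) blast
  then have "finsum (\<lambda>n. f n v) = (\<Sum>n\<in>F. f n v)"
    unfolding finsum_def by (intro sum.mono_neutral_left F(1)) auto
  moreover have "x u = (\<Sum>n\<in>F. f n u)" if "u \<in> {pp v 0, pp v 1}" for u
    using F(3) that by (auto simp: sum_fun_apply)
  then have "x (pp v 0) + x (pp v 1) = (\<Sum>n\<in>F. f n (pp v 0) + f n (pp v 1))"
    by (simp add: sum.distrib)
  then have "x v = (\<Sum>n\<in>F. f n v)" by (simp only: Lin_pr L)
  ultimately show "finsum (\<lambda>n. f n v) = x v" by simp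
qed

lemma End_mode_algebra:
  "mode_algebra fsc (end_par s PE) Lin point_nbhds (\<circ>) id (\<lambda>f v. finsum (\<lambda>n. f n v)) (fields_on s)"
proof (intro mode_algebra.intro mode_space.intro super_space_on.intro
    super_space_on_axioms.intro char0_space.intro mode_space_axioms.intro mode_algebra_axioms.intro)
  interpret F: vector_space fsc by (rule fun_vs)
  show "vector_space fsc" by (rule fun_vs)
  show "super_space fsc (end_par s PE) Lin" by (rule end_super)
  fix U assume "U \<in> point_nbhds"
  then obtain F where U: "U = {f. \<forall>v\<in>F. f v = 0}" and F: "finite F" "F \<subseteq> (\<Union>q. PE q)"
    unfolding point_nbhds_def by blast
  show "module.subspace fsc U"
    unfolding U by (rule F.subspaceI) simp_all
  show "parity_part (end_par s PE) f p \<in> U" if "f \<in> U" "f \<in> Lin" for f p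
    unfolding U end_parity_part[OF that(2)]
  proof (intro CollectI ballI)
    fix v assume v: "v \<in> F"
    then obtain q where "v \<in> PE q" using F(2) by blast
    then have "fpart f p v = pp (f v) (p + q)" by (rule fpart_hom[OF that(2)])
    also have "f v = 0" using that(1) v unfolding U by blast
    finally show "fpart f p v = 0" by (simp only: pp_zero)
  qed
  show "\<exists>U'\<in>point_nbhds. \<forall>x\<in>U' \<inter> Lin. c \<circ> x \<in> U" if "c \<in> Lin" for c
    using \<open>U \<in> point_nbhds\<close> Lin_zero[OF that] by (intro bexI[of _ U]) (simp_all add: U)
  show "\<exists>U'\<in>point_nbhds. \<forall>x\<in>U' \<inter> Lin. x \<circ> c \<in> U" if "c \<in> Lin" for c
  proof -
    \<comment> \<open>For \<open>x \<circ> c\<close> to vanish on \<open>F\<close>, the map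
      \<open>x\<close> has to kill the vectors \<open>c v\<close>, which are split to stay
      homogeneous.\<close>
    let ?F = "(\<lambda>v. pp (c v) 0) ` F \<union> (\<lambda>v. pp (c v) 1) ` F"
    have "{f. \<forall>v\<in>?F. f v = 0} \<in> point_nbhds"
      unfolding point_nbhds_def using F(1) pp_UNIV(1) by blast
    moreover have "x \<circ> c \<in> U" if x: "x \<in> {f. \<forall>v\<in>?F. f v = 0} \<inter> Lin" for x
      unfolding U
    proof (intro CollectI ballI)
      fix v assume "v \<in> F"
      then have "x (pp (c v) 0) = 0" "x (pp (c v) 1) = 0" using x by blast+
      then show "(x \<circ> c) v = 0" using Lin_pr[of x "c v"] x by simp
    qed
    ultimately show ?thesis by blast
  qed
  show "\<exists>N. \<forall>t\<ge>N. \<forall>x\<in>Lin. x \<circ> a t \<in> U" if a: "a \<in> fields_on s" for a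
  proof -
    obtain N where N: "\<forall>t\<ge>N. \<forall>v\<in>F. a t v = 0" using eventually_point[OF a F(1)] by blast
    show ?thesis
    proof (intro exI[of _ N] allI impI ballI)
      fix t x assume "N \<le> t" "x \<in> Lin"
      then show "x \<circ> a t \<in> U" using N Lin_zero[of x] by (simp add: U)
    qed
  qed
next
  fix f assume f: "f \<in> Lin" and z: "\<And>U. U \<in> point_nbhds \<Longrightarrow> f \<in> U"
  show "f = 0"
  proof
    fix v
    have "{f. \<forall>u\<in>{pp v 0, pp v 1}. f u = 0} \<in> point_nbhds"
      unfolding point_nbhds_def using pp_UNIV(1) by blast
    from z[OF this] show "f v = 0 v" using Lin_pr[OF f, of v] by simp
  qed
next
  fix f g h :: "'e \<Rightarrow> 'e" and k
  show "f \<circ> g \<in> Lin" if "f \<in> Lin" "g \<in> Lin" using that by (rule Lin_comp)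
  show "(f + g) \<circ> h = (f \<circ> h) + (g \<circ> h)" by (simp add: fun_eq_iff)
  show "f \<circ> (g + h) = (f \<circ> g) + (f \<circ> h)" if "f \<in> Lin" using Lin_add[OF that] by (simp add: fun_eq_iff)
  show "fsc k f \<circ> g = fsc k (f \<circ> g)" by (simp add: fun_eq_iff)
  show "f \<circ> fsc k g = fsc k (f \<circ> g)" if "f \<in> Lin" using Lin_scale[OF that] by (simp add: fun_eq_iff)
  show "(f \<circ> g) \<circ> h = f \<circ> (g \<circ> h)" by (rule comp_assoc)
  show "f \<circ> g \<in> end_par s PE (p + q)" if "f \<in> end_par s PE p" "g \<in> end_par s PE q" for p q
    unfolding end_par_iff
  proof (intro conjI allI impI)
    show "f \<circ> g \<in> Lin" using that unfolding end_par_iff by (elim conjE) (rule Lin_comp)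
    show "(f \<circ> g) v \<in> PE (p + q + r)" if "v \<in> PE r" for r v
    proof -
      have "g v \<in> PE (q + r)" using \<open>g \<in> _\<close> that unfolding end_par_iff by blast
      then have "f (g v) \<in> PE (p + (q + r))" using \<open>f \<in> _\<close> unfolding end_par_iff by blast
      then show ?thesis by (simp only: add.assoc o_apply)
    qed
  qed
  show "id \<in> end_par s PE 0" unfolding end_par_iff Lin_iff by simp
  show "id \<circ> f = f" "f \<circ> id = f" by simp_all
next
  interpret F: vector_space fsc by (rule fun_vs)
  fix a b t k i c p
  show "0 \<in> fields_on s" by (rule fieldsI) (use F.subspace_0[OF Lin_sub] in auto)
  assume a: "a \<in> fields_on s"
  note L = fields_Lin[OF a]
  have ev: "\<exists>N. \<forall>t\<ge>N. a t v = 0" for v using a by (simp add: fields_on_def)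
  show "a t \<in> Lin" by (rule L)
  show "a + b \<in> fields_on s" if b: "b \<in> fields_on s"
  proof (rule fieldsI)
    have "a t + b t \<in> Lin" for t by (rule F.subspace_add[OF Lin_sub L fields_Lin[OF b]])
    then show "(a + b) t \<in> Lin" for t by (subst plus_fun_apply)
    fix v
    obtain N N' where N: "\<forall>t\<ge>N. a t v = 0" "\<forall>t\<ge>N'. b t v = 0"
      using ev[of v] b unfolding fields_on_def by blast
    then show "\<exists>N. \<forall>t\<ge>N. (a + b) t v = 0" by (intro exI[of _ "max N N'"]) simp
  qed
  show "(\<lambda>t. fsc k (a t)) \<in> fields_on s"
  proof (rule fieldsI)
    show "fsc k (a t) \<in> Lin" for t by (rule F.subspace_scale[OF Lin_sub L])
    fix v
    obtain N where "\<forall>t\<ge>N. a t v = 0" using ev[of v] by blast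
    then show "\<exists>N. \<forall>t\<ge>N. fsc k (a t) v = 0" by (intro exI[of _ N]) simp
  qed
  show "(\<lambda>t. a (t + i)) \<in> fields_on s"
  proof (rule fieldsI)
    fix v
    obtain N where "\<forall>t\<ge>N. a t v = 0" using ev[of v] by blast
    then show "\<exists>N. \<forall>t\<ge>N. a (t + i) v = 0" by (intro exI[of _ "N - i"]) simp
  qed (rule L)
  show "(\<lambda>t. c \<circ> a t) \<in> fields_on s" if c: "c \<in> Lin"
  proof (rule fieldsI)
    fix v
    obtain N where "\<forall>t\<ge>N. a t v = 0" using ev[of v] by blast
    then show "\<exists>N. \<forall>t\<ge>N. (c \<circ> a t) v = 0" using Lin_zero[OF c] by (intro exI[of _ N]) simp
  qed (rule Lin_comp[OF c L])
  show "(\<lambda>t. a t \<circ> c) \<in> fields_on s" if c: "c \<in> Lin"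
  proof (rule fieldsI)
    fix v
    obtain N where "\<forall>t\<ge>N. a t (c v) = 0" using ev[of "c v"] by blast
    then show "\<exists>N. \<forall>t\<ge>N. (a t \<circ> c) v = 0" by (intro exI[of _ N]) simp
  qed (rule Lin_comp[OF L c])
  show "(\<lambda>t. parity_part (end_par s PE) (a t) p) \<in> fields_on s"
  proof (rule fieldsI)
    show "parity_part (end_par s PE) (a t) p \<in> Lin" for t
      unfolding end_parity_part[OF L] using fpart_end_par[OF L] end_par_iff by blast
    fix v
    obtain N where "\<forall>t\<ge>N. \<forall>u\<in>{pp v 0, pp v 1}. a t u = 0"
      using eventually_point[OF a, of "{pp v 0, pp v 1}"] by auto
    then show "\<exists>N. \<forall>t\<ge>N. parity_part (end_par s PE) (a t) p v = 0"
      unfolding end_parity_part[OF L] by (intro exI[of _ N]) (simp add: fpart_def pp_zero)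
  qed
  show "\<exists>x. has_sum_in Lin point_nbhds UNIV (\<lambda>n. a (- 1 - int n) \<circ> b (int n)) x" if "b \<in> fields_on s"
    by (rule fields_sum_exists[OF a that])
next
  fix f :: "nat \<Rightarrow> 'e \<Rightarrow> 'e" and x assume "has_sum_in Lin point_nbhds UNIV f x"
  then show "(\<lambda>v. finsum (\<lambda>n. f n v)) = x" by (rule point_sum_finsum)
qed

lemma End_associative_iff_local:
  assumes "vertex_subalgebra (End_v s PE) V"
  shows "associative_vertex_algebra (restrict_valg (End_v s PE) V) \<longleftrightarrow> local_set (\<circ>) (end_par s PE) V"
proof -
  have "mode_subalgebra fsc (end_par s PE) Lin point_nbhds (\<circ>) id (\<lambda>f v. finsum (\<lambda>n. f n v)) (fields_on s) V"
    using assms unfolding End_v_def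
    by (intro mode_subalgebra.intro mode_subalgebra_axioms.intro End_mode_algebra)
  then show ?thesis unfolding End_v_def by (rule mode_subalgebra.associative_iff_local)
qed

end


section \<open>FZ-complete algebras\<close>

locale FZ_algebra = super_space_on s P UNIV
  for s :: "'k::field_char_0 \<Rightarrow> 'a::{ring,monoid_mult} \<Rightarrow> 'a" and P +
  fixes \<rho> :: rat and G :: "rat \<Rightarrow> 'a set" and \<tau> :: "rat \<Rightarrow> 'a topology"
  assumes rho: "\<rho> \<noteq> 0" "inverse \<rho> \<in> \<nat>" and FZ: "FZ_complete \<rho> s P G \<tau>"
begin

abbreviation WT :: "rat set" where "WT \<equiv> weights \<rho>"

abbreviation cm :: "'a \<Rightarrow> rat \<Rightarrow> 'a" where "cm \<equiv> component WT G"

lemmas FZ_unfolded = FZ[unfolded FZ_complete_def]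

lemmas s_mult = FZ_unfolded[THEN conjunct2, THEN conjunct1, rule_format]
lemmas par_mult = FZ_unfolded[THEN conjunct2, THEN conjunct2, THEN conjunct1, rule_format]
lemmas par_one = FZ_unfolded[THEN conjunct2, THEN conjunct2, THEN conjunct2, THEN conjunct1]

lemmas FZ_grading = FZ_unfolded[THEN conjunct2, THEN conjunct2, THEN conjunct2, THEN conjunct2]

lemmas graded = FZ_grading[THEN conjunct1]
lemmas G_super = FZ_grading[THEN conjunct2, THEN conjunct1, rule_format]
lemmas G_mult = FZ_grading[THEN conjunct2, THEN conjunct2, THEN conjunct1, rule_format]

lemmas FZ_topology = FZ_grading[THEN conjunct2, THEN conjunct2, THEN conjunct2, THEN conjunct2]

lemmas topo = FZ_topology[THEN conjunct1, rule_format]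
lemmas mult_cont = FZ_topology[THEN conjunct2, THEN conjunct1, rule_format]
lemmas coarse = FZ_topology[THEN conjunct2, THEN conjunct2, rule_format]

lemmas top_G = topo[THEN conjunct1]
lemmas add_cont = topo[THEN conjunct2, THEN conjunct1]
lemmas scale_cont = topo[THEN conjunct2, THEN conjunct2, THEN conjunct1]
lemmas Haus = topo[THEN conjunct2, THEN conjunct2, THEN conjunct2, THEN conjunct2, THEN conjunct1]
lemmas complete = topo[THEN conjunct2, THEN conjunct2, THEN conjunct2, THEN conjunct2, THEN conjunct2]

lemma linear_basis: "h \<in> WT \<Longrightarrow> openin (\<tau> h) U \<Longrightarrow> 0 \<in> U \<Longrightarrow>
    \<exists>S W. super_subspace s P S \<and> openin (\<tau> h) W \<and> 0 \<in> W \<and> W \<subseteq> S \<and> S \<subseteq> U"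
  by (rule topo[THEN conjunct2, THEN conjunct2, THEN conjunct2, THEN conjunct1, rule_format]) auto

text \<open>Mode indices shift weights by integers. These are weights because \<rho> is the inverse
  of a natural number.\<close>

lemma WT_of_int: "of_int i \<in> WT"
proof -
  obtain n where n: "inverse \<rho> = of_nat n" using rho(2) by (elim Nats_cases)
  have "of_int i = \<rho> * inverse \<rho> * of_int i" using rho(1) by simp
  also have "\<dots> = \<rho> * of_int (int n * i)" unfolding n by simp
  finally show ?thesis unfolding weights_def by blast
qed

lemma WT_add: "h \<in> WT \<Longrightarrow> k \<in> WT \<Longrightarrow> h + k \<in> WT"
proof -
  assume "h \<in> WT" "k \<in> WT"
  then obtain i j where "h = \<rho> * of_int i" "k = \<rho> * of_int j" unfolding weights_def by blast
  then have "h + k = \<rho> * of_int (i + j)" by (simp add: distrib_left)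
  then show ?thesis unfolding weights_def by blast
qed

lemma WT_minus: "h \<in> WT \<Longrightarrow> - h \<in> WT"
proof -
  assume "h \<in> WT"
  then obtain i where "h = \<rho> * of_int i" unfolding weights_def by blast
  then have "- h = \<rho> * of_int (- i)" by simp
  then show ?thesis unfolding weights_def by blast
qed

lemma WT_diff: "h \<in> WT \<Longrightarrow> k \<in> WT \<Longrightarrow> h - k \<in> WT"
  using WT_add[OF _ WT_minus, of h k] by simp

lemma WT_mode: "h \<in> WT \<Longrightarrow> h - of_int t - 1 \<in> WT"
  using WT_diff[OF WT_diff[OF _ WT_of_int], of h 1 t] WT_of_int[of 1] by (simp add: WT_diff WT_of_int)

section \<open>Weight components\<close>

lemma G_sub: "h \<in> WT \<Longrightarrow> subspace (G h)"
  using graded by (simp add: graded_space_def)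

lemma cm_in: "h \<in> WT \<Longrightarrow> cm x h \<in> G h"
  by (rule component_in[OF graded]) simp_all

lemma cm_add: "cm (x + y) h = cm x h + cm y h"
  by (rule component_add[OF graded]) simp_all

lemma cm_scale: "h \<in> WT \<Longrightarrow> cm (s k x) h = s k (cm x h)"
  by (rule component_scale[OF graded]) simp_all

lemma cm_hom: "h \<in> WT \<Longrightarrow> x \<in> G h \<Longrightarrow> cm x k = (if k = h then x else 0)"
  by (rule component_homogeneous[OF graded])

lemma cm_outside: "h \<notin> WT \<Longrightarrow> cm x h = 0"
  using component_decomposition[OF graded, of x] by (simp add: decomposition_def)

lemma cm_finite: "finite {h. cm x h \<noteq> 0}" and cm_sum: "x = (\<Sum>h | cm x h \<noteq> 0. cm x h)"
  using component_decomposition[OF graded, of x] by (simp_all add: decomposition_def)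

lemma cm_zero: "cm 0 h = 0"
  using cm_add[of 0 0 h] by simp

lemma cm_minus: "cm (- x) h = - cm x h"
  using cm_add[of x "- x" h] cm_zero by (simp add: minus_unique)

lemma cm_diff: "cm (x - y) h = cm x h - cm y h"
  using cm_add[of x "- y" h] cm_minus by simp

lemma cm_eqI: "(\<And>h. h \<in> WT \<Longrightarrow> cm x h = cm y h) \<Longrightarrow> x = y"
proof -
  assume "\<And>h. h \<in> WT \<Longrightarrow> cm x h = cm y h"
  then have "cm x h = cm y h" for h by (cases "h \<in> WT") (simp_all add: cm_outside)
  then have "cm x = cm y" by (intro ext)
  then show "x = y" using cm_sum[of x] cm_sum[of y] by simp
qed

text \<open>Continuity of multiplication is given between single weight spaces; properties stable
  under addition extend to all elements through their finitely many components.\<close>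

lemma grade_induct:
  assumes "Q 0" "\<And>h c. h \<in> WT \<Longrightarrow> c \<in> G h \<Longrightarrow> Q c" "\<And>c d. Q c \<Longrightarrow> Q d \<Longrightarrow> Q (c + d)"
  shows "Q c"
proof -
  have "Q (\<Sum>h\<in>F. cm c h)" if "finite F" for F
    using that
  proof induction
    case (insert h F)
    have "Q (cm c h)" using assms(1) assms(2)[OF _ cm_in, of h c] cm_outside[of h c] by (cases "h \<in> WT") auto
    then show ?case using insert assms(3) by simp
  qed (use assms(1) in simp)
  then show ?thesis using cm_sum[of c] cm_finite[of c] by metis
qed

lemma shift_bij: "k \<in> WT \<Longrightarrow> bij_betw (\<lambda>h. h + k) WT WT"
  by (rule bij_betwI[where g = "\<lambda>h. h - k"]) (auto simp: WT_add WT_diff)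

text \<open>Abstracts left and right multiplication, so that one proof covers both.\<close>

definition graded_action :: "('a \<Rightarrow> 'a \<Rightarrow> 'a) \<Rightarrow> bool" where
  "graded_action f \<longleftrightarrow> (\<forall>c d x. f (c + d) x = f c x + f d x) \<and> (\<forall>c x y. f c (x + y) = f c x + f c y) \<and>
     (\<forall>k\<in>WT. \<forall>h\<in>WT. \<forall>c\<in>G k. continuous_map (\<tau> h) (\<tau> (h + k)) (f c))"

lemma graded_action_left: "graded_action (*)"
  unfolding graded_action_def
proof (intro conjI allI ballI)
  fix k h c assume k: "k \<in> WT" and h: "h \<in> WT" and c: "c \<in> G k"
  have "continuous_map (\<tau> h) (prod_topology (\<tau> k) (\<tau> h)) (\<lambda>x. (c, x))"
    using top_G[OF k] c by (intro continuous_map_pairedI) (simp_all add: continuous_map_const)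
  from continuous_map_compose[OF this mult_cont[OF k h]]
  show "continuous_map (\<tau> h) (\<tau> (h + k)) ((*) c)" by (simp add: o_def add.commute)
qed (simp_all add: distrib_left distrib_right)

lemma graded_action_right: "graded_action (\<lambda>c x. x * c)"
  unfolding graded_action_def
proof (intro conjI allI ballI)
  fix k h c assume k: "k \<in> WT" and h: "h \<in> WT" and c: "c \<in> G k"
  have "continuous_map (\<tau> h) (prod_topology (\<tau> h) (\<tau> k)) (\<lambda>x. (x, c))"
    using top_G[OF k] c by (intro continuous_map_pairedI) (simp_all add: continuous_map_const)
  from continuous_map_compose[OF this mult_cont[OF h k]]
  show "continuous_map (\<tau> h) (\<tau> (h + k)) (\<lambda>x. x * c)" by (simp add: o_def)
qed (simp_all add: distrib_left distrib_right)

context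
  fixes f assumes action: "graded_action f"
begin

lemma action_add: "f (c + d) x = f c x + f d x" "f c (x + y) = f c x + f c y"
  using action by (simp_all add: graded_action_def)

lemma action_zero: "f 0 x = 0" "f c 0 = 0"
  using action_add(1)[of 0 0 x] action_add(2)[of c 0 0] by simp_all

lemma action_cont: "k \<in> WT \<Longrightarrow> h \<in> WT \<Longrightarrow> c \<in> G k \<Longrightarrow> continuous_map (\<tau> h) (\<tau> (h + k)) (f c)"
  using action by (simp add: graded_action_def)

lemma action_G: "k \<in> WT \<Longrightarrow> h \<in> WT \<Longrightarrow> c \<in> G k \<Longrightarrow> x \<in> G h \<Longrightarrow> f c x \<in> G (h + k)"
  using continuous_map_funspace[OF action_cont[of k h c]] top_G[of h] top_G[of "h + k"] WT_add[of h k]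
  by (simp add: Pi_iff)

lemma cm_action:
  assumes k: "k \<in> WT" "c \<in> G k" "h \<in> WT"
  shows "cm (f c x) h = f c (cm x (h - k))"
proof -
  have "cm (f c x) (h - k + k) = f c (cm x (h - k))"
    by (rule component_additive_map[OF graded graded _ shift_bij[OF k(1)]])
      (simp_all add: action_add action_G WT_diff k)
  then show ?thesis by simp
qed

end

text \<open>Weight spaces are super subspaces, so parity projections preserve them and commute with
  weight projections.\<close>

lemma cm_parity: "h \<in> WT \<Longrightarrow> parity_part P (cm x h) p = cm (parity_part P x p) h"
proof -
  assume h: "h \<in> WT"
  have "cm (parity_part P x p) ((\<lambda>i. i) h) = parity_part P (cm x h) p"
  proof (rule component_additive_map[OF graded graded])
    show "parity_part P (x + y) p = parity_part P x p + parity_part P y p" for x y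
      by (rule component_add[OF super]) simp_all
    show "bij_betw (\<lambda>i. i) WT WT" by (simp add: bij_betw_def)
    show "parity_part P y p \<in> G i" if "i \<in> WT" "y \<in> G i" for i y
      using G_super[OF that(1)] that(2) unfolding super_subspace_def by blast
  qed (simp_all add: h)
  then show ?thesis by simp
qed

text \<open>A basis of neighbourhoods of \<open>0\<close> for the product topology on the direct sum of the weight spaces.\<close>

definition FZ_nbhds :: "'a set set" where
  "FZ_nbhds = {U. super_subspace s P U \<and> (\<exists>F W. finite F \<and> F \<subseteq> WT \<and>
     (\<forall>h\<in>F. openin (\<tau> h) (W h) \<and> 0 \<in> W h) \<and> {x. \<forall>h\<in>F. cm x h \<in> W h} \<subseteq> U)}"

lemma nbhd_ex:
  assumes "U \<in> FZ_nbhds"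
  shows "\<exists>F W. finite F \<and> F \<subseteq> WT \<and> (\<forall>h\<in>F. openin (\<tau> h) (W h)) \<and> (\<forall>h\<in>F. 0 \<in> W h) \<and>
    (\<forall>x. (\<forall>h\<in>F. cm x h \<in> W h) \<longrightarrow> x \<in> U)"
proof -
  obtain F W where "finite F" "F \<subseteq> WT" "\<forall>h\<in>F. openin (\<tau> h) (W h) \<and> 0 \<in> W h" "{x. \<forall>h\<in>F. cm x h \<in> W h} \<subseteq> U"
    using assms unfolding FZ_nbhds_def by (elim CollectE conjE exE)
  then show ?thesis by (intro exI[of _ F] exI[of _ W]) (simp add: subset_eq)
qed

lemma nbhd_subspace: "U \<in> FZ_nbhds \<Longrightarrow> subspace U"
  and nbhd_parity: "U \<in> FZ_nbhds \<Longrightarrow> x \<in> U \<Longrightarrow> parity_part P x p \<in> U"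
  unfolding FZ_nbhds_def super_subspace_def by simp_all

lemma nbhd_UNIV: "UNIV \<in> FZ_nbhds"
proof -
  have "super_subspace s P UNIV" unfolding super_subspace_def by (simp add: subspace_UNIV)
  then show ?thesis unfolding FZ_nbhds_def by (auto intro: exI[of _ "{}"])
qed

lemma nbhd_Int:
  assumes U: "U \<in> FZ_nbhds" and U': "U' \<in> FZ_nbhds"
  shows "U \<inter> U' \<in> FZ_nbhds"
proof -
  obtain F W where "finite F" "F \<subseteq> WT" "\<forall>h\<in>F. openin (\<tau> h) (W h)" "\<forall>h\<in>F. 0 \<in> W h"
      "\<forall>x. (\<forall>h\<in>F. cm x h \<in> W h) \<longrightarrow> x \<in> U" using nbhd_ex[OF U] by (elim exE conjE)
    note F = this[rule_format]
  obtain F' W' where "finite F'" "F' \<subseteq> WT" "\<forall>h\<in>F'. openin (\<tau> h) (W' h)" "\<forall>h\<in>F'. 0 \<in> W' h"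
      "\<forall>x. (\<forall>h\<in>F'. cm x h \<in> W' h) \<longrightarrow> x \<in> U'" using nbhd_ex[OF U'] by (elim exE conjE)
    note F' = this[rule_format]
  let ?W = "\<lambda>h. (if h \<in> F then W h else topspace (\<tau> h)) \<inter> (if h \<in> F' then W' h else topspace (\<tau> h))"
  have G0: "0 \<in> topspace (\<tau> h)" if "h \<in> WT" for h using subspace_0[OF G_sub] top_G that by simp
  have "super_subspace s P (U \<inter> U')"
    using U U' unfolding FZ_nbhds_def super_subspace_def by (simp add: subspace_inter)
  moreover have "\<forall>h\<in>F \<union> F'. openin (\<tau> h) (?W h) \<and> 0 \<in> ?W h"
    using F(2-4) F'(2-4) G0 by (auto intro!: openin_Int)
  moreover have "{x. \<forall>h\<in>F \<union> F'. cm x h \<in> ?W h} \<subseteq> U \<inter> U'"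
  proof
    fix x assume x: "x \<in> {x. \<forall>h\<in>F \<union> F'. cm x h \<in> ?W h}"
    have "x \<in> U"
    proof (rule F(5))
      fix h assume "h \<in> F"
      then have "cm x h \<in> ?W h" using x by blast
      then show "cm x h \<in> W h" using \<open>h \<in> F\<close> by simp
    qed
    moreover have "x \<in> U'"
    proof (rule F'(5))
      fix h assume "h \<in> F'"
      then have "cm x h \<in> ?W h" using x by blast
      then show "cm x h \<in> W' h" using \<open>h \<in> F'\<close> by simp
    qed
    ultimately show "x \<in> U \<inter> U'" by blast
  qed
  ultimately show ?thesis
    unfolding FZ_nbhds_def using F(1,2) F'(1,2)
    by (intro CollectI conjI exI[of _ "F \<union> F'"] exI[of _ ?W]) simp_all
qed

lemma nbhd_finite_Int:
  assumes "finite I" "\<And>i. i \<in> I \<Longrightarrow> \<exists>U\<in>FZ_nbhds. \<forall>x\<in>U. Q i x"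
  shows "\<exists>U\<in>FZ_nbhds. \<forall>i\<in>I. \<forall>x\<in>U. Q i x"
  using assms
proof induction
  case empty
  then show ?case using nbhd_UNIV by blast
next
  case (insert i I)
  then obtain U where U: "U \<in> FZ_nbhds" "\<forall>i\<in>I. \<forall>x\<in>U. Q i x" by auto
  obtain U' where U': "U' \<in> FZ_nbhds" "\<forall>x\<in>U'. Q i x" using insert.prems by auto
  show ?case using U(2) U'(2) by (intro bexI[OF _ nbhd_Int[OF U(1) U'(1)]]) auto
qed

text \<open>Continuity of the weight projections. A member of \<open>FZ_nbhds\<close> has to be a
  super subspace, so the preimage of \<open>S\<close> is taken, while the open set \<open>W\<close>
  certifies that it is large enough.\<close>

lemma nbhd_component:
  assumes "h \<in> WT" "openin (\<tau> h) U" "0 \<in> U"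
  shows "\<exists>U'\<in>FZ_nbhds. \<forall>x\<in>U'. cm x h \<in> U"
proof -
  obtain S W where S: "super_subspace s P S" "openin (\<tau> h) W" "0 \<in> W" "W \<subseteq> S" "S \<subseteq> U"
    using linear_basis[OF assms] by blast
  have sub: "subspace S" using S(1) by (simp add: super_subspace_def)
  have "super_subspace s P {x. cm x h \<in> S}"
    unfolding super_subspace_def
  proof (intro conjI ballI allI)
    show "subspace {x. cm x h \<in> S}"
      by (rule subspaceI)
        (simp_all add: cm_zero cm_add cm_scale assms(1) subspace_0[OF sub] subspace_add[OF sub] subspace_scale[OF sub])
    fix x p assume "x \<in> {x. cm x h \<in> S}"
    then have "parity_part P (cm x h) p \<in> S" using S(1) unfolding super_subspace_def by blast
    then show "parity_part P x p \<in> {x. cm x h \<in> S}" by (simp add: cm_parity[OF assms(1)])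
  qed
  moreover have "{x. \<forall>k\<in>{h}. cm x k \<in> W} \<subseteq> {x. cm x h \<in> S}" using S(4) by auto
  ultimately have "{x. cm x h \<in> S} \<in> FZ_nbhds"
    unfolding FZ_nbhds_def using S(2,3) assms(1)
    by (intro CollectI conjI exI[of _ "{h}"] exI[of _ "\<lambda>_. W"]) simp_all
  then show ?thesis using S(5) by (intro bexI[of _ "{x. cm x h \<in> S}"]) auto
qed

lemma nbhd_weight:
  assumes "U \<in> FZ_nbhds" "w \<in> WT"
  shows "\<exists>W. openin (\<tau> w) W \<and> 0 \<in> W \<and> W \<subseteq> U"
proof -
  obtain F W where "finite F" "F \<subseteq> WT" "\<forall>h\<in>F. openin (\<tau> h) (W h)" "\<forall>h\<in>F. 0 \<in> W h"
      "\<forall>x. (\<forall>h\<in>F. cm x h \<in> W h) \<longrightarrow> x \<in> U" using nbhd_ex[OF assms(1)] by (elim exE conjE)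
    note F = this[rule_format]
  let ?W = "if w \<in> F then W w else topspace (\<tau> w)"
  have o: "openin (\<tau> w) ?W" using F(3) by simp
  moreover have "0 \<in> ?W" using F(4) subspace_0[OF G_sub[OF assms(2)]] top_G[OF assms(2)] by simp
  moreover have "?W \<subseteq> U"
  proof
    fix x assume x: "x \<in> ?W"
    then have "x \<in> G w" using openin_subset[OF o] top_G[OF assms(2)] by auto
    note c = cm_hom[OF assms(2) this]
    show "x \<in> U"
    proof (rule F(5))
      fix h assume "h \<in> F"
      then show "cm x h \<in> W h" unfolding c using x F(4) by auto
    qed
  qed
  ultimately show ?thesis by blast
qed

text \<open>For \<open>c\<close> of weight \<open>k\<close>, the component of \<open>f c x\<close>
  at \<open>h\<close> depends only on that of \<open>x\<close> at h - k, and a neighbourhood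
  restricts finitely many \<open>h\<close>. Sums of such \<open>c\<close> are handled by
  intersecting neighbourhoods.\<close>

lemma nbhd_action:
  assumes "graded_action f"
  shows "\<forall>U\<in>FZ_nbhds. \<exists>U'\<in>FZ_nbhds. \<forall>x\<in>U'. f c x \<in> U"
proof (induction c rule: grade_induct)
  case 1
  show ?case
    using nbhd_UNIV subspace_0[OF nbhd_subspace] by (auto simp: action_zero[OF assms])
next
  case (2 k c)
  show ?case
  proof
    fix U assume U: "U \<in> FZ_nbhds"
    obtain F W where "finite F" "F \<subseteq> WT" "\<forall>h\<in>F. openin (\<tau> h) (W h)" "\<forall>h\<in>F. 0 \<in> W h"
      "\<forall>x. (\<forall>h\<in>F. cm x h \<in> W h) \<longrightarrow> x \<in> U" using nbhd_ex[OF U] by (elim exE conjE)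
    note F = this[rule_format]
    have "\<exists>U'\<in>FZ_nbhds. \<forall>x\<in>U'. cm (f c x) h \<in> W h" if h: "h \<in> F" for h
    proof -
      have hW: "h \<in> WT" "h - k \<in> WT" using F(2) h 2(1) WT_diff by auto
      let ?O = "{x \<in> topspace (\<tau> (h - k)). f c x \<in> W h}"
      have "continuous_map (\<tau> (h - k)) (\<tau> h) (f c)"
        using action_cont[OF assms 2(1) hW(2) 2(2)] by simp
      then have o: "openin (\<tau> (h - k)) ?O"
        by (rule openin_continuous_map_preimage) (rule F(3)[OF h])
      have "0 \<in> ?O"
        using F(4)[OF h] subspace_0[OF G_sub[OF hW(2)]] top_G[OF hW(2)] by (simp add: action_zero[OF assms])
      from nbhd_component[OF hW(2) o this] obtain U'
        where "U' \<in> FZ_nbhds" "\<forall>x\<in>U'. cm x (h - k) \<in> ?O" by (elim bexE)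
      then show ?thesis by (intro bexI[of _ U']) (simp_all add: cm_action[OF assms 2 hW(1)])
    qed
    then have "\<exists>U'\<in>FZ_nbhds. \<forall>h\<in>F. \<forall>x\<in>U'. cm (f c x) h \<in> W h"
      by (rule nbhd_finite_Int[OF F(1)])
    then obtain U' where U': "U' \<in> FZ_nbhds" "\<forall>h\<in>F. \<forall>x\<in>U'. cm (f c x) h \<in> W h" by (elim bexE)
    show "\<exists>U'\<in>FZ_nbhds. \<forall>x\<in>U'. f c x \<in> U"
      by (intro bexI[OF _ U'(1)] ballI F(5)) (use U'(2) in simp)
  qed
next
  case (3 c d)
  show ?case
  proof
    fix U assume U: "U \<in> FZ_nbhds"
    obtain U1 where 1: "U1 \<in> FZ_nbhds" "\<forall>x\<in>U1. f c x \<in> U" using bspec[OF 3(1) U] by (elim bexE)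
    obtain U2 where 2: "U2 \<in> FZ_nbhds" "\<forall>x\<in>U2. f d x \<in> U" using bspec[OF 3(2) U] by (elim bexE)
    show "\<exists>U'\<in>FZ_nbhds. \<forall>x\<in>U'. f (c + d) x \<in> U"
      using 1(2) 2(2) subspace_add[OF nbhd_subspace[OF U]]
      by (intro bexI[OF _ nbhd_Int[OF 1(1) 2(1)]]) (simp add: action_add[OF assms])
  qed
qed

lemma FZ_mode_space: "mode_space s P UNIV FZ_nbhds"
proof (intro mode_space.intro mode_space_axioms.intro)
  show "super_space_on s P UNIV" by (rule super_space_on_axioms)
  fix x assume x: "\<And>U. U \<in> FZ_nbhds \<Longrightarrow> x \<in> U"
  have "cm x h = cm 0 h" if h: "h \<in> WT" for h
  proof (rule ccontr)
    assume "cm x h \<noteq> cm 0 h"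
    then have ne: "cm x h \<noteq> 0" using cm_zero by simp
    have "0 \<in> topspace (\<tau> h)" "cm x h \<in> topspace (\<tau> h)"
      using top_G[OF h] cm_in[OF h] subspace_0[OF G_sub[OF h]] by auto
    then have "\<exists>U U'. openin (\<tau> h) U \<and> openin (\<tau> h) U' \<and> 0 \<in> U \<and> cm x h \<in> U' \<and> disjnt U U'"
      using Haus[OF h, unfolded Hausdorff_space_def] ne[symmetric] by (simp only: simp_thms)
    then obtain U U' where U: "openin (\<tau> h) U" "openin (\<tau> h) U'" "0 \<in> U" "cm x h \<in> U'" "disjnt U U'"
      by (elim exE conjE)
    obtain N where "N \<in> FZ_nbhds" "\<forall>x\<in>N. cm x h \<in> U" using nbhd_component[OF h U(1,3)] by blast
    then have "cm x h \<in> U" using x by blast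
    then show False using U(4,5) by (auto simp: disjnt_def)
  qed
  then show "x = 0" by (rule cm_eqI)
qed (simp_all add: nbhd_subspace nbhd_parity)

section \<open>Finite sums of homogeneous distributions\<close>

lemma DW_D: "h \<in> WT \<Longrightarrow> a \<in> dist_weight G h \<Longrightarrow> a \<in> dist_H \<rho> G"
  unfolding dist_H_def by (intro CollectI exI[of _ "{h}"] exI[of _ "\<lambda>_. a"]) simp

lemma DW_zero: "h \<in> WT \<Longrightarrow> 0 \<in> dist_weight G h"
  unfolding dist_weight_def using subspace_0[OF G_sub[OF WT_mode]] by simp

lemma DW_add: "h \<in> WT \<Longrightarrow> a \<in> dist_weight G h \<Longrightarrow> b \<in> dist_weight G h \<Longrightarrow> a + b \<in> dist_weight G h"
  unfolding dist_weight_def using subspace_add[OF G_sub[OF WT_mode]] by simp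

lemma DH_zero: "0 \<in> dist_H \<rho> G"
  unfolding dist_H_def by (intro CollectI exI[of _ "{}"]) simp

lemma DH_add:
  assumes "a \<in> dist_H \<rho> G" "b \<in> dist_H \<rho> G"
  shows "a + b \<in> dist_H \<rho> G"
proof -
  obtain F f where f: "a = (\<Sum>h\<in>F. f h)" "finite F" "F \<subseteq> WT" "\<forall>h\<in>F. f h \<in> dist_weight G h"
    using assms(1) unfolding dist_H_def by (elim CollectE exE conjE)
  obtain F' f' where f': "b = (\<Sum>h\<in>F'. f' h)" "finite F'" "F' \<subseteq> WT" "\<forall>h\<in>F'. f' h \<in> dist_weight G h"
    using assms(2) unfolding dist_H_def by (elim CollectE exE conjE)
  let ?g = "\<lambda>h. (if h \<in> F then f h else 0) + (if h \<in> F' then f' h else 0)"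
  have "(\<Sum>h\<in>F \<union> F'. if h \<in> F then f h else 0) = a"
    unfolding f(1) by (rule sum.mono_neutral_cong_right) (use f(2) f'(2) in auto)
  moreover have "(\<Sum>h\<in>F \<union> F'. if h \<in> F' then f' h else 0) = b"
    unfolding f'(1) by (rule sum.mono_neutral_cong_right) (use f(2) f'(2) in auto)
  ultimately have "a + b = (\<Sum>h\<in>F \<union> F'. ?g h)" by (simp only: sum.distrib)
  moreover have "\<forall>h\<in>F \<union> F'. ?g h \<in> dist_weight G h"
  proof
    fix h assume "h \<in> F \<union> F'"
    then have h: "h \<in> WT" using f(3) f'(3) by blast
    show "?g h \<in> dist_weight G h"
      by (rule DW_add[OF h]) (use f(4) f'(4) DW_zero[OF h] in simp_all)
  qed
  ultimately show ?thesis
    unfolding dist_H_def using f(2,3) f'(2,3)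
    by (intro CollectI exI[of _ "F \<union> F'"] exI[of _ ?g]) simp
qed

lemma DH_induct [consumes 1, case_names weight zero add]:
  assumes "a \<in> dist_H \<rho> G" "\<And>h a. h \<in> WT \<Longrightarrow> a \<in> dist_weight G h \<Longrightarrow> Q a" "Q 0"
    "\<And>a b. Q a \<Longrightarrow> Q b \<Longrightarrow> Q (a + b)"
  shows "Q a"
proof -
  obtain F f where f: "a = (\<Sum>h\<in>F. f h)" "finite F" "F \<subseteq> WT" "\<forall>h\<in>F. f h \<in> dist_weight G h"
    using assms(1) unfolding dist_H_def by (elim CollectE exE conjE)
  have "F \<subseteq> WT \<Longrightarrow> \<forall>h\<in>F. f h \<in> dist_weight G h \<Longrightarrow> Q (\<Sum>h\<in>F. f h)"
    using f(2)
  proof induction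
    case (insert h F)
    then have "Q (f h)" "Q (\<Sum>h\<in>F. f h)" using assms(2) by auto
    then show ?case unfolding sum.insert[OF insert.hyps] by (rule assms(4))
  qed (simp add: assms(3))
  then show ?thesis using f by simp
qed

lemma DW_mode: "a \<in> dist_weight G h \<Longrightarrow> a t \<in> G (h - of_int t - 1)"
  by (simp add: dist_weight_def)

lemma DH_map:
  assumes "a \<in> dist_H \<rho> G" and g: "\<And>x y. g (x + y) = g x + g y"
    "\<And>h x. h \<in> WT \<Longrightarrow> x \<in> G h \<Longrightarrow> g x \<in> G h"
  shows "(\<lambda>t. g (a t)) \<in> dist_H \<rho> G"
  using assms(1)
proof (induction rule: DH_induct)
  case (weight h a)
  then have "(\<lambda>t. g (a t)) \<in> dist_weight G h"
    unfolding dist_weight_def by (simp add: g(2)[OF WT_mode])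
  then show ?case by (rule DW_D[OF weight(1)])
next
  case zero
  have "g 0 = 0" using g(1)[of 0 0] by simp
  then show ?case using DH_zero by (simp add: zero_fun_def)
next
  case (add a b)
  then show ?case using DH_add[OF add] by (simp add: plus_fun_def g(1))
qed

lemma DH_scale: "a \<in> dist_H \<rho> G \<Longrightarrow> (\<lambda>t. s k (a t)) \<in> dist_H \<rho> G"
  by (rule DH_map[where g = "s k"]) (simp_all add: scale_right_distrib subspace_scale[OF G_sub])

lemma DH_par: "a \<in> dist_H \<rho> G \<Longrightarrow> (\<lambda>t. parity_part P (a t) p) \<in> dist_H \<rho> G"
proof (rule DH_map[where g = "\<lambda>x. parity_part P x p"])
  show "parity_part P x p \<in> G h" if "h \<in> WT" "x \<in> G h" for h x
    using G_super[OF that(1)] that(2) unfolding super_subspace_def by blast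
qed (simp_all add: pp_add)

lemma DH_shift: "a \<in> dist_H \<rho> G \<Longrightarrow> (\<lambda>t. a (t + i)) \<in> dist_H \<rho> G"
proof (induction rule: DH_induct)
  case (weight h a)
  have "(\<lambda>t. a (t + i)) \<in> dist_weight G (h - of_int i)"
    unfolding dist_weight_def
  proof (intro CollectI allI)
    fix t
    have "h - of_int (t + i) - 1 = h - of_int i - of_int t - 1" by simp
    then show "a (t + i) \<in> G (h - of_int i - of_int t - 1)" using DW_mode[OF weight(2), of "t + i"] by (simp only:)
  qed
  then show ?case by (rule DW_D[OF WT_diff[OF weight(1) WT_of_int]])
next
  case zero
  show ?case using DH_zero by (simp add: zero_fun_def)
next
  case (add a b)
  then show ?case using DH_add[OF add] by (simp add: plus_fun_def)
qed

lemma DH_action: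
  assumes f: "graded_action f" and "a \<in> dist_H \<rho> G"
  shows "(\<lambda>t. f c (a t)) \<in> dist_H \<rho> G"
proof (induction c rule: grade_induct)
  case 1
  show ?case using DH_zero by (simp add: zero_fun_def action_zero[OF f])
next
  case (3 c d)
  then show ?case using DH_add[OF 3(1) 3(2)] by (simp add: plus_fun_def action_add[OF f])
next
  case (2 k c)
  from assms(2) show ?case
  proof (induction rule: DH_induct)
    case (weight h a)
    have "(\<lambda>t. f c (a t)) \<in> dist_weight G (h + k)"
      unfolding dist_weight_def
    proof (intro CollectI allI)
      fix t
      have "h - of_int t - 1 + k = h + k - of_int t - 1" by simp
      then show "f c (a t) \<in> G (h + k - of_int t - 1)"
        using action_G[OF f 2(1) WT_mode[OF weight(1)] 2(2) DW_mode[OF weight(2), of t]] by (simp only:)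
    qed
    then show ?case by (rule DW_D[OF WT_add[OF weight(1) 2(1)]])
  next
    case zero
    show ?case using DH_zero by (simp add: zero_fun_def action_zero[OF f])
  next
    case (add a b)
    then show ?case using DH_add[OF add] by (simp add: plus_fun_def action_add[OF f])
  qed
qed

lemma low_products_G: "w \<in> WT \<Longrightarrow> low_products s \<rho> G w K \<subseteq> G w"
  unfolding low_products_def
proof (rule span_minimal)
  assume w: "w \<in> WT"
  show "subspace (G w)" by (rule G_sub[OF w])
  show "{x * y |x y l. l \<in> WT \<and> l < of_int K \<and> x \<in> G (w - l) \<and> y \<in> G l} \<subseteq> G w"
  proof clarify
    fix x y l assume l: "l \<in> WT" "x \<in> G (w - l)" "y \<in> G l"
    have "x * y \<in> G (w - l + l)" by (rule G_mult[OF WT_diff[OF w l(1)] l])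
    then show "x * y \<in> G w" by simp
  qed
qed

text \<open>The coarseness axiom at the point 0, passing from the closure to the low products
  themselves.\<close>

lemma low_products_small:
  assumes "w \<in> WT" "openin (\<tau> w) U" "0 \<in> U"
  shows "\<exists>K. low_products s \<rho> G w K \<subseteq> U"
proof -
  obtain K where K: "(+) 0 ` (\<tau> w closure_of low_products s \<rho> G w K) \<subseteq> U"
    using coarse[OF assms] by (elim exE)
  have "low_products s \<rho> G w K \<subseteq> \<tau> w closure_of low_products s \<rho> G w K"
    by (rule closure_of_subset) (simp only: top_G[OF assms(1)] low_products_G[OF assms(1)])
  also have "\<dots> \<subseteq> U" using K by simp
  finally show ?thesis by blast
qed

lemma low_productI:
  assumes "l \<in> WT" "l < of_int K" "x \<in> G (w - l)" "y \<in> G l"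
  shows "x * y \<in> low_products s \<rho> G w K"
  unfolding low_products_def by (rule span_base) (use assms in blast)

text \<open>Mode \<open>t\<close> of a distribution of weight \<open>k\<close> has weight k - t - 1,
  which falls below every bound. Each component of \<open>x * a t\<close> is therefore eventually a
  low product, for all \<open>x\<close> at once.\<close>

lemma DH_null: "a \<in> dist_H \<rho> G \<Longrightarrow> \<forall>U\<in>FZ_nbhds. \<exists>N. \<forall>t\<ge>N. \<forall>x. x * a t \<in> U"
proof (induction rule: DH_induct)
  case zero
  show ?case using subspace_0[OF nbhd_subspace] by simp
next
  case (add a b)
  show ?case
  proof
    fix U assume U: "U \<in> FZ_nbhds"
    obtain N where N: "\<forall>t\<ge>N. \<forall>x. x * a t \<in> U" using bspec[OF add(1) U] by (elim exE)
    obtain N' where N': "\<forall>t\<ge>N'. \<forall>x. x * b t \<in> U" using bspec[OF add(2) U] by (elim exE)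
    show "\<exists>N. \<forall>t\<ge>N. \<forall>x. x * (a + b) t \<in> U"
    proof (intro exI[of _ "max N N'"] allI impI)
      fix t x assume "max N N' \<le> t"
      then have "x * a t + x * b t \<in> U" using N N' by (intro subspace_add[OF nbhd_subspace[OF U]]) simp_all
      then show "x * (a + b) t \<in> U" by (simp add: distrib_left)
    qed
  qed
next
  case (weight k a)
  show ?case
  proof
    fix U assume U: "U \<in> FZ_nbhds"
    obtain F W where "finite F" "F \<subseteq> WT" "\<forall>h\<in>F. openin (\<tau> h) (W h)" "\<forall>h\<in>F. 0 \<in> W h"
      "\<forall>x. (\<forall>h\<in>F. cm x h \<in> W h) \<longrightarrow> x \<in> U" using nbhd_ex[OF U] by (elim exE conjE)
    note F = this[rule_format]
    have "\<forall>h\<in>F. eventually (\<lambda>t::int. \<forall>x. cm (x * a t) h \<in> W h) at_top"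
    proof
      fix h assume h: "h \<in> F"
      then have hW: "h \<in> WT" using F(2) by blast
      obtain K where K: "low_products s \<rho> G h K \<subseteq> W h"
        using low_products_small[OF hW F(3)[OF h] F(4)[OF h]] by (elim exE)
      \<comment> \<open>From this threshold on, k - t - 1 is at most K - 1 and hence below
        K.\<close>
      have "\<forall>t\<ge>\<lceil>k\<rceil> - K. \<forall>x. cm (x * a t) h \<in> W h"
      proof (intro allI impI)
        fix t x assume t: "\<lceil>k\<rceil> - K \<le> t"
        let ?l = "k - of_int t - 1"
        have l: "?l \<in> WT" by (rule WT_mode[OF weight(1)])
        have "k \<le> of_int (t + K)" using t by (simp add: ceiling_le_iff[symmetric] del: of_int_add)
        then have "?l < of_int K" by simp
        have "cm x (h - ?l) * a t \<in> low_products s \<rho> G h K"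
          by (rule low_productI[OF l \<open>?l < of_int K\<close>]) (rule cm_in[OF WT_diff[OF hW l]], rule DW_mode[OF weight(2)])
        then show "cm (x * a t) h \<in> W h"
          using K cm_action[OF graded_action_right l DW_mode[OF weight(2)] hW, of x] by auto
      qed
      then show "eventually (\<lambda>t::int. \<forall>x. cm (x * a t) h \<in> W h) at_top"
        unfolding eventually_at_top_linorder by blast
    qed
    then have "eventually (\<lambda>t. \<forall>h\<in>F. \<forall>x. cm (x * a t) h \<in> W h) at_top"
      by (rule eventually_ball_finite[OF F(1)])
    then obtain N where N: "\<forall>t\<ge>N. \<forall>h\<in>F. \<forall>x. cm (x * a t) h \<in> W h"
      unfolding eventually_at_top_linorder by (elim exE)
    show "\<exists>N. \<forall>t\<ge>N. \<forall>x. x * a t \<in> U"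
      by (intro exI[of _ N] allI impI F(5)) (use N in simp)
  qed
qed

section \<open>Convergence of series of products of modes\<close>

abbreviation HS :: "(nat \<Rightarrow> 'a) \<Rightarrow> 'a \<Rightarrow> bool" where
  "HS \<equiv> has_sum_in UNIV FZ_nbhds UNIV"

text \<open>The axioms provide continuity of addition and scaling; subtraction is obtained by
  scaling with -1.\<close>

lemma minus_cont: "w \<in> WT \<Longrightarrow> l \<in> G w \<Longrightarrow> continuous_map (\<tau> w) (\<tau> w) (\<lambda>y. l - y)"
proof -
  assume w: "w \<in> WT" and l: "l \<in> G w"
  have "continuous_map (\<tau> w) (prod_topology (discrete_topology UNIV) (\<tau> w)) (\<lambda>y. (-1 :: 'k, y))"
    by (intro continuous_map_pairedI) (simp_all add: continuous_map_const)
  from continuous_map_compose[OF this scale_cont[OF w]]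
  have 1: "continuous_map (\<tau> w) (\<tau> w) (\<lambda>y. - y)" by (simp add: o_def)
  have "continuous_map (\<tau> w) (prod_topology (\<tau> w) (\<tau> w)) (\<lambda>y. (l, - y))"
    by (intro continuous_map_pairedI 1) (simp add: continuous_map_const top_G[OF w] l)
  from continuous_map_compose[OF this add_cont[OF w]]
  show ?thesis by (simp add: o_def)
qed

text \<open>The terms tend to 0, and in a linear topology this makes partial sums Cauchy: their late
  differences stay in a subspace. Completeness is applied to the filter generated by the partial
  sums.\<close>

lemma sum_exists_weight:
  assumes w: "w \<in> WT" and f: "\<And>n. f n \<in> G w"
    and low: "\<And>K. \<exists>N. \<forall>n\<ge>N. f n \<in> low_products s \<rho> G w K"
  shows "\<exists>x. HS f x"
proof -
  define p where "p = (\<lambda>N. \<Sum>n<N. f n)"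
  have pG: "p N \<in> G w" for N unfolding p_def by (intro subspace_sum[OF G_sub[OF w]] f)
  have small: "\<exists>N. \<forall>n\<ge>N. f n \<in> U" if U: "openin (\<tau> w) U" "0 \<in> U" for U
  proof -
    obtain K where "low_products s \<rho> G w K \<subseteq> U" using low_products_small[OF w U] by (elim exE)
    moreover obtain N where "\<forall>n\<ge>N. f n \<in> low_products s \<rho> G w K" using low[of K] by (elim exE)
    ultimately show ?thesis by (intro exI[of _ N]) auto
  qed
  let ?F = "filtermap p sequentially"
  have "eventually (\<lambda>(x, y). x - y \<in> U) (?F \<times>\<^sub>F ?F)" if U: "openin (\<tau> w) U" "0 \<in> U" for U
  proof -
    obtain S W where S: "super_subspace s P S" "openin (\<tau> w) W" "0 \<in> W" "W \<subseteq> S" "S \<subseteq> U"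
      using linear_basis[OF w U] by (elim exE conjE)
    have sub: "subspace S" using S(1) by (simp add: super_subspace_def)
    obtain N where N: "\<forall>n\<ge>N. f n \<in> W" using small[OF S(2,3)] by (elim exE)
    have d: "p i - p N \<in> S" if "i \<ge> N" for i
    proof -
      have "p i - p N = (\<Sum>n\<in>{N..<i}. f n)"
        unfolding p_def using sum_diff_nat_ivl[of 0 N i f] that by (simp add: atLeast0LessThan)
      also have "\<dots> \<in> S" using N S(4) by (intro subspace_sum[OF sub]) auto
      finally show ?thesis .
    qed
    have "eventually (\<lambda>x. x - p N \<in> S) ?F"
      unfolding eventually_filtermap eventually_sequentially using d by blast
    then show ?thesis
      unfolding eventually_prod_filter
    proof (intro exI[of _ "\<lambda>x. x - p N \<in> S"] conjI allI impI)
      fix x y assume "x - p N \<in> S" "y - p N \<in> S"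
      then have "(x - p N) - (y - p N) \<in> S" by (rule subspace_diff[OF sub])
      then show "case (x, y) of (x, y) \<Rightarrow> x - y \<in> U" using S(5) by auto
    qed
  qed
  moreover have "?F \<noteq> bot" by (simp add: filtermap_bot_iff)
  moreover have "?F \<le> principal (topspace (\<tau> w))"
    unfolding le_principal eventually_filtermap top_G[OF w] using pG by simp
  ultimately obtain l where l: "limitin (\<tau> w) (\<lambda>x. x) l ?F"
    using complete[OF w, unfolded complete_group_topology_def, rule_format, of ?F] by auto
  have lG: "l \<in> G w" using l top_G[OF w] by (simp add: limitin_def)
  have "HS f l"
    unfolding has_sum_in_def
  proof (intro conjI ballI)
    fix V assume V: "V \<in> FZ_nbhds"
    obtain W where W: "openin (\<tau> w) W" "0 \<in> W" "W \<subseteq> V" using nbhd_weight[OF V w] by (elim exE conjE)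
    obtain N where N: "\<forall>n\<ge>N. f n \<in> W" using small[OF W(1,2)] by (elim exE)
    have "openin (\<tau> w) {y \<in> topspace (\<tau> w). l - y \<in> W}"
      by (rule openin_continuous_map_preimage[OF minus_cont[OF w lG] W(1)])
    moreover have "l \<in> {y \<in> topspace (\<tau> w). l - y \<in> W}" using lG W(2) top_G[OF w] by simp
    ultimately have "eventually (\<lambda>x. x \<in> {y \<in> topspace (\<tau> w). l - y \<in> W}) ?F"
      using l unfolding limitin_def by blast
    then obtain N' where N': "\<forall>n\<ge>N'. p n \<in> {y \<in> topspace (\<tau> w). l - y \<in> W}"
      unfolding eventually_filtermap eventually_sequentially by (elim exE)
    let ?A = "{..<max N N'}"
    have "l - sum f ?A \<in> V" using N'[rule_format, of "max N N'"] W(3) by (auto simp: p_def)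
    moreover have "f ` (UNIV - ?A) \<subseteq> V"
    proof (intro image_subsetI)
      fix n assume "n \<in> UNIV - ?A"
      then have "N \<le> n" by simp
      then show "f n \<in> V" using N W(3) by blast
    qed
    ultimately show "\<exists>F. finite F \<and> F \<subseteq> UNIV \<and> f ` (UNIV - F) \<subseteq> V \<and> l - sum f F \<in> V"
      by (intro exI[of _ ?A]) simp
  qed simp_all
  then show ?thesis by blast
qed

lemma DW_sum_exists:
  assumes h: "h \<in> WT" "a \<in> dist_weight G h" and k: "k \<in> WT" "b \<in> dist_weight G k"
  shows "\<exists>x. HS (\<lambda>n. a (- 1 - int n) * b (int n)) x"
proof (rule sum_exists_weight)
  let ?w = "h + k - 1"
  \<comment> \<open>The weight of the left factor is written as w - l with l the weight of the right
    one, as in the definition of \<open>low_products\<close>.\<close>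
  have idx: "h - of_int (- 1 - int n) - 1 = ?w - (k - of_int (int n) - 1)" for n by simp
  have a: "a (- 1 - int n) \<in> G (?w - (k - of_int (int n) - 1))" for n
    using DW_mode[OF h(2), of "- 1 - int n"] unfolding idx .
  have b: "b (int n) \<in> G (k - of_int (int n) - 1)" for n by (rule DW_mode[OF k(2)])
  show w: "?w \<in> WT" using WT_diff[OF WT_add[OF h(1) k(1)] WT_of_int[of 1]] by simp
  show "a (- 1 - int n) * b (int n) \<in> G ?w" for n
    using G_mult[OF WT_diff[OF w WT_mode[OF k(1), of "int n"]] WT_mode[OF k(1), of "int n"] a b] by (simp only: diff_add_cancel)
  show "\<exists>N. \<forall>n\<ge>N. a (- 1 - int n) * b (int n) \<in> low_products s \<rho> G ?w K" for K
  proof (intro exI[of _ "nat (\<lceil>k\<rceil> - K)"] allI impI)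
    fix n assume "nat (\<lceil>k\<rceil> - K) \<le> n"
    then have "\<lceil>k\<rceil> \<le> int n + K" by simp
    then have "k \<le> of_int (int n + K)" by (simp add: ceiling_le_iff[symmetric] del: of_int_add)
    then have "k - of_int (int n) - 1 < of_int K" by simp
    then show "a (- 1 - int n) * b (int n) \<in> low_products s \<rho> G ?w K"
      by (rule low_productI[OF WT_mode[OF k(1)] _ a b])
  qed
qed

lemma HS_zero: "HS (\<lambda>n. 0) 0"
  by (rule mode_space.hs_zero[OF FZ_mode_space])

lemma HS_add: "HS f x \<Longrightarrow> HS g y \<Longrightarrow> HS (\<lambda>n. f n + g n) (x + y)"
  by (rule mode_space.hs_add[OF FZ_mode_space])

lemma DH_sum_exists:
  assumes "a \<in> dist_H \<rho> G" "b \<in> dist_H \<rho> G"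
  shows "\<exists>x. HS (\<lambda>n. a (- 1 - int n) * b (int n)) x"
  using assms(1)
proof (induction rule: DH_induct)
  case (weight h a)
  from assms(2) show ?case
  proof (induction rule: DH_induct)
    case (weight k b)
    then show ?case using \<open>h \<in> WT\<close> \<open>a \<in> dist_weight G h\<close> by (intro DW_sum_exists)
  next
    case zero
    show ?case using HS_zero by auto
  next
    case (add b b')
    then obtain x y where "HS (\<lambda>n. a (- 1 - int n) * b (int n)) x" "HS (\<lambda>n. a (- 1 - int n) * b' (int n)) y"
      by (elim exE)
    from HS_add[OF this] show ?case by (intro exI[of _ "x + y"]) (simp add: distrib_left)
  qed
next
  case zero
  show ?case using HS_zero by auto
next
  case (add a a')
  then obtain x y where "HS (\<lambda>n. a (- 1 - int n) * b (int n)) x" "HS (\<lambda>n. a' (- 1 - int n) * b (int n)) y"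
    by (elim exE)
  from HS_add[OF this] show ?case by (intro exI[of _ "x + y"]) (simp add: distrib_right)
qed

text \<open>Long initial segments contain the finite sets of the unordered sum, so
  \<open>hs_approx\<close> and the continuous weight projections give the limit in each weight. The
  Hausdorff property makes the definite description unique.\<close>

lemma conv_sum_eq:
  assumes h: "HS f x"
  shows "conv_sum \<rho> G \<tau> f = x"
  unfolding conv_sum_def
proof (rule the_equality)
  show lim: "\<forall>h\<in>WT. limitin (\<tau> h) (\<lambda>N. cm (\<Sum>n<N. f n) h) (cm x h) sequentially"
  proof
    fix k assume k: "k \<in> WT"
    show "limitin (\<tau> k) (\<lambda>N. cm (\<Sum>n<N. f n) k) (cm x k) sequentially"
      unfolding limitin_def
    proof (intro conjI allI impI)
      show "cm x k \<in> topspace (\<tau> k)" using top_G[OF k] cm_in[OF k] by simp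
      fix U assume U: "openin (\<tau> k) U \<and> cm x k \<in> U"
      let ?O = "{z \<in> topspace (\<tau> k). cm x k - z \<in> U}"
      have "openin (\<tau> k) ?O"
        by (rule openin_continuous_map_preimage[OF minus_cont[OF k cm_in[OF k]]]) (use U in blast)
      moreover have "0 \<in> ?O" using U top_G[OF k] subspace_0[OF G_sub[OF k]] by simp
      ultimately obtain V where V: "V \<in> FZ_nbhds" "\<forall>z\<in>V. cm z k \<in> ?O"
        using nbhd_component[OF k] by meson
      obtain F where F: "finite F" "F \<subseteq> UNIV" "f ` (UNIV - F) \<subseteq> V" "x - sum f F \<in> V"
        using mode_space.hsD(3)[OF FZ_mode_space h V(1)] by (elim exE conjE)
      obtain N where N: "F \<subseteq> {..<N}" using finite_nat_iff_bounded F(1) by blast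
      have "cm (\<Sum>n<i. f n) k \<in> U" if "i \<ge> N" for i
      proof -
        have "x - sum f {..<i} \<in> V"
        proof (rule mode_space.hs_approx[OF FZ_mode_space h V(1)])
          have "F \<subseteq> {..<i}" using N that by auto
          then show "f ` (UNIV - {..<i}) \<subseteq> V" using F(3) by blast
        qed simp_all
        then have "cm (x - sum f {..<i}) k \<in> ?O" using V(2) by blast
        then show ?thesis unfolding cm_diff by simp
      qed
      then show "eventually (\<lambda>N. cm (\<Sum>n<N. f n) k \<in> U) sequentially"
        unfolding eventually_sequentially by blast
    qed
  qed
  fix y assume y: "\<forall>h\<in>WT. limitin (\<tau> h) (\<lambda>N. cm (\<Sum>n<N. f n) h) (cm y h) sequentially"
  show "y = x"
  proof (rule cm_eqI)
    fix k assume k: "k \<in> WT"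
    show "cm y k = cm x k"
      by (rule limitin_Hausdorff_unique[OF bspec[OF y k] bspec[OF lim k] _ Haus[OF k]]) simp
  qed
qed

lemma FZ_mode_algebra:
  "mode_algebra s P UNIV FZ_nbhds (*) 1 (conv_sum \<rho> G \<tau>) (dist_H \<rho> G)"
proof (intro mode_algebra.intro mode_algebra_axioms.intro)
  show "mode_space s P UNIV FZ_nbhds" by (rule FZ_mode_space)
  fix x y z c :: 'a and k :: 'k and p q U f a b i t
  show "(x + y) * z = x * z + y * z" "x * (y + z) = x * y + x * z" "x * y * z = x * (y * z)"
    "1 * x = x" "x * 1 = x"
    by (simp_all add: distrib_right distrib_left mult.assoc)
  show "s k x * y = s k (x * y)" "x * s k y = s k (x * y)"
    by (rule s_mult[THEN conjunct1, symmetric], rule s_mult[THEN conjunct2, symmetric])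
  show "x * y \<in> P (p + q)" if "x \<in> P p" "y \<in> P q" by (rule par_mult[OF that])
  show "1 \<in> P 0" by (rule par_one)
  show "\<exists>U'\<in>FZ_nbhds. \<forall>x\<in>U' \<inter> UNIV. c * x \<in> U" if "U \<in> FZ_nbhds" using nbhd_action[OF graded_action_left] that by simp
  show "\<exists>U'\<in>FZ_nbhds. \<forall>x\<in>U' \<inter> UNIV. x * c \<in> U" if "U \<in> FZ_nbhds" using nbhd_action[OF graded_action_right] that by simp
  show "0 \<in> dist_H \<rho> G" by (rule DH_zero)
  show "conv_sum \<rho> G \<tau> f = x" if "HS f x" by (rule conv_sum_eq[OF that])
  show "a + b \<in> dist_H \<rho> G" if "a \<in> dist_H \<rho> G" "b \<in> dist_H \<rho> G" by (rule DH_add[OF that])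
  show "\<exists>x. HS (\<lambda>n. a (- 1 - int n) * b (int n)) x" if "a \<in> dist_H \<rho> G" "b \<in> dist_H \<rho> G"
    by (rule DH_sum_exists[OF that])
  show "\<exists>N. \<forall>t\<ge>N. \<forall>x\<in>UNIV. x * a t \<in> U" if "a \<in> dist_H \<rho> G" "U \<in> FZ_nbhds"
    using DH_null[OF that(1)] that(2) by simp
  assume a: "a \<in> dist_H \<rho> G"
  show "(\<lambda>t. s k (a t)) \<in> dist_H \<rho> G" by (rule DH_scale[OF a])
  show "(\<lambda>t. a (t + i)) \<in> dist_H \<rho> G" by (rule DH_shift[OF a])
  show "(\<lambda>t. c * a t) \<in> dist_H \<rho> G" by (rule DH_action[OF graded_action_left a])
  show "(\<lambda>t. a t * c) \<in> dist_H \<rho> G" by (rule DH_action[OF graded_action_right a])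
  show "(\<lambda>t. parity_part P (a t) p) \<in> dist_H \<rho> G" by (rule DH_par[OF a])
qed simp_all

lemma FZ_associative_iff_local:
  assumes "vertex_subalgebra (FZ_valg \<rho> s P G \<tau>) V"
  shows "associative_vertex_algebra (restrict_valg (FZ_valg \<rho> s P G \<tau>) V) \<longleftrightarrow> local_set (*) P V"
proof -
  have "mode_subalgebra s P UNIV FZ_nbhds (*) 1 (conv_sum \<rho> G \<tau>) (dist_H \<rho> G) V"
    using assms unfolding FZ_valg_def
    by (intro mode_subalgebra.intro mode_subalgebra_axioms.intro FZ_mode_algebra)
  then show ?thesis unfolding FZ_valg_def by (rule mode_subalgebra.associative_iff_local)
qed

end

theorem proposition3p3p9:
  fixes scaleE :: "'k::field_char_0 \<Rightarrow> 'e::ab_group_add \<Rightarrow> 'e"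
    and parE :: "bit \<Rightarrow> 'e set"
    and \<rho> :: rat
    and scaleA :: "'k \<Rightarrow> 'a::{ring,monoid_mult} \<Rightarrow> 'a"
    and parA :: "bit \<Rightarrow> 'a set"
    and wtA :: "rat \<Rightarrow> 'a set"
    and topA :: "rat \<Rightarrow> 'a topology"
  assumes "super_space scaleE parE UNIV"
    and "\<rho> \<noteq> 0" and "inverse \<rho> \<in> \<nat>"
    and "FZ_complete \<rho> scaleA parA wtA topA"
  shows "(\<forall>V. vertex_subalgebra (End_v scaleE parE) V \<longrightarrow>
            (associative_vertex_algebra (restrict_valg (End_v scaleE parE) V) \<longleftrightarrow>
             local_set (\<circ>) (end_par scaleE parE) V)) \<and>
         (\<forall>V. vertex_subalgebra (FZ_valg \<rho> scaleA parA wtA topA) V \<longrightarrow>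
            (associative_vertex_algebra (restrict_valg (FZ_valg \<rho> scaleA parA wtA topA) V) \<longleftrightarrow>
             local_set (*) parA V))"
proof (intro conjI allI impI)
  have "super_space_on scaleE parE UNIV"
    using assms(1) by (intro super_space_on.intro char0_space.intro super_space_on_axioms.intro)
      (simp_all add: graded_space_def)
  then have E: "super_vector_space scaleE parE" by (rule super_vector_space.intro)
  show "associative_vertex_algebra (restrict_valg (End_v scaleE parE) V) \<longleftrightarrow>
      local_set (\<circ>) (end_par scaleE parE) V"
    if "vertex_subalgebra (End_v scaleE parE) V" for V
    by (rule super_vector_space.End_associative_iff_local[OF E that])
  have "super_space scaleA parA UNIV" using assms(4) by (simp add: FZ_complete_def)
  then have "super_space_on scaleA parA UNIV"
    by (intro super_space_on.intro char0_space.intro super_space_on_axioms.intro)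
      (simp_all add: graded_space_def)
  then have A: "FZ_algebra scaleA parA \<rho> wtA topA"
    using assms(2-4) by (intro FZ_algebra.intro FZ_algebra_axioms.intro)
  show "associative_vertex_algebra (restrict_valg (FZ_valg \<rho> scaleA parA wtA topA) V) \<longleftrightarrow>
      local_set (*) parA V"
    if "vertex_subalgebra (FZ_valg \<rho> scaleA parA wtA topA) V" for V
    by (rule FZ_algebra.FZ_associative_iff_local[OF A that])
qed

end
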